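(* Let $X(\mathbb{R})$ be a separable Banach function space such that the Hardy–Littlewood maximal operator $\mathcal{M}$ is bounded on $X(\mathbb{R})$ and on its associate space $X'(\mathbb{R})$. If $\Phi$ is a unital $C^*$-subalgebra of $L^\infty(\mathbb{R})$, then $$\mathcal{MO}^\pi(\Phi)\cap\mathcal{CO}^\pi(SO_{X(\mathbb{R})}^\diamond)=\mathcal{MO}^\pi(\mathbb{C}),$$ where $\mathcal{MO}^\pi(\Phi)=\{aI+\mathcal{K}(X(\mathbb{R})):a\in\Phi\}$, $\mathcal{CO}^\pi(SO_{X(\mathbb{R})}^\diamond)=\{W^0(b)+\mathcal{K}(X(\mathbb{R})):b\in SO_{X(\mathbb{R})}^\diamond\}$ and $\mathcal{MO}^\pi(\mathbb{C})=\{cI+\mathcal{K}(X(\mathbb{R})):c\in\mathbb{C}\}$ are subsets of the Calkin algebra $\mathcal{B}(X(\mathbb{R}))/\mathcal{K}(X(\mathbb{R}))$.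
   Context: **Banach function spaces.** Let $\mathfrak{M}^+(\mathbb{R})$ be the set of Lebesgue measurable functions on $\mathbb{R}$ with values in $[0,\infty]$. A map $\rho:\mathfrak{M}^+(\mathbb{R})\to[0,\infty]$ is a Banach function norm if for all $f,g,f_n\in\mathfrak{M}^+(\mathbb{R})$ ($n\in\mathbb{N}$), all constants $a\ge0$ and all measurable $E\subset\mathbb{R}$: (A1) $\rho(f)=0\Leftrightarrow f=0$ a.e., $\rho(af)=a\rho(f)$, $\rho(f+g)\le\rho(f)+\rho(g)$; (A2) $0\le g\le f$ a.e. implies $\rho(g)\le\rho(f)$; (A3) $0\le f_n\uparrow f$ a.e. implies $\rho(f_n)\uparrow\rho(f)$; (A4) $|E|<\infty$ implies $\rho(\chi_E)<\infty$; (A5) $|E|<\infty$ implies $\int_E f\,dx\le C_E\rho(f)$ with a constant $C_E\in(0,\infty)$ independent of $f$. The Banach function space $X(\mathbb{R})$ consists of all measurable $f:\mathbb{R}\to\mathbb{C}$ (modulo a.e. equality) with $\|f\|_{X(\mathbb{R})}:=\rho(|f|)<\infty$. The associate space $X'(\mathbb{R})$ is the Banach function space given by $\rho'(g)=\sup\{\int_{\mathbb{R}}f(x)g(x)\,dx: f\in\mathfrak{M}^+(\mathbb{R}),\ \rho(f)\le1\}$. **Maximal operator.** $(\mathcal{M}f)(x)=\sup_{I\ni x}\frac1{|I|}\int_I|f(y)|\,dy$, the supremum over all intervals $I$ of finite length containing $x$. **Operators and multipliers.** $\mathcal{B}(X(\mathbb{R}))$ is the algebra of bounded linear operators on $X(\mathbb{R})$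 and $\mathcal{K}(X(\mathbb{R}))$ the ideal of compact operators; $aI$ is the operator of multiplication by $a$. Let $(\mathcal{F}f)(x)=\int_{\mathbb{R}}f(t)e^{itx}\,dt$ be the Fourier transform on $L^2(\mathbb{R})$. For $X(\mathbb{R})$ separable (then $L^2(\mathbb{R})\cap X(\mathbb{R})$ is dense in $X(\mathbb{R})$), $a\in L^\infty(\mathbb{R})$ is a Fourier multiplier on $X(\mathbb{R})$ if $W^0(a):=\mathcal{F}^{-1}a\mathcal{F}$ maps $L^2(\mathbb{R})\cap X(\mathbb{R})$ into $X(\mathbb{R})$ and extends to a bounded linear operator on $X(\mathbb{R})$, again denoted $W^0(a)$. $\mathcal{M}_{X(\mathbb{R})}$ is the algebra of all Fourier multipliers on $X(\mathbb{R})$, with norm $\|a\|_{\mathcal{M}_{X(\mathbb{R})}}=\|W^0(a)\|_{\mathcal{B}(X(\mathbb{R}))}$; under the hypotheses on $\mathcal{M}$ it is a Banach algebra. **Slowly oscillating functions and multipliers.** Let $\dot{\mathbb{R}}=\mathbb{R}\cup\{\infty\}$ be the one-point compactification of $\mathbb{R}$ and $\operatorname{osc}(f,E)=\operatorname{ess\,sup}_{s,t\in E}|f(s)-f(t)|$. A function $f\in L^\infty(\mathbb{R})$ is slowly oscillating at $\lambda\in\dot{\mathbb{R}}$ if for every (equivalently, some) $r\in(0,1)$: $\lim_{x\to0+}\operatorname{osc}(f,\lambda+([-x,-rx]\cup[rx,x]))=0$ when $\lambda\in\mathbb{R}$, and $\lim_{x\to+\infty}\operatorname{osc}(f,[-x,-rx]\cup[rx,x])=0$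 when $\lambda=\infty$. $SO_\lambda$ is the set of bounded continuous functions on $\dot{\mathbb{R}}\setminus\{\lambda\}$ that slowly oscillate at $\lambda$. With $(D_\lambda a)(x)=(x-\lambda)a'(x)$ for $\lambda\in\mathbb{R}$ and $(D_\infty a)(x)=xa'(x)$, $SO_\lambda^3$ is the set of all $a\in SO_\lambda\cap C^3(\mathbb{R}\setminus\{\lambda\})$ such that $\lim_{x\to\lambda}(D_\lambda^ka)(x)=0$ for $k=1,2,3$ and $\|a\|_{SO_\lambda^3}:=\sum_{j=0}^3\frac1{j!}\|D_\lambda^ja\|_{L^\infty(\mathbb{R})}<\infty$. Under the hypotheses on $X(\mathbb{R})$ one has $SO_\lambda^3\subset\mathcal{M}_{X(\mathbb{R})}$. $SO_{\lambda,X(\mathbb{R})}$ is the closure of $SO_\lambda^3$ in $\mathcal{M}_{X(\mathbb{R})}$, and $SO_{X(\mathbb{R})}^\diamond$ is the smallest Banach (i.e. closed) subalgebra of $\mathcal{M}_{X(\mathbb{R})}$ containing all $SO_{\lambda,X(\mathbb{R})}$, $\lambda\in\dot{\mathbb{R}}$. *)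

theory Defs
  imports "HOL-Probability.Probability" "HOL-Algebra.QuotRing"
begin

section \<open>Measurable functions modulo a.e. equality\<close>

quotient_type L0 = "real \<Rightarrow> complex" / partial:
  "\<lambda>f g. f \<in> borel_measurable lebesgue \<and> g \<in> borel_measurable lebesgue \<and>
         (AE x in lebesgue. f x = g x)"
proof (rule part_equivpI)
  show "\<exists>x::real \<Rightarrow> complex. x \<in> borel_measurable lebesgue \<and> x \<in> borel_measurable lebesgue \<and>
         (AE t in lebesgue. x t = x t)"
    by (rule exI[of _ "\<lambda>_. 0"]) auto
  show "symp (\<lambda>f g :: real \<Rightarrow> complex. f \<in> borel_measurable lebesgue \<and>
         g \<in> borel_measurable lebesgue \<and> (AE x in lebesgue. f x = g x))"
    by (auto simp: symp_def elim: eventually_mono)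
  show "transp (\<lambda>f g :: real \<Rightarrow> complex. f \<in> borel_measurable lebesgue \<and>
         g \<in> borel_measurable lebesgue \<and> (AE x in lebesgue. f x = g x))"
    unfolding transp_def by (auto elim: eventually_elim2)
qed

instantiation L0 :: comm_ring_1
begin

lift_definition zero_L0 :: L0 is "\<lambda>_. 0" by simp
lift_definition one_L0 :: L0 is "\<lambda>_. 1" by simp
lift_definition plus_L0 :: "L0 \<Rightarrow> L0 \<Rightarrow> L0" is "\<lambda>f g x. f x + g x"
  by (auto elim: eventually_elim2)
lift_definition minus_L0 :: "L0 \<Rightarrow> L0 \<Rightarrow> L0" is "\<lambda>f g x. f x - g x"
  by (auto elim: eventually_elim2)
lift_definition uminus_L0 :: "L0 \<Rightarrow> L0" is "\<lambda>f x. - f x"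
  by (auto elim: eventually_mono)
lift_definition times_L0 :: "L0 \<Rightarrow> L0 \<Rightarrow> L0" is "\<lambda>f g x. f x * g x"
  by (auto elim: eventually_elim2)

instance
proof
  fix a b c :: L0
  show "a * b * c = a * (b * c)" by transfer (simp add: mult.assoc)
  show "a * b = b * a" by transfer (simp add: mult.commute)
  show "1 * a = a" by transfer simp
  show "a + b + c = a + (b + c)" by transfer (simp add: add.assoc)
  show "a + b = b + a" by transfer (simp add: add.commute)
  show "0 + a = a" by transfer simp
  show "- a + a = 0" by transfer simp
  show "a - b = a + - b" by transfer simp
  show "(a + b) * c = a * c + b * c" by transfer (simp add: distrib_right)
  show "(0::L0) \<noteq> 1" by transfer (simp add: eventually_False ae_filter_eq_bot_iff)
qed

end

lift_definition cnj_L0 :: "L0 \<Rightarrow> L0" is "\<lambda>f x. cnj (f x)"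
  by (auto elim: eventually_mono
           intro: measurable_compose[OF _ borel_measurable_continuous_onI[OF continuous_on_cnj[OF continuous_on_id]]])

text \<open>Scalar multiplication by \<open>c\<close> is multiplication by \<open>const_L0 c\<close> in the ring \<^typ>\<open>L0\<close>.\<close>

lift_definition const_L0 :: "complex \<Rightarrow> L0" is "\<lambda>c _. c" by simp

lemma rep_L0_measurable [measurable]: "rep_L0 f \<in> borel_measurable lebesgue"
  using Quotient3_rep_reflp[OF Quotient3_L0] by blast

lemma abs_rep_L0: "abs_L0 (rep_L0 f) = f"
  by (rule Quotient3_abs_rep[OF Quotient3_L0])

lemma AE_rep_abs_L0:
  assumes "f \<in> borel_measurable lebesgue"
  shows "AE x in lebesgue. rep_L0 (abs_L0 f) x = f x"
  using Quotient3_rep_abs[OF Quotient3_L0, of f] assms by simp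

definition norm_topology :: "L0 set \<Rightarrow> (L0 \<Rightarrow> ennreal) \<Rightarrow> L0 topology" where
  "norm_topology S N = Metric_space.mtopology S (\<lambda>f g. enn2real (N (f - g)))"

definition complex_subalgebra :: "L0 set \<Rightarrow> bool" where
  "complex_subalgebra A \<longleftrightarrow>
     0 \<in> A \<and> (\<forall>f\<in>A. \<forall>g\<in>A. f + g \<in> A \<and> f * g \<in> A) \<and> (\<forall>c. \<forall>f\<in>A. const_L0 c * f \<in> A)"

definition Linf_norm :: "L0 \<Rightarrow> ennreal" where
  "Linf_norm f = esssup lebesgue (\<lambda>x. ennreal (cmod (rep_L0 f x)))"

definition Linf :: "L0 set" where
  "Linf = {f. Linf_norm f < \<infinity>}"

definition unital_Cstar_subalgebra :: "L0 set \<Rightarrow> bool" where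
  "unital_Cstar_subalgebra \<Phi> \<longleftrightarrow>
     complex_subalgebra \<Phi> \<and> 1 \<in> \<Phi> \<and> (\<forall>f\<in>\<Phi>. cnj_L0 f \<in> \<Phi>) \<and>
     closedin (norm_topology Linf Linf_norm) \<Phi>"


section \<open>Banach function spaces\<close>

definition banach_function_norm :: "((real \<Rightarrow> ennreal) \<Rightarrow> ennreal) \<Rightarrow> bool" where
  "banach_function_norm \<rho> \<longleftrightarrow>
     (\<forall>f\<in>borel_measurable lebesgue. \<rho> f = 0 \<longleftrightarrow> (AE x in lebesgue. f x = 0)) \<and>
     (\<forall>f\<in>borel_measurable lebesgue. \<forall>a::real. 0 \<le> a \<longrightarrow>
        \<rho> (\<lambda>x. ennreal a * f x) = ennreal a * \<rho> f) \<and>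
     (\<forall>f\<in>borel_measurable lebesgue. \<forall>g\<in>borel_measurable lebesgue.
        \<rho> (\<lambda>x. f x + g x) \<le> \<rho> f + \<rho> g) \<and>
     (\<forall>f\<in>borel_measurable lebesgue. \<forall>g\<in>borel_measurable lebesgue.
        (AE x in lebesgue. g x \<le> f x) \<longrightarrow> \<rho> g \<le> \<rho> f) \<and>
     (\<forall>f\<in>borel_measurable lebesgue. \<forall>F. (\<forall>n::nat. F n \<in> borel_measurable lebesgue) \<longrightarrow>
        (AE x in lebesgue. incseq (\<lambda>n. F n x) \<and> (\<lambda>n. F n x) \<longlonglongrightarrow> f x) \<longrightarrow>
        incseq (\<lambda>n. \<rho> (F n)) \<and> (\<lambda>n. \<rho> (F n)) \<longlonglongrightarrow> \<rho> f) \<and>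
     (\<forall>E\<in>sets lebesgue. emeasure lebesgue E < \<infinity> \<longrightarrow> \<rho> (indicator E) < \<infinity>) \<and>
     (\<forall>E\<in>sets lebesgue. emeasure lebesgue E < \<infinity> \<longrightarrow>
        (\<exists>C::real. 0 < C \<and> (\<forall>f\<in>borel_measurable lebesgue.
           (\<integral>\<^sup>+x\<in>E. f x \<partial>lebesgue) \<le> ennreal C * \<rho> f)))"

definition associate_norm :: "((real \<Rightarrow> ennreal) \<Rightarrow> ennreal) \<Rightarrow> (real \<Rightarrow> ennreal) \<Rightarrow> ennreal" where
  "associate_norm \<rho> g =
     (SUP f\<in>{f \<in> borel_measurable lebesgue. \<rho> f \<le> 1}. \<integral>\<^sup>+x. f x * g x \<partial>lebesgue)"

text \<open>
  A Banach function norm does not see null sets, so the choice of the representative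
  \<open>rep_L0 f\<close> is immaterial below.
\<close>

definition bfs_norm :: "((real \<Rightarrow> ennreal) \<Rightarrow> ennreal) \<Rightarrow> L0 \<Rightarrow> ennreal" where
  "bfs_norm \<rho> f = \<rho> (\<lambda>x. ennreal (cmod (rep_L0 f x)))"

lemma bfs_norm_abs_L0:
  assumes "banach_function_norm \<rho>" "f \<in> borel_measurable lebesgue"
  shows "bfs_norm \<rho> (abs_L0 f) = \<rho> (\<lambda>x. ennreal (cmod (f x)))"
proof -
  have mono: "\<rho> g \<le> \<rho> h" if "g \<in> borel_measurable lebesgue" "h \<in> borel_measurable lebesgue"
    "AE x in lebesgue. g x \<le> h x" for g h
    using assms(1) that unfolding banach_function_norm_def by blast
  note [measurable] = assms(2)
  show ?thesis
    unfolding bfs_norm_def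
    by (intro antisym mono) (use AE_rep_abs_L0[OF assms(2)] in \<open>auto elim: eventually_mono\<close>)
qed

definition bfs :: "((real \<Rightarrow> ennreal) \<Rightarrow> ennreal) \<Rightarrow> L0 set" where
  "bfs \<rho> = {f. bfs_norm \<rho> f < \<infinity>}"

definition bfs_topology :: "((real \<Rightarrow> ennreal) \<Rightarrow> ennreal) \<Rightarrow> L0 topology" where
  "bfs_topology \<rho> = norm_topology (bfs \<rho>) (bfs_norm \<rho>)"

text \<open>Only nondegenerate intervals enter the supremum.\<close>

definition maximal_function :: "L0 \<Rightarrow> real \<Rightarrow> ennreal" where
  "maximal_function f x =
     (SUP I\<in>{I. is_interval I \<and> bounded I \<and> 0 < emeasure lebesgue I \<and> x \<in> I}.
        (\<integral>\<^sup>+y\<in>I. ennreal (cmod (rep_L0 f y)) \<partial>lebesgue) / emeasure lebesgue I)"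

definition maximal_bounded :: "((real \<Rightarrow> ennreal) \<Rightarrow> ennreal) \<Rightarrow> bool" where
  "maximal_bounded \<rho> \<longleftrightarrow>
     (\<exists>C::real. \<forall>f\<in>bfs \<rho>. \<rho> (maximal_function f) \<le> ennreal C * bfs_norm \<rho> f)"


section \<open>Operators and the Calkin algebra\<close>

text \<open>
  An operator on \<open>bfs \<rho>\<close> is encoded as a function on all of \<^typ>\<open>L0\<close> that vanishes outside
  \<open>bfs \<rho>\<close>, so that equality of operators is equality of functions.
\<close>

definition bounded_ops :: "((real \<Rightarrow> ennreal) \<Rightarrow> ennreal) \<Rightarrow> (L0 \<Rightarrow> L0) set" where
  "bounded_ops \<rho> = {T.
     (\<forall>f. f \<notin> bfs \<rho> \<longrightarrow> T f = 0) \<and>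
     (\<forall>f\<in>bfs \<rho>. T f \<in> bfs \<rho>) \<and>
     (\<forall>f\<in>bfs \<rho>. \<forall>g\<in>bfs \<rho>. T (f + g) = T f + T g) \<and>
     (\<forall>c. \<forall>f\<in>bfs \<rho>. T (const_L0 c * f) = const_L0 c * T f) \<and>
     (\<exists>C::real. \<forall>f\<in>bfs \<rho>. bfs_norm \<rho> (T f) \<le> ennreal C * bfs_norm \<rho> f)}"

definition op_norm :: "((real \<Rightarrow> ennreal) \<Rightarrow> ennreal) \<Rightarrow> (L0 \<Rightarrow> L0) \<Rightarrow> ennreal" where
  "op_norm \<rho> T = (SUP f\<in>{f \<in> bfs \<rho>. bfs_norm \<rho> f \<le> 1}. bfs_norm \<rho> (T f))"

definition compact_ops :: "((real \<Rightarrow> ennreal) \<Rightarrow> ennreal) \<Rightarrow> (L0 \<Rightarrow> L0) set" where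
  "compact_ops \<rho> = {T \<in> bounded_ops \<rho>.
     compactin (bfs_topology \<rho>)
       (bfs_topology \<rho> closure_of (T ` {f \<in> bfs \<rho>. bfs_norm \<rho> f \<le> 1}))}"

definition mult_op :: "((real \<Rightarrow> ennreal) \<Rightarrow> ennreal) \<Rightarrow> L0 \<Rightarrow> L0 \<Rightarrow> L0" where
  "mult_op \<rho> a = (\<lambda>f. if f \<in> bfs \<rho> then a * f else 0)"

definition op_ring :: "((real \<Rightarrow> ennreal) \<Rightarrow> ennreal) \<Rightarrow> (L0 \<Rightarrow> L0) ring" where
  "op_ring \<rho> = \<lparr>carrier = bounded_ops \<rho>, mult = (\<lambda>S T. S \<circ> T), one = mult_op \<rho> 1,
                zero = (\<lambda>_. 0), add = (\<lambda>S T f. S f + T f)\<rparr>"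

definition calkin_algebra :: "((real \<Rightarrow> ennreal) \<Rightarrow> ennreal) \<Rightarrow> (L0 \<Rightarrow> L0) set ring" where
  "calkin_algebra \<rho> = op_ring \<rho> Quot compact_ops \<rho>"

definition calkin_class ::
    "((real \<Rightarrow> ennreal) \<Rightarrow> ennreal) \<Rightarrow> (L0 \<Rightarrow> L0) \<Rightarrow> (L0 \<Rightarrow> L0) set" where
  "calkin_class \<rho> T = compact_ops \<rho> +>\<^bsub>op_ring \<rho>\<^esub> T"

lemma calkin_class_in_carrier:
  "T \<in> bounded_ops \<rho> \<Longrightarrow> calkin_class \<rho> T \<in> carrier (calkin_algebra \<rho>)"
  by (auto simp: calkin_class_def calkin_algebra_def FactRing_def A_RCOSETS_def RCOSETS_def
      a_r_coset_def op_ring_def)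


section \<open>Fourier multipliers\<close>

definition L2 :: "L0 set" where
  "L2 = {f. (\<integral>\<^sup>+x. ennreal ((cmod (rep_L0 f x))\<^sup>2) \<partial>lebesgue) < \<infinity>}"

text \<open>
  The Fourier transform of \<open>f \<in> L2\<close> is the limit in the \<open>L\<^sup>2\<close> norm, as \<open>R \<rightarrow> \<infinity>\<close>, of the
  Fourier integrals of \<open>f\<close> truncated to \<open>[-R, R]\<close>.
\<close>

definition fourier_truncated :: "real \<Rightarrow> L0 \<Rightarrow> real \<Rightarrow> complex" where
  "fourier_truncated R f x =
     (LINT t:{-R..R}|lebesgue. rep_L0 f t * exp (\<i> * of_real t * of_real x))"

definition fourier :: "L0 \<Rightarrow> L0" where
  "fourier f = (THE g. g \<in> L2 \<and>
     ((\<lambda>R. \<integral>\<^sup>+x. ennreal ((cmod (fourier_truncated R f x - rep_L0 g x))\<^sup>2) \<partial>lebesgue)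
        \<longlongrightarrow> 0) at_top)"

definition inverse_fourier :: "L0 \<Rightarrow> L0" where
  "inverse_fourier = inv_into L2 fourier"

definition is_multiplier_op ::
    "((real \<Rightarrow> ennreal) \<Rightarrow> ennreal) \<Rightarrow> L0 \<Rightarrow> (L0 \<Rightarrow> L0) \<Rightarrow> bool" where
  "is_multiplier_op \<rho> a T \<longleftrightarrow>
     T \<in> bounded_ops \<rho> \<and> (\<forall>f\<in>L2 \<inter> bfs \<rho>. T f = inverse_fourier (a * fourier f))"

definition multipliers :: "((real \<Rightarrow> ennreal) \<Rightarrow> ennreal) \<Rightarrow> L0 set" where
  "multipliers \<rho> = {a \<in> Linf. \<exists>T. is_multiplier_op \<rho> a T}"

text \<open>
  For separable \<open>bfs \<rho>\<close> the extension is unique, as \<open>L2 \<inter> bfs \<rho>\<close> is dense in \<open>bfs \<rho>\<close>.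
\<close>

definition W0 :: "((real \<Rightarrow> ennreal) \<Rightarrow> ennreal) \<Rightarrow> L0 \<Rightarrow> L0 \<Rightarrow> L0" where
  "W0 \<rho> a = (THE T. is_multiplier_op \<rho> a T)"

definition multiplier_topology :: "((real \<Rightarrow> ennreal) \<Rightarrow> ennreal) \<Rightarrow> L0 topology" where
  "multiplier_topology \<rho> = norm_topology (multipliers \<rho>) (\<lambda>a. op_norm \<rho> (W0 \<rho> a))"


section \<open>Slowly oscillating functions\<close>

text \<open>
  The one-point compactification of the line has the points \<open>Some x\<close> for real \<open>x\<close>, and
  \<open>None\<close> for \<open>\<infinity>\<close>.
\<close>

definition Rdot :: "real option topology" where
  "Rdot = Alexandroff_compactification euclideanreal"

definition osc :: "(real \<Rightarrow> complex) \<Rightarrow> real set \<Rightarrow> ennreal" where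
  "osc f E = esssup (restrict_space (lebesgue \<Otimes>\<^sub>M lebesgue) (E \<times> E))
               (\<lambda>(s, t). ennreal (cmod (f s - f t)))"

definition shell :: "real \<Rightarrow> real \<Rightarrow> real set" where
  "shell r x = {-x..-(r * x)} \<union> {r * x..x}"

definition slowly_oscillating_at :: "real option \<Rightarrow> (real \<Rightarrow> complex) \<Rightarrow> bool" where
  "slowly_oscillating_at p f \<longleftrightarrow> (\<forall>r\<in>{0<..<1}.
     (case p of
        Some l \<Rightarrow> ((\<lambda>x. osc f ((+) l ` shell r x)) \<longlongrightarrow> 0) (at_right 0)
      | None \<Rightarrow> ((\<lambda>x. osc f (shell r x)) \<longlongrightarrow> 0) at_top))"

text \<open>The value of \<open>f\<close> at \<open>p\<close> itself is irrelevant in the following definitions.\<close>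

definition SO :: "real option \<Rightarrow> (real option \<Rightarrow> complex) set" where
  "SO p = {f. continuous_map (subtopology Rdot (UNIV - {p})) euclidean f \<and>
              bounded (f ` (UNIV - {p})) \<and> slowly_oscillating_at p (f \<circ> Some)}"

primrec Ck_on :: "nat \<Rightarrow> real set \<Rightarrow> (real \<Rightarrow> complex) \<Rightarrow> bool" where
  "Ck_on 0 S f \<longleftrightarrow> continuous_on S f"
| "Ck_on (Suc k) S f \<longleftrightarrow>
     (\<forall>x\<in>S. f differentiable at x) \<and> Ck_on k S (\<lambda>x. vector_derivative f (at x))"

definition D_op :: "real option \<Rightarrow> (real \<Rightarrow> complex) \<Rightarrow> real \<Rightarrow> complex" where
  "D_op p a x = (case p of Some l \<Rightarrow> x - l | None \<Rightarrow> x) *\<^sub>R vector_derivative a (at x)"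

definition SO3 :: "real option \<Rightarrow> (real option \<Rightarrow> complex) set" where
  "SO3 p = {a \<in> SO p.
     Ck_on 3 {x. Some x \<noteq> p} (a \<circ> Some) \<and>
     (\<forall>k\<in>{1, 2, 3::nat}. (((D_op p ^^ k) (a \<circ> Some)) \<longlongrightarrow> 0)
        (case p of Some l \<Rightarrow> at l | None \<Rightarrow> at_infinity)) \<and>
     (\<Sum>j\<le>3. ennreal (1 / fact j) *
        esssup lebesgue (\<lambda>x. ennreal (cmod ((D_op p ^^ j) (a \<circ> Some) x)))) < \<infinity>}"

text \<open>\<open>closure_of\<close> only sees the part of a set inside the topological space.\<close>

definition SO_mult :: "((real \<Rightarrow> ennreal) \<Rightarrow> ennreal) \<Rightarrow> real option \<Rightarrow> L0 set" where
  "SO_mult \<rho> p =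
     multiplier_topology \<rho> closure_of ((\<lambda>a. abs_L0 (a \<circ> Some)) ` SO3 p)"

definition SO_diamond :: "((real \<Rightarrow> ennreal) \<Rightarrow> ennreal) \<Rightarrow> L0 set" where
  "SO_diamond \<rho> = \<Inter>{A. complex_subalgebra A \<and> closedin (multiplier_topology \<rho>) A \<and>
                        (\<Union>p. SO_mult \<rho> p) \<subseteq> A}"


section \<open>Sets of cosets in the Calkin algebra\<close>

definition MO_pi :: "((real \<Rightarrow> ennreal) \<Rightarrow> ennreal) \<Rightarrow> L0 set \<Rightarrow> (L0 \<Rightarrow> L0) set set" where
  "MO_pi \<rho> \<Phi> = {calkin_class \<rho> (mult_op \<rho> a) | a. a \<in> \<Phi>}"

definition CO_pi :: "((real \<Rightarrow> ennreal) \<Rightarrow> ennreal) \<Rightarrow> L0 set \<Rightarrow> (L0 \<Rightarrow> L0) set set" where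
  "CO_pi \<rho> \<Psi> = {calkin_class \<rho> (W0 \<rho> b) | b. b \<in> \<Psi>}"

end

theory Submission
  imports Defs
begin

text \<open>Suppose \<open>a I = K + W\<^sup>0(b)\<close> with \<open>K\<close> compact, and conjugate by multiplication with
  \<open>e\<^sub>n(x) = exp(-i n x)\<close>. This fixes \<open>a I\<close> and turns \<open>b\<close> into its translate \<open>b(\<cdot> + n)\<close>. For a
  slowly oscillating symbol \<open>b(x + n) - b(n) \<rightarrow> 0\<close> pointwise, so on a function of \<open>L\<^sup>2\<close> the conjugated
  convolution operator acts in the \<open>L\<^sup>2\<close> limit as multiplication by the number \<open>b(n)\<close>. Separability
  makes the norm of the space absolutely continuous, and then \<open>K(e\<^sub>n f) \<rightarrow> 0\<close> along a subsequence.
  Hence on every bounded interval \<open>a\<close> is a limit in \<open>L\<^sup>1\<close> of constants. A general \<open>b\<close> of the algebra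
  is approximated in the multiplier norm, which dominates local \<open>L\<^sup>1\<close> norms by axiom (A5).

  Only those elements of \<open>SO3 p\<close> that are multipliers enter the closures, so no multiplier theorem of
  Mikhlin type is involved. What remains is the Fourier transform on \<open>L\<^sup>2\<close>: Gaussian
  regularisation bounds it on \<open>L\<^sup>1 \<inter> L\<^sup>2\<close> and inverts it on indicators of intervals, and the
  multiplication formula \<open>\<integral>(F f) g = \<integral>f (F g)\<close> extends the inversion to all of \<open>L\<^sup>2\<close>.\<close>

section \<open>The Fourier transform on \<open>L\<^sup>1 \<inter> L\<^sup>2\<close>\<close>

text \<open>The numbers \<open>b(n)\<close> need not converge, so no limit of the symbol is taken:
  for each \<open>e\<close> one large \<open>n\<close> is chosen, \<open>b(n)\<close> serves as a
  constant within \<open>e\<close> of \<open>a\<close>, and completeness of the constants in L1 of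
  an interval does the rest. The test function is an interval indicator times a wave; it has modulus
  1 on the interval, so \<open>|a g - c g|\<close> is \<open>|a - c|\<close> there. Two norms that
  cannot be compared meet in this estimate: that of the space, which controls the compact part and
  the approximation of the symbol, and that of L2, which controls the slowly varying part. Each of
  them dominates the L1 norm on bounded intervals, the second by Cauchy-Schwarz, and this is why the
  conclusion is drawn in local L1. The frequencies are integers and the intervals have half-length
  \<open>m * pi\<close>, because distinct integer waves are orthogonal there; orthogonality makes
  averages of modulated indicators small, which replaces duality in the treatment of
  \<open>K\<close>.\<close>

definition sqnorm :: "(real \<Rightarrow> complex) \<Rightarrow> ennreal" where
  "sqnorm f = (\<integral>\<^sup>+x. ennreal ((cmod (f x))\<^sup>2) \<partial>lborel)"

lemma tendsto_0_le_ennreal: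
  fixes f g :: "'a \<Rightarrow> ennreal"
  assumes "(g \<longlongrightarrow> 0) F" "\<And>x. f x \<le> g x"
  shows "(f \<longlongrightarrow> 0) F"
  by (rule tendsto_sandwich[OF _ _ tendsto_const assms(1)]) (auto simp: assms(2))

definition square_integrable :: "(real \<Rightarrow> complex) \<Rightarrow> bool" where
  "square_integrable f \<longleftrightarrow> f \<in> borel_measurable borel \<and> sqnorm f < \<infinity>"

lemma square_integrable_measurable [measurable_dest]:
  "square_integrable f \<Longrightarrow> f \<in> borel_measurable borel"
  by (simp add: square_integrable_def)

lemma sqnorm_cong_AE: "AE x in lborel. f x = g x \<Longrightarrow> sqnorm f = sqnorm g"
  unfolding sqnorm_def by (rule nn_integral_cong_AE) auto

lemma sqnorm_mono: "(\<And>x. cmod (f x) \<le> cmod (g x)) \<Longrightarrow> sqnorm f \<le> sqnorm g"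
  unfolding sqnorm_def by (intro nn_integral_mono ennreal_leI power_mono) auto

lemma cmod_add_sq_le: "(cmod (a + b))\<^sup>2 \<le> 2 * (cmod a)\<^sup>2 + 2 * (cmod b)\<^sup>2"
proof -
  have "(cmod (a + b))\<^sup>2 \<le> (cmod a + cmod b)\<^sup>2"
    by (intro power_mono norm_triangle_ineq) auto
  also have "\<dots> \<le> 2 * (cmod a)\<^sup>2 + 2 * (cmod b)\<^sup>2"
    using sum_squares_bound[of "cmod a" "cmod b"] by (simp add: power2_sum)
  finally show ?thesis .
qed

text \<open>Working with the square of the norm costs a factor 2 in the triangle inequality but
  avoids roots in \<open>ennreal\<close>. The later uses are null limits and boundedness, where the
  factor is harmless.\<close>

lemma sqnorm_add_le:
  assumes [measurable]: "f \<in> borel_measurable borel" "g \<in> borel_measurable borel"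
  shows "sqnorm (\<lambda>x. f x + g x) \<le> 2 * sqnorm f + 2 * sqnorm g"
proof -
  have "sqnorm (\<lambda>x. f x + g x) \<le>
     (\<integral>\<^sup>+x. 2 * ennreal ((cmod (f x))\<^sup>2) + 2 * ennreal ((cmod (g x))\<^sup>2) \<partial>lborel)"
    unfolding sqnorm_def
  proof (rule nn_integral_mono)
    fix x
    have "ennreal ((cmod (f x + g x))\<^sup>2) \<le> ennreal (2 * (cmod (f x))\<^sup>2 + 2 * (cmod (g x))\<^sup>2)"
      by (intro ennreal_leI cmod_add_sq_le)
    then show "ennreal ((cmod (f x + g x))\<^sup>2) \<le> 2 * ennreal ((cmod (f x))\<^sup>2) + 2 * ennreal ((cmod (g x))\<^sup>2)"
      by (simp add: ennreal_plus ennreal_mult)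
  qed
  also have "\<dots> = 2 * sqnorm f + 2 * sqnorm g"
    unfolding sqnorm_def by (simp add: nn_integral_add nn_integral_cmult)
  finally show ?thesis .
qed

lemma sqnorm_uminus: "sqnorm (\<lambda>x. - f x) = sqnorm f"
  by (simp add: sqnorm_def)

lemma sqnorm_minus_commute: "sqnorm (\<lambda>x. f x - g x) = sqnorm (\<lambda>x. g x - f x)"
  by (simp add: sqnorm_def norm_minus_commute)

lemma sqnorm_diff_le:
  assumes [measurable]: "f \<in> borel_measurable borel" "g \<in> borel_measurable borel"
  shows "sqnorm (\<lambda>x. f x - g x) \<le> 2 * sqnorm f + 2 * sqnorm g"
  using sqnorm_add_le[of f "\<lambda>x. - g x"] by (simp add: sqnorm_uminus)

lemma sqnorm_cmult:
  assumes [measurable]: "f \<in> borel_measurable borel"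
  shows "sqnorm (\<lambda>x. c * f x) = ennreal ((cmod c)\<^sup>2) * sqnorm f"
  unfolding sqnorm_def
  by (subst nn_integral_cmult[symmetric]) (auto simp: norm_mult power_mult_distrib ennreal_mult)

lemma sqnorm_eq_0_iff:
  assumes [measurable]: "f \<in> borel_measurable borel"
  shows "sqnorm f = 0 \<longleftrightarrow> (AE x in lborel. f x = 0)"
  unfolding sqnorm_def by (subst nn_integral_0_iff_AE) (auto simp: ennreal_eq_0_iff)

lemma sqnorm_translate:
  assumes [measurable]: "f \<in> borel_measurable borel"
  shows "sqnorm (\<lambda>x. f (x + a)) = sqnorm f"
  unfolding sqnorm_def
  by (subst (2) nn_integral_real_affine[where c=1 and t=a]) (auto simp: add.commute)

lemma sqnorm_reflect:
  assumes [measurable]: "f \<in> borel_measurable borel"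
  shows "sqnorm (\<lambda>x. f (- x)) = sqnorm f"
  unfolding sqnorm_def
  by (subst (2) nn_integral_real_affine[where c="-1" and t=0]) auto

lemma square_integrable_add:
  assumes "square_integrable f" "square_integrable g"
  shows "square_integrable (\<lambda>x. f x + g x)"
proof -
  have [measurable]: "f \<in> borel_measurable borel" "g \<in> borel_measurable borel"
    using assms by (auto simp: square_integrable_def)
  have "2 * sqnorm f + 2 * sqnorm g < \<infinity>"
    using assms by (auto simp: square_integrable_def ennreal_mult_less_top)
  then have "sqnorm (\<lambda>x. f x + g x) < \<infinity>"
    by (rule le_less_trans[OF sqnorm_add_le, rotated 2]) auto
  then show ?thesis
    by (auto simp: square_integrable_def)
qed

lemma square_integrable_cmult:
  assumes "square_integrable f" shows "square_integrable (\<lambda>x. c * f x)"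
  using assms by (auto simp: square_integrable_def sqnorm_cmult ennreal_mult_less_top)

lemma square_integrable_diff:
  assumes "square_integrable f" "square_integrable g"
  shows "square_integrable (\<lambda>x. f x - g x)"
  using square_integrable_add[OF assms(1) square_integrable_cmult[OF assms(2), of "-1"]] by simp

lemma square_integrable_bound:
  assumes "square_integrable f" "g \<in> borel_measurable borel" "\<And>x. cmod (g x) \<le> cmod (f x)"
  shows "square_integrable g"
  using assms sqnorm_mono[of g f] by (auto simp: square_integrable_def)

lemma square_integrable_translate:
  "square_integrable f \<Longrightarrow> square_integrable (\<lambda>x. f (x + a))"
  by (auto simp: square_integrable_def sqnorm_translate)

lemma square_integrable_reflect:
  "square_integrable f \<Longrightarrow> square_integrable (\<lambda>x. f (- x))"
  by (auto simp: square_integrable_def sqnorm_reflect)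

lemma nn_integral_mult_sqnorm:
  assumes [measurable]: "f \<in> borel_measurable borel" "g \<in> borel_measurable borel"
  shows "(\<integral>\<^sup>+x. ennreal (cmod (f x * g x)) \<partial>lborel)\<^sup>2 \<le> sqnorm f * sqnorm g"
  using Cauchy_Schwarz_nn_integral[of "\<lambda>x. ennreal (cmod (f x))" lborel "\<lambda>x. ennreal (cmod (g x))"]
  by (simp add: sqnorm_def norm_mult ennreal_mult ennreal_power)

lemma integrable_mult_square_integrable:
  assumes "square_integrable f" "square_integrable g"
  shows "integrable lborel (\<lambda>x. f x * g x)"
proof (rule integrableI_bounded)
  have [measurable]: "f \<in> borel_measurable borel" "g \<in> borel_measurable borel"
    using assms by (auto simp: square_integrable_def)
  show "(\<lambda>x. f x * g x) \<in> borel_measurable lborel" by measurable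
  have "sqnorm f * sqnorm g < \<infinity>"
    using assms by (auto simp: square_integrable_def ennreal_mult_less_top)
  then have "(\<integral>\<^sup>+x. ennreal (cmod (f x * g x)) \<partial>lborel)\<^sup>2 < \<infinity>"
    using nn_integral_mult_sqnorm[of f g] by auto
  then show "(\<integral>\<^sup>+x. ennreal (norm (f x * g x)) \<partial>lborel) < \<infinity>"
    by (simp add: power_less_top_ennreal)
qed

text \<open>Cauchy-Schwarz makes the pairing continuous in its first factor. It carries integral
  identities from truncations to all of L2.\<close>

lemma integral_mult_tendsto:
  assumes f: "\<And>n. square_integrable (f n)" "square_integrable f'"
    and g: "square_integrable g"
    and lim: "(\<lambda>n. sqnorm (\<lambda>x. f n x - f' x)) \<longlonglongrightarrow> 0"
  shows "(\<lambda>n. \<integral>x. f n x * g x \<partial>lborel) \<longlonglongrightarrow> (\<integral>x. f' x * g x \<partial>lborel)"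
proof -
  have [measurable]: "f n \<in> borel_measurable borel" "f' \<in> borel_measurable borel"
    "g \<in> borel_measurable borel" for n
    using f g by (auto simp: square_integrable_def)
  have fin: "sqnorm g < \<infinity>" using g by (auto simp: square_integrable_def)
  have bound: "ennreal ((cmod ((\<integral>x. f n x * g x \<partial>lborel) - (\<integral>x. f' x * g x \<partial>lborel)))\<^sup>2)
      \<le> sqnorm (\<lambda>x. f n x - f' x) * sqnorm g" for n
  proof -
    have "(\<integral>x. f n x * g x \<partial>lborel) - (\<integral>x. f' x * g x \<partial>lborel) = (\<integral>x. (f n x - f' x) * g x \<partial>lborel)"
      using integrable_mult_square_integrable[OF f(1) g] integrable_mult_square_integrable[OF f(2) g]
      by (simp add: algebra_simps)
    then have "ennreal (cmod ((\<integral>x. f n x * g x \<partial>lborel) - (\<integral>x. f' x * g x \<partial>lborel)))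
       \<le> (\<integral>\<^sup>+x. ennreal (cmod ((f n x - f' x) * g x)) \<partial>lborel)"
      using integral_norm_bound_ennreal[OF integrable_mult_square_integrable[OF square_integrable_diff[OF f(1) f(2)] g], of n]
      by simp
    then have "ennreal (cmod ((\<integral>x. f n x * g x \<partial>lborel) - (\<integral>x. f' x * g x \<partial>lborel))) ^ 2
       \<le> (\<integral>\<^sup>+x. ennreal (cmod ((f n x - f' x) * g x)) \<partial>lborel)\<^sup>2"
      by (rule power_mono) auto
    also have "\<dots> \<le> sqnorm (\<lambda>x. f n x - f' x) * sqnorm g"
      by (rule nn_integral_mult_sqnorm) auto
    finally show ?thesis by (simp add: ennreal_power)
  qed
  have "(\<lambda>n. sqnorm (\<lambda>x. f n x - f' x) * sqnorm g) \<longlonglongrightarrow> 0 * sqnorm g"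
    using ennreal_tendsto_cmult[of "sqnorm g", OF _ lim] fin by (simp add: mult.commute)
  then have "(\<lambda>n. ennreal ((cmod ((\<integral>x. f n x * g x \<partial>lborel) - (\<integral>x. f' x * g x \<partial>lborel)))\<^sup>2)) \<longlonglongrightarrow> ennreal 0"
    using bound by (auto intro: tendsto_0_le_ennreal)
  then have "(\<lambda>n. (cmod ((\<integral>x. f n x * g x \<partial>lborel) - (\<integral>x. f' x * g x \<partial>lborel)))\<^sup>2) \<longlonglongrightarrow> 0"
    by (subst (asm) tendsto_ennreal_iff) auto
  then have "(\<lambda>n. sqrt ((cmod ((\<integral>x. f n x * g x \<partial>lborel) - (\<integral>x. f' x * g x \<partial>lborel)))\<^sup>2)) \<longlonglongrightarrow> sqrt 0"
    by (rule tendsto_real_sqrt)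
  then have "(\<lambda>n. cmod ((\<integral>x. f n x * g x \<partial>lborel) - (\<integral>x. f' x * g x \<partial>lborel))) \<longlonglongrightarrow> 0"
    by simp
  then show ?thesis
    by (simp add: LIM_zero_iff tendsto_norm_zero_iff)
qed

section \<open>Fourier integrals of integrable functions\<close>

definition ft :: "(real \<Rightarrow> complex) \<Rightarrow> real \<Rightarrow> complex" where
  "ft f x = (\<integral>t. f t * exp (\<i> * of_real t * of_real x) \<partial>lborel)"

lemma norm_exp_ii [simp]: "cmod (exp (\<i> * of_real t * of_real x)) = 1"
  using norm_exp_i_times[of "t * x"] by (simp add: mult.assoc)

lemma ft_measurable [measurable (raw)]:
  assumes [measurable]: "f \<in> borel_measurable borel" "g \<in> borel_measurable M"
  shows "(\<lambda>x. ft f (g x)) \<in> borel_measurable M"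
proof -
  have "ft f \<in> borel_measurable borel"
    unfolding ft_def[abs_def] by measurable
  then show ?thesis by measurable
qed

lemma integrable_ft_integrand:
  assumes "integrable lborel f"
  shows "integrable lborel (\<lambda>t. f t * exp (\<i> * of_real t * of_real x))"
proof (rule Bochner_Integration.integrable_bound[OF assms])
  have [measurable]: "f \<in> borel_measurable borel" using assms by auto
  show "(\<lambda>t. f t * exp (\<i> * of_real t * of_real x)) \<in> borel_measurable lborel" by measurable
qed (auto simp: norm_mult)

lemma ft_bound:
  assumes "integrable lborel f"
  shows "cmod (ft f x) \<le> (\<integral>t. cmod (f t) \<partial>lborel)"
proof -
  have "cmod (ft f x) \<le> (\<integral>t. cmod (f t * exp (\<i> * of_real t * of_real x)) \<partial>lborel)"
    unfolding ft_def by (rule integral_norm_bound)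
  then show ?thesis by (simp add: norm_mult)
qed

lemma ft_diff:
  assumes "integrable lborel f" "integrable lborel g"
  shows "ft (\<lambda>t. f t - g t) x = ft f x - ft g x"
  unfolding ft_def using integrable_ft_integrand[OF assms(1), of x] integrable_ft_integrand[OF assms(2), of x]
  by (simp add: algebra_simps)

lemma ft_add:
  assumes "integrable lborel f" "integrable lborel g"
  shows "ft (\<lambda>t. f t + g t) x = ft f x + ft g x"
  unfolding ft_def using integrable_ft_integrand[OF assms(1), of x] integrable_ft_integrand[OF assms(2), of x]
  by (simp add: algebra_simps)

lemma ft_cmult: "ft (\<lambda>t. c * f t) x = c * ft f x"
  unfolding ft_def by (simp add: mult.assoc)

text \<open>Fubini's theorem: the kernel is symmetric in its two variables and has modulus 1, so the
  double integral converges absolutely.\<close>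

lemma ft_multiplication_formula:
  assumes f: "integrable lborel f" and g: "integrable lborel g"
  shows "(\<integral>x. ft f x * g x \<partial>lborel) = (\<integral>t. f t * ft g t \<partial>lborel)"
proof -
  have [measurable]: "f \<in> borel_measurable borel" "g \<in> borel_measurable borel" using f g by auto
  let ?h = "\<lambda>x t. f t * exp (\<i> * of_real t * of_real x) * g x"
  have int: "integrable (lborel \<Otimes>\<^sub>M lborel) (case_prod ?h)"
  proof (rule lborel_pair.Fubini_integrable)
    show "case_prod ?h \<in> borel_measurable (lborel \<Otimes>\<^sub>M lborel)" by measurable
    have "(\<integral>t. norm (?h x t) \<partial>lborel) = (\<integral>t. cmod (f t) \<partial>lborel) * cmod (g x)" for x
      by (simp add: norm_mult)
    then show "integrable lborel (\<lambda>x. \<integral>t. norm (case_prod ?h (x, t)) \<partial>lborel)"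
      using g by (simp add: integrable_norm)
    show "AE x in lborel. integrable lborel (\<lambda>t. case_prod ?h (x, t))"
      using integrable_ft_integrand[OF f] by auto
  qed
  have "(\<integral>x. ft f x * g x \<partial>lborel) = (\<integral>x. (\<integral>t. ?h x t \<partial>lborel) \<partial>lborel)"
    unfolding ft_def by simp
  also have "\<dots> = (\<integral>t. (\<integral>x. ?h x t \<partial>lborel) \<partial>lborel)"
    by (rule lborel_pair.Fubini_integral[OF int, symmetric])
  also have "\<dots> = (\<integral>t. f t * ft g t \<partial>lborel)"
    unfolding ft_def
    by (intro Bochner_Integration.integral_cong refl, subst Bochner_Integration.integral_mult_right_zero[symmetric])
       (simp add: mult_ac)
  finally show ?thesis .
qed

section \<open>Gaussian weights and the Bessel inequality\<close>

text \<open>Normalised to the value 1 at the origin rather than to mass 1: as \<open>s\<close>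
  grows, the weight increases pointwise to 1 and can be removed by monotone convergence.\<close>

definition gauss :: "real \<Rightarrow> real \<Rightarrow> real" where
  "gauss s x = exp (- x\<^sup>2 / (2 * s\<^sup>2))"

lemma gauss_measurable [measurable]: "gauss s \<in> borel_measurable borel"
  unfolding gauss_def[abs_def] by measurable

lemma gauss_pos: "0 < gauss s x" and gauss_le_1: "gauss s x \<le> 1"
  by (auto simp: gauss_def)

lemma gauss_eq_normal_density: "0 < s \<Longrightarrow> gauss s x = s * sqrt (2 * pi) * normal_density 0 s x"
  by (simp add: gauss_def normal_density_def real_sqrt_mult)

lemma integrable_gauss: "0 < s \<Longrightarrow> integrable lborel (gauss s)"
  using integrable_mult_right[OF integrable_normal_density[of s 0], of "s * sqrt (2 * pi)"]
  by (simp only: gauss_eq_normal_density[symmetric])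

lemma integrable_gauss_exp:
  assumes "0 < s"
  shows "integrable lborel (\<lambda>x. of_real (gauss s x) * exp (\<i> * of_real x * of_real y))"
  by (rule integrable_ft_integrand) (use integrable_gauss[OF assms] in auto)

text \<open>After the substitution \<open>x = s * z\<close> this is the characteristic function of
  the standard normal law. The result is written as a density because its total mass, 1, is what the
  next estimates use.\<close>

lemma integral_gauss_exp:
  assumes s: "0 < s"
  shows "(\<integral>x. of_real (gauss s x) * exp (\<i> * of_real x * of_real u) \<partial>lborel)
     = complex_of_real (2 * pi * normal_density 0 (1/s) u)"
proof -
  have "char std_normal_distribution (s * u) = (\<integral>x. std_normal_density x *\<^sub>R iexp (s * u * x) \<partial>lborel)"
    unfolding char_def by (subst integral_density) auto
  then have *: "(\<integral>x. std_normal_density x *\<^sub>R iexp (s * u * x) \<partial>lborel) = complex_of_real (exp (- ((s*u)\<^sup>2) / 2))"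
    by (simp add: char_std_normal_distribution)
  have "(\<integral>x. of_real (gauss s x) * exp (\<i> * of_real x * of_real u) \<partial>lborel)
     = s *\<^sub>R (\<integral>x. of_real (gauss s (s * x)) * exp (\<i> * of_real (s * x) * of_real u) \<partial>lborel)"
    using lborel_integral_real_affine[where c=s and t=0 and f="\<lambda>x. of_real (gauss s x) * exp (\<i> * of_real x * of_real u)"] s
    by simp
  also have "(\<lambda>x. complex_of_real (gauss s (s * x)) * exp (\<i> * of_real (s * x) * of_real u))
     = (\<lambda>x. complex_of_real (sqrt (2*pi)) * (std_normal_density x *\<^sub>R iexp (s * u * x)))"
  proof
    fix x
    have "gauss s (s * x) = sqrt (2*pi) * std_normal_density x"
      using s by (simp add: gauss_def std_normal_density_def power_mult_distrib)
    then show "complex_of_real (gauss s (s * x)) * exp (\<i> * of_real (s * x) * of_real u)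
       = complex_of_real (sqrt (2*pi)) * (std_normal_density x *\<^sub>R iexp (s * u * x))"
      by (simp only: scaleR_conv_of_real of_real_mult mult_ac)
  qed
  also have "(\<integral>x. complex_of_real (sqrt (2*pi)) * (std_normal_density x *\<^sub>R iexp (s * u * x)) \<partial>lborel)
     = complex_of_real (sqrt (2*pi)) * complex_of_real (exp (- ((s*u)\<^sup>2) / 2))"
    by (simp only: * integral_mult_right_zero)
  also have "s *\<^sub>R (complex_of_real (sqrt (2*pi)) * complex_of_real (exp (- ((s*u)\<^sup>2) / 2)))
     = complex_of_real (s * sqrt (2*pi) * exp (- ((s*u)\<^sup>2) / 2))"
    by (simp add: scaleR_conv_of_real)
  also have "s * sqrt (2*pi) * exp (- ((s*u)\<^sup>2) / 2) = 2 * pi * normal_density 0 (1/s) u"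
  proof -
    have "2 * pi / sqrt (2 * pi) = sqrt (2 * pi)"
      by (subst real_div_sqrt) auto
    then show ?thesis
      using s by (simp add: normal_density_def real_sqrt_divide power_divide power_mult_distrib real_sqrt_mult field_simps)
  qed
  finally show ?thesis .
qed

text \<open>The multiplication formula against a modulated Gaussian moves the transform onto the
  Gaussian. The right-hand kernel concentrates at \<open>t = - y\<close>, which is where the
  reflection in the inversion formula comes from.\<close>

lemma ft_gauss_smoothing:
  assumes f: "integrable lborel f" and s: "0 < s"
  shows "(\<integral>x. ft f x * (of_real (gauss s x) * exp (\<i> * of_real x * of_real y)) \<partial>lborel)
    = complex_of_real (2 * pi) * (\<integral>t. f t * complex_of_real (normal_density 0 (1/s) (t + y)) \<partial>lborel)"
proof -
  have "ft (\<lambda>x. of_real (gauss s x) * exp (\<i> * of_real x * of_real y)) t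
      = complex_of_real (2 * pi * normal_density 0 (1/s) (t + y))" for t
  proof -
    have "ft (\<lambda>x. of_real (gauss s x) * exp (\<i> * of_real x * of_real y)) t =
       (\<integral>x. of_real (gauss s x) * exp (\<i> * of_real x * of_real (t + y)) \<partial>lborel)"
      unfolding ft_def
      by (rule Bochner_Integration.integral_cong) (auto simp: exp_add[symmetric] algebra_simps)
    then show ?thesis unfolding integral_gauss_exp[OF s] .
  qed
  then show ?thesis
    using ft_multiplication_formula[OF f integrable_gauss_exp[OF s, of y]]
    by (simp add: mult.left_commute[of "f _"])
qed

lemma nn_integral_normal_density:
  "0 < s \<Longrightarrow> (\<integral>\<^sup>+x. ennreal (normal_density m s x) \<partial>lborel) = 1"
  by (subst nn_integral_eq_integral) auto

text \<open>The Gaussian weight turns \<open>\<integral>|ft f|\<^sup>2\<close> into a quadratic form in \<open>f\<close> whose kernel has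
  total mass \<open>2\<pi>\<close>; AM-GM under the integral and Tonelli bound it.\<close>

lemma ft_weighted_le:
  assumes f: "integrable lborel f" and s: "0 < s"
  shows "(\<integral>\<^sup>+x. ennreal ((cmod (ft f x))\<^sup>2 * gauss s x) \<partial>lborel) \<le> ennreal (2 * pi) * sqnorm f"
proof -
  have [measurable]: "f \<in> borel_measurable borel" using f by auto
  let ?N = "normal_density 0 (1/s)"
  \<comment> \<open>With this \<open>g\<close>, \<open>ft f * g\<close> is the weighted square of
    \<open>|ft f|\<close>, and the multiplication formula trades its integral for a double integral
    in \<open>f\<close> alone.\<close>
  define g where "g x = of_real (gauss s x) * cnj (ft f x)" for x
  have ft_meas: "(\<lambda>x. ft f x) \<in> borel_measurable borel" by measurable
  have [measurable]: "(\<lambda>x. cnj (ft f x)) \<in> borel_measurable borel"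
    by (rule measurable_compose[OF ft_meas borel_measurable_continuous_onI]) (intro continuous_intros)
  have [measurable]: "g \<in> borel_measurable borel" unfolding g_def[abs_def] by measurable
  have g: "integrable lborel g"
  proof (rule Bochner_Integration.integrable_bound)
    show "integrable lborel (\<lambda>x. gauss s x * (\<integral>t. cmod (f t) \<partial>lborel))"
      using integrable_gauss[OF s] by simp
    show "AE x in lborel. norm (g x) \<le> norm (gauss s x * (\<integral>t. cmod (f t) \<partial>lborel))"
      using ft_bound[OF f] gauss_pos[of s]
      by (auto simp: g_def norm_mult abs_mult less_imp_le intro!: mult_left_mono order_trans[OF _ abs_ge_self])
  qed auto
  have int_ftg: "integrable lborel (\<lambda>x. ft f x * g x)"
  proof (rule Bochner_Integration.integrable_bound)
    show "integrable lborel (\<lambda>x. (\<integral>t. cmod (f t) \<partial>lborel) *\<^sub>R g x)" using g by simp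
    show "AE x in lborel. norm (ft f x * g x) \<le> norm ((\<integral>t. cmod (f t) \<partial>lborel) *\<^sub>R g x)"
      using ft_bound[OF f] by (auto simp: norm_mult intro!: mult_right_mono)
  qed auto
  \<comment> \<open>Conjugation changes the sign of the exponent, so the smoothing formula applies
    at the point \<open>- t\<close>.\<close>
  have ftg: "cmod (ft g t) \<le> 2 * pi * cmod (\<integral>u. f u * of_real (?N (u + (- t))) \<partial>lborel)" for t
  proof -
    have "ft g t = (\<integral>x. cnj (ft f x * (of_real (gauss s x) * exp (\<i> * of_real x * of_real (-t)))) \<partial>lborel)"
      unfolding ft_def[of g] g_def by (intro Bochner_Integration.integral_cong) (auto simp: exp_cnj mult_ac)
    also have "\<dots> = cnj (complex_of_real (2 * pi) * (\<integral>u. f u * complex_of_real (?N (u + (- t))) \<partial>lborel))"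
      unfolding ft_gauss_smoothing[OF f s, symmetric] by (rule Bochner_Integration.integral_cnj)
    finally show ?thesis by (simp add: norm_mult)
  qed
  \<comment> \<open>The mean is left free because the kernel, symmetric in \<open>t\<close> and
    \<open>u\<close>, is integrated once in each variable.\<close>
  have mass: "(\<integral>\<^sup>+t. ennreal (pi * ((cmod z)\<^sup>2 * normal_density m (1/s) t)) \<partial>lborel) = ennreal pi * ennreal ((cmod z)\<^sup>2)" for z m
  proof -
    have "(\<integral>\<^sup>+t. ennreal (pi * ((cmod z)\<^sup>2 * normal_density m (1/s) t)) \<partial>lborel) =
      (\<integral>\<^sup>+t. (ennreal pi * ennreal ((cmod z)\<^sup>2)) * ennreal (normal_density m (1/s) t) \<partial>lborel)"
      using s by (intro nn_integral_cong) (simp add: ennreal_mult mult.assoc)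
    also have "\<dots> = ennreal pi * ennreal ((cmod z)\<^sup>2)"
      using s by (subst nn_integral_cmult) (auto simp: nn_integral_normal_density)
    finally show ?thesis .
  qed
  have conv: "ennreal (cmod (\<integral>u. f u * of_real (?N (u + (- t))) \<partial>lborel))
     \<le> (\<integral>\<^sup>+u. ennreal (cmod (f u) * ?N (u - t)) \<partial>lborel)" for t
  proof -
    have "integrable lborel (\<lambda>u. f u * complex_of_real (?N (u + (- t))))"
    proof (rule Bochner_Integration.integrable_bound)
      show "integrable lborel (\<lambda>u. (s / sqrt (2 * pi)) *\<^sub>R f u)" using f by simp
      show "AE u in lborel. norm (f u * complex_of_real (?N (u + (- t)))) \<le> norm ((s / sqrt (2 * pi)) *\<^sub>R f u)"
      proof (rule AE_I2)
        fix u
        \<comment> \<open>The bound is the peak value of the normal density with deviation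
          \<open>1/s\<close>.\<close>
        have "?N (u + - t) \<le> s / sqrt (2 * pi)"
          using s by (auto simp: normal_density_def real_sqrt_divide divide_le_eq
              real_sqrt_mult intro!: mult_left_le_one_le order_trans[OF mult_left_mono[where b=1]])
        then show "norm (f u * complex_of_real (?N (u + (- t)))) \<le> norm ((s / sqrt (2 * pi)) *\<^sub>R f u)"
          using s by (simp add: norm_mult mult.commute[of "cmod _"] mult_right_mono del: times_divide_eq_left)
      qed
    qed auto
    from integral_norm_bound_ennreal[OF this] show ?thesis by (simp add: norm_mult)
  qed
  have "(\<integral>\<^sup>+x. ennreal ((cmod (ft f x))\<^sup>2 * gauss s x) \<partial>lborel) = (\<integral>\<^sup>+x. ennreal (Re (ft f x * g x)) \<partial>lborel)"
  proof (rule nn_integral_cong)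
    fix x
    have "ft f x * g x = of_real ((cmod (ft f x))\<^sup>2 * gauss s x)"
      unfolding g_def of_real_mult complex_norm_square by (simp only: mult_ac)
    then show "ennreal ((cmod (ft f x))\<^sup>2 * gauss s x) = ennreal (Re (ft f x * g x))" by simp
  qed
  also have "\<dots> = ennreal (\<integral>x. Re (ft f x * g x) \<partial>lborel)"
  proof (rule nn_integral_eq_integral)
    show "integrable lborel (\<lambda>x. Re (ft f x * g x))"
      using integrable_bounded_linear[OF bounded_linear_Re int_ftg] .
    have "ft f x * g x = of_real ((cmod (ft f x))\<^sup>2 * gauss s x)" for x
      unfolding g_def of_real_mult complex_norm_square by (simp only: mult_ac)
    then show "AE x in lborel. 0 \<le> Re (ft f x * g x)"
      using gauss_pos[of s] by (auto simp: less_imp_le)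
  qed
  also have "\<dots> \<le> ennreal (cmod (\<integral>x. ft f x * g x \<partial>lborel))"
  proof (rule ennreal_leI)
    have "(\<integral>x. Re (ft f x * g x) \<partial>lborel) = Re (\<integral>x. ft f x * g x \<partial>lborel)"
      by (rule integral_bounded_linear[OF bounded_linear_Re int_ftg])
    then show "(\<integral>x. Re (ft f x * g x) \<partial>lborel) \<le> cmod (\<integral>x. ft f x * g x \<partial>lborel)"
      by (simp only: complex_Re_le_cmod)
  qed
  also have "(\<integral>x. ft f x * g x \<partial>lborel) = (\<integral>t. f t * ft g t \<partial>lborel)"
    by (rule ft_multiplication_formula[OF f g])
  also have "ennreal (cmod \<dots>) \<le> (\<integral>\<^sup>+t. ennreal (cmod (f t * ft g t)) \<partial>lborel)"
  proof (rule integral_norm_bound_ennreal, rule Bochner_Integration.integrable_bound)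
    show "integrable lborel (\<lambda>x. (\<integral>t. cmod (g t) \<partial>lborel) *\<^sub>R f x)" using f by simp
    show "AE x in lborel. norm (f x * ft g x) \<le> norm ((\<integral>t. cmod (g t) \<partial>lborel) *\<^sub>R f x)"
      using ft_bound[OF g] by (auto simp: norm_mult mult.commute[of "cmod (f _)"] intro!: mult_right_mono)
  qed auto
  also have "\<dots> \<le> (\<integral>\<^sup>+t. (\<integral>\<^sup>+u. ennreal (pi * ((cmod (f t))\<^sup>2 * ?N (u - t))) + ennreal (pi * ((cmod (f u))\<^sup>2 * ?N (u - t))) \<partial>lborel) \<partial>lborel)"
  proof (rule nn_integral_mono)
    fix t
    have "ennreal (cmod (ft g t)) \<le> ennreal (2 * pi * cmod (\<integral>u. f u * of_real (?N (u + (- t))) \<partial>lborel))"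
      by (rule ennreal_leI[OF ftg])
    also have "\<dots> = ennreal (2 * pi) * ennreal (cmod (\<integral>u. f u * of_real (?N (u + (- t))) \<partial>lborel))"
      by (rule ennreal_mult) auto
    also have "\<dots> \<le> ennreal (2 * pi) * (\<integral>\<^sup>+u. ennreal (cmod (f u) * ?N (u - t)) \<partial>lborel)"
      by (rule mult_left_mono[OF conv]) simp
    finally have "ennreal (cmod (f t * ft g t)) \<le> ennreal (cmod (f t)) * (ennreal (2 * pi) * (\<integral>\<^sup>+u. ennreal (cmod (f u) * ?N (u - t)) \<partial>lborel))"
      unfolding norm_mult ennreal_mult[OF norm_ge_zero norm_ge_zero]
      by (rule mult_left_mono) simp
    also have "\<dots> = (\<integral>\<^sup>+u. ennreal (cmod (f t)) * (ennreal (2 * pi) * ennreal (cmod (f u) * ?N (u - t))) \<partial>lborel)"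
      by (simp add: nn_integral_cmult)
    also have "\<dots> \<le> (\<integral>\<^sup>+u. ennreal (pi * ((cmod (f t))\<^sup>2 * ?N (u - t))) + ennreal (pi * ((cmod (f u))\<^sup>2 * ?N (u - t))) \<partial>lborel)"
    proof (rule nn_integral_mono)
      fix u
      have "2 * (cmod (f t) * cmod (f u)) * (pi * ?N (u - t)) \<le> ((cmod (f t))\<^sup>2 + (cmod (f u))\<^sup>2) * (pi * ?N (u - t))"
        using sum_squares_bound[of "cmod (f t)" "cmod (f u)"] s
        by (intro mult_right_mono) (auto simp: mult.assoc)
      then have "ennreal (cmod (f t) * (2 * pi * (cmod (f u) * ?N (u - t)))) \<le> ennreal (pi * ((cmod (f t))\<^sup>2 * ?N (u - t)) + pi * ((cmod (f u))\<^sup>2 * ?N (u - t)))"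
        by (intro ennreal_leI) (simp add: algebra_simps)
      then show "ennreal (cmod (f t)) * (ennreal (2 * pi) * ennreal (cmod (f u) * ?N (u - t)))
        \<le> ennreal (pi * ((cmod (f t))\<^sup>2 * ?N (u - t))) + ennreal (pi * ((cmod (f u))\<^sup>2 * ?N (u - t)))"
        by (simp add: ennreal_mult[symmetric] ennreal_plus[symmetric] del: ennreal_plus)
    qed
    finally show "ennreal (cmod (f t * ft g t)) \<le> \<dots>" .
  qed
  also have "\<dots> = (\<integral>\<^sup>+t. (\<integral>\<^sup>+u. ennreal (pi * ((cmod (f t))\<^sup>2 * ?N (u - t))) \<partial>lborel) \<partial>lborel) +
      (\<integral>\<^sup>+t. (\<integral>\<^sup>+u. ennreal (pi * ((cmod (f u))\<^sup>2 * ?N (u - t))) \<partial>lborel) \<partial>lborel)"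
    by (simp add: nn_integral_add)
  also have "(\<integral>\<^sup>+t. (\<integral>\<^sup>+u. ennreal (pi * ((cmod (f u))\<^sup>2 * ?N (u - t))) \<partial>lborel) \<partial>lborel)
      = (\<integral>\<^sup>+u. (\<integral>\<^sup>+t. ennreal (pi * ((cmod (f u))\<^sup>2 * ?N (u - t))) \<partial>lborel) \<partial>lborel)"
    by (rule lborel_pair.Fubini') measurable
  also have "(\<lambda>u. (\<integral>\<^sup>+t. ennreal (pi * ((cmod (f u))\<^sup>2 * ?N (u - t))) \<partial>lborel)) = (\<lambda>u. ennreal pi * ennreal ((cmod (f u))\<^sup>2))"
  proof
    fix u
    have "?N (u - t) = normal_density u (1/s) t" for t
      by (simp add: normal_density_def power2_commute)
    then show "(\<integral>\<^sup>+t. ennreal (pi * ((cmod (f u))\<^sup>2 * ?N (u - t))) \<partial>lborel) = ennreal pi * ennreal ((cmod (f u))\<^sup>2)"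
      by (simp only: mass)
  qed
  also have "(\<lambda>t. (\<integral>\<^sup>+u. ennreal (pi * ((cmod (f t))\<^sup>2 * ?N (u - t))) \<partial>lborel)) = (\<lambda>u. ennreal pi * ennreal ((cmod (f u))\<^sup>2))"
  proof
    fix t
    have "?N (u - t) = normal_density t (1/s) u" for u
      by (simp add: normal_density_def)
    then show "(\<integral>\<^sup>+u. ennreal (pi * ((cmod (f t))\<^sup>2 * ?N (u - t))) \<partial>lborel) = ennreal pi * ennreal ((cmod (f t))\<^sup>2)"
      by (simp only: mass)
  qed
  also have "(\<integral>\<^sup>+u. ennreal pi * ennreal ((cmod (f u))\<^sup>2) \<partial>lborel) + (\<integral>\<^sup>+u. ennreal pi * ennreal ((cmod (f u))\<^sup>2) \<partial>lborel)
     = ennreal (2 * pi) * sqnorm f"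
  proof -
    have "(\<integral>\<^sup>+u. ennreal pi * ennreal ((cmod (f u))\<^sup>2) \<partial>lborel) = ennreal pi * sqnorm f"
      unfolding sqnorm_def by (rule nn_integral_cmult) measurable
    moreover have "ennreal pi * sqnorm f + ennreal pi * sqnorm f = (ennreal pi + ennreal pi) * sqnorm f"
      by (rule distrib_right[symmetric])
    moreover have "ennreal pi + ennreal pi = ennreal (2 * pi)"
      by (subst ennreal_plus[symmetric]) auto
    ultimately show ?thesis by simp
  qed
  finally show ?thesis .
qed

text \<open>The bound of \<open>ft_weighted_le\<close> does not depend on the width of the Gaussian,
  so it survives when the weight increases to 1.\<close>

lemma ft_bessel:
  assumes f: "integrable lborel f"
  shows "sqnorm (ft f) \<le> ennreal (2 * pi) * sqnorm f"
proof -
  have [measurable]: "f \<in> borel_measurable borel" using f by auto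
  have "sqnorm (ft f) = (\<integral>\<^sup>+x. (SUP n. ennreal ((cmod (ft f x))\<^sup>2 * gauss (real (Suc n)) x)) \<partial>lborel)"
    unfolding sqnorm_def
  proof (rule nn_integral_cong)
    fix x
    have "(\<lambda>n. (cmod (ft f x))\<^sup>2 * gauss (real (Suc n)) x) \<longlonglongrightarrow> (cmod (ft f x))\<^sup>2 * exp 0"
      unfolding gauss_def
    proof (intro tendsto_mult tendsto_const tendsto_exp)
      show "(\<lambda>n. - x\<^sup>2 / (2 * (real (Suc n))\<^sup>2)) \<longlonglongrightarrow> 0" by real_asymp
    qed
    then have "(\<lambda>n. ennreal ((cmod (ft f x))\<^sup>2 * gauss (real (Suc n)) x)) \<longlonglongrightarrow> ennreal ((cmod (ft f x))\<^sup>2)"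
      by (intro tendsto_ennrealI) simp
    moreover have "incseq (\<lambda>n. ennreal ((cmod (ft f x))\<^sup>2 * gauss (real (Suc n)) x))"
      by (intro incseq_SucI ennreal_leI mult_left_mono)
         (auto simp: gauss_def intro!: divide_left_mono power_mono mult_left_mono)
    ultimately show "ennreal ((cmod (ft f x))\<^sup>2) = (SUP n. ennreal ((cmod (ft f x))\<^sup>2 * gauss (real (Suc n)) x))"
      using LIMSEQ_SUP LIMSEQ_unique by blast
  qed
  also have "\<dots> = (SUP n. \<integral>\<^sup>+x. ennreal ((cmod (ft f x))\<^sup>2 * gauss (real (Suc n)) x) \<partial>lborel)"
    by (rule nn_integral_monotone_convergence_SUP)
       (auto intro!: incseq_SucI ennreal_leI mult_left_mono le_funI simp: gauss_def intro!: divide_left_mono power_mono mult_left_mono)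
  also have "\<dots> \<le> ennreal (2 * pi) * sqnorm f"
    by (rule SUP_least) (rule ft_weighted_le[OF f], simp)
  finally show ?thesis .
qed

section \<open>The Fourier transform on \<open>L\<^sup>2\<close>\<close>

lemma square_integrable_indicator:
  "square_integrable (indicator {a..b::real} :: real \<Rightarrow> complex)"
proof -
  have "sqnorm (indicator {a..b::real} :: real \<Rightarrow> complex) = (\<integral>\<^sup>+x. indicator {a..b} x \<partial>lborel)"
    unfolding sqnorm_def by (intro nn_integral_cong) (auto simp: indicator_def)
  then show ?thesis by (auto simp: square_integrable_def emeasure_lborel_Icc_eq)
qed

text \<open>The function is cut to bounded windows, where it becomes integrable. The sets over which
  its integral vanishes are closed under complements and countable disjoint unions and contain the
  intervals, an intersection-stable generator of the Borel sets.\<close>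

lemma AE_eq_0_if_interval_integrals_0:
  assumes u: "square_integrable u"
    and zero: "\<And>a b::real. (\<integral>x. u x * indicator {a..b} x \<partial>lborel) = 0"
  shows "AE x in lborel. u x = 0"
proof -
  have [measurable]: "u \<in> borel_measurable borel" using u by (simp add: square_integrable_def)
  have "AE x in lborel. u x * indicator {- real n..real n} x = 0" for n
  proof -
    let ?v = "\<lambda>x. u x * indicator {- real n..real n} x"
    have int: "integrable lborel ?v"
      by (rule integrable_mult_square_integrable[OF u square_integrable_indicator])
    show ?thesis
    proof (rule sigma_finite_measure.density_zero[OF sigma_finite_lborel int])
      fix A :: "real set" assume "A \<in> sets lborel"
      then have A: "A \<in> sigma_sets UNIV (range (\<lambda>(a, b). {a..b::real}))"
        using borel_eq_atLeastAtMost by (metis sets_lborel sets_measure_of top_greatest Pow_UNIV)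
      have sets: "B \<in> sets borel" if "B \<in> sigma_sets UNIV (range (\<lambda>(a, b). {a..b::real}))" for B
        using that borel_eq_atLeastAtMost by (metis sets_measure_of top_greatest Pow_UNIV)
      have Is: "Int_stable (range (\<lambda>(a, b). {a..b::real}))"
        by (auto simp: Int_stable_def)
      have tot: "(\<integral>x. ?v x \<partial>lborel) = 0" by (rule zero)
      show "set_lebesgue_integral lborel A ?v = 0"
        using Is subset_UNIV[of "range (\<lambda>(a, b). {a..b::real})", folded Pow_UNIV] A
      proof (induction rule: sigma_sets_induct_disjoint)
        case (basic A)
        then obtain a b where A: "A = {a..b}" by auto
        \<comment> \<open>Two closed intervals meet in a closed interval, possibly an empty one, so
          the hypothesis covers the windowed integral.\<close>
        have "set_lebesgue_integral lborel A ?v = (\<integral>x. u x * indicator {max a (- real n)..min b (real n)} x \<partial>lborel)"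
          unfolding set_lebesgue_integral_def A
          by (intro Bochner_Integration.integral_cong) (auto simp: indicator_def)
        then show ?case using zero by simp
      next
        case (compl A)
        have "set_lebesgue_integral lborel (UNIV - A) ?v = (\<integral>x. ?v x - indicator A x *\<^sub>R ?v x \<partial>lborel)"
          unfolding set_lebesgue_integral_def
          by (intro Bochner_Integration.integral_cong) (auto simp: indicator_def)
        also have "\<dots> = (\<integral>x. ?v x \<partial>lborel) - (\<integral>x. indicator A x *\<^sub>R ?v x \<partial>lborel)"
          using sets[OF compl(1)] by (intro Bochner_Integration.integral_diff int integrable_mult_indicator) auto
        also have "\<dots> = 0" using tot compl(2) by (simp add: set_lebesgue_integral_def)
        finally show ?case .
      next
        case (union A)
        have "set_lebesgue_integral lborel (\<Union>i. A i) ?v = (\<Sum>i. set_lebesgue_integral lborel (A i) ?v)"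
        proof (rule lebesgue_integral_countable_add)
          show "A i \<in> sets lborel" for i using union(2) sets by auto
          show "A i \<inter> A j = {}" if "i \<noteq> j" for i j using union(1) that by (auto simp: disjoint_family_on_def)
          have "(\<Union>i. A i) \<in> sets lborel" using union(2) sets by auto
          then show "set_integrable lborel (\<Union>i. A i) ?v"
            unfolding set_integrable_def by (rule integrable_mult_indicator[OF _ int])
        qed
        then show ?case using union(3) by simp
      qed (auto simp: set_lebesgue_integral_def)
    qed
  qed
  then have "AE x in lborel. \<forall>n::nat. u x * indicator {- real n..real n} x = 0"
    unfolding AE_all_countable by blast
  then show ?thesis
  proof (eventually_elim)
    case (elim x)
    obtain n where "\<bar>x\<bar> \<le> real n" using real_arch_simple by blast
    then show ?case using elim[rule_format, of n] by (auto simp: indicator_def abs_le_iff split: if_splits)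
  qed
qed

lemma sqnorm_fatou:
  assumes [measurable]: "\<And>n. v n \<in> borel_measurable borel" "w \<in> borel_measurable borel"
    and lim: "AE x in lborel. (\<lambda>n. v n x) \<longlonglongrightarrow> w x"
  shows "sqnorm w \<le> liminf (\<lambda>n. sqnorm (v n))"
proof -
  have "sqnorm w = (\<integral>\<^sup>+x. liminf (\<lambda>n. ennreal ((cmod (v n x))\<^sup>2)) \<partial>lborel)"
    unfolding sqnorm_def
  proof (rule nn_integral_cong_AE)
    show "AE x in lborel. ennreal ((cmod (w x))\<^sup>2) = liminf (\<lambda>n. ennreal ((cmod (v n x))\<^sup>2))"
      using lim
    proof eventually_elim
      case (elim x)
      then have "(\<lambda>n. ennreal ((cmod (v n x))\<^sup>2)) \<longlonglongrightarrow> ennreal ((cmod (w x))\<^sup>2)"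
        by (intro tendsto_ennrealI tendsto_power tendsto_norm)
      from lim_imp_Liminf[OF sequentially_bot this] show ?case by (rule sym)
    qed
  qed
  also have "\<dots> \<le> liminf (\<lambda>n. sqnorm (v n))"
    unfolding sqnorm_def by (rule nn_integral_liminf) auto
  finally show ?thesis .
qed

lemma sqnorm_dominated:
  assumes [measurable]: "\<And>n. v n \<in> borel_measurable borel"
    and f: "square_integrable f"
    and bound: "\<And>n x. cmod (v n x) \<le> cmod (f x)"
    and lim: "AE x in lborel. (\<lambda>n. v n x) \<longlonglongrightarrow> 0"
  shows "(\<lambda>n. sqnorm (v n)) \<longlonglongrightarrow> 0"
proof -
  have [measurable]: "f \<in> borel_measurable borel" using f by (simp add: square_integrable_def)
  have "(\<lambda>n. \<integral>\<^sup>+x. ennreal ((cmod (v n x))\<^sup>2) \<partial>lborel) \<longlonglongrightarrow> nn_integral lborel (\<lambda>_::real. 0)"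
  proof (rule nn_integral_dominated_convergence[where w="\<lambda>x. ennreal ((cmod (f x))\<^sup>2)"])
    show "AE x in lborel. ennreal ((cmod (v n x))\<^sup>2) \<le> ennreal ((cmod (f x))\<^sup>2)" for n
      using bound by (auto intro!: ennreal_leI power_mono)
    show "(\<integral>\<^sup>+ x. ennreal ((cmod (f x))\<^sup>2) \<partial>lborel) < \<infinity>"
      using f by (simp add: square_integrable_def sqnorm_def)
    show "AE x in lborel. (\<lambda>n. ennreal ((cmod (v n x))\<^sup>2)) \<longlonglongrightarrow> 0"
      using lim
    proof eventually_elim
      case (elim x)
      then have "(\<lambda>n. ennreal ((cmod (v n x))\<^sup>2)) \<longlonglongrightarrow> ennreal ((cmod 0)\<^sup>2)"
        by (intro tendsto_ennrealI tendsto_power tendsto_norm)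
      then show ?case by simp
    qed
  qed auto
  then show ?thesis by (simp add: sqnorm_def)
qed

lemma sqnorm_limit_unique:
  assumes [measurable]: "\<And>n. u n \<in> borel_measurable borel" "g \<in> borel_measurable borel" "h \<in> borel_measurable borel"
    and "((\<lambda>n. sqnorm (\<lambda>x. u n x - g x)) \<longlongrightarrow> 0) F" "((\<lambda>n. sqnorm (\<lambda>x. u n x - h x)) \<longlongrightarrow> 0) F" "F \<noteq> bot"
  shows "AE x in lborel. g x = h x"
proof -
  have le: "sqnorm (\<lambda>x. g x - h x) \<le> 2 * sqnorm (\<lambda>x. u n x - h x) + 2 * sqnorm (\<lambda>x. u n x - g x)" for n
    using sqnorm_diff_le[of "\<lambda>x. u n x - h x" "\<lambda>x. u n x - g x"] by simp
  have "((\<lambda>n. 2 * sqnorm (\<lambda>x. u n x - h x) + 2 * sqnorm (\<lambda>x. u n x - g x)) \<longlongrightarrow> 2 * 0 + 2 * 0) F"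
    using assms(4,5) by (intro tendsto_add ennreal_tendsto_cmult) auto
  then have "sqnorm (\<lambda>x. g x - h x) \<le> 2 * 0 + 2 * 0"
    by (rule tendsto_lowerbound) (use le assms(6) in auto)
  then have "sqnorm (\<lambda>x. g x - h x) = 0" by simp
  then show ?thesis by (subst (asm) sqnorm_eq_0_iff) auto
qed

text \<open>Fatou's lemma identifies the L2 limit with the pointwise limit directly.\<close>

lemma sqnorm_limit_AE_unique:
  assumes [measurable]: "\<And>n. u n \<in> borel_measurable borel" "g \<in> borel_measurable borel" "h \<in> borel_measurable borel"
    and lim: "(\<lambda>n. sqnorm (\<lambda>x. u n x - g x)) \<longlonglongrightarrow> 0" and ae: "AE x in lborel. (\<lambda>n. u n x) \<longlonglongrightarrow> h x"
  shows "AE x in lborel. g x = h x"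
proof -
  have "sqnorm (\<lambda>x. h x - g x) \<le> liminf (\<lambda>n. sqnorm (\<lambda>x. u n x - g x))"
  proof (rule sqnorm_fatou)
    show "AE x in lborel. (\<lambda>n. u n x - g x) \<longlonglongrightarrow> h x - g x"
      using ae by eventually_elim (intro tendsto_intros)
  qed auto
  also have "\<dots> = 0" using lim by (simp add: lim_imp_Liminf)
  finally have "sqnorm (\<lambda>x. h x - g x) = 0" by simp
  then show ?thesis by (subst (asm) sqnorm_eq_0_iff) auto
qed

text \<open>Riesz-Fischer. Only pointwise convergence along a subsequence is delivered; callers
  recover norm estimates from it by Fatou's lemma.\<close>

lemma sqnorm_complete:
  assumes u: "\<And>n. square_integrable (u n)"
    and cauchy: "\<And>e::real. 0 < e \<Longrightarrow> \<exists>N::nat. \<forall>m\<ge>N. \<forall>n\<ge>N. sqnorm (\<lambda>x. u m x - u n x) \<le> ennreal e"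
  obtains g r where "square_integrable g" "strict_mono r" "AE x in lborel. (\<lambda>k. u (r k) x) \<longlonglongrightarrow> g x"
proof -
  have [measurable]: "u n \<in> borel_measurable borel" for n using u by (auto simp: square_integrable_def)
  obtain N where N: "\<And>k m n. N k \<le> m \<Longrightarrow> N k \<le> n \<Longrightarrow> sqnorm (\<lambda>x. u m x - u n x) \<le> ennreal ((1/4)^k)"
    using cauchy[of "(1/4)^k" for k] by (metis zero_less_power zero_less_divide_iff zero_less_numeral zero_less_one)
  \<comment> \<open>Partial sums of \<open>Suc (N j)\<close> are strictly increasing and dominate
    each \<open>N k\<close>.\<close>
  define r where "r k = (\<Sum>j\<le>k. Suc (N j))" for k
  have r: "strict_mono r" by (rule strict_monoI_Suc) (simp add: r_def)
  have rN: "N k \<le> r k" for k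
    unfolding r_def by (rule order_trans[OF _ member_le_sum[of k]]) auto
  \<comment> \<open>The decay \<open>4^-k\<close> leaves room for a weight \<open>2^k\<close>: the
    weighted squares still have a finite sum, and almost everywhere this bounds the k-th increment
    by a multiple of \<open>2^(-k/2)\<close>, which is summable.\<close>
  have step: "sqnorm (\<lambda>x. u (r (Suc k)) x - u (r k) x) \<le> ennreal ((1/4)^k)" for k
    using N[of k "r (Suc k)" "r k"] rN[of k] strict_monoD[OF r, of k "Suc k"] by auto
  have "(\<integral>\<^sup>+x. (\<Sum>k. 2^k * ennreal ((cmod (u (r (Suc k)) x - u (r k) x))\<^sup>2)) \<partial>lborel)
     = (\<Sum>k. 2^k * sqnorm (\<lambda>x. u (r (Suc k)) x - u (r k) x))"
    unfolding sqnorm_def by (subst nn_integral_suminf) (auto simp: nn_integral_cmult)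
  also have "\<dots> \<le> (\<Sum>k. ennreal ((1/2)^k))"
  proof (rule suminf_le)
    fix k
    have "2^k * sqnorm (\<lambda>x. u (r (Suc k)) x - u (r k) x) \<le> ennreal (2^k) * ennreal ((1/4)^k)"
      using step[of k] by (simp add: mult_left_mono ennreal_power[symmetric])
    also have "\<dots> = ennreal ((1/2)^k)"
      by (simp add: ennreal_mult[symmetric] power_mult_distrib[symmetric])
    finally show "2^k * sqnorm (\<lambda>x. u (r (Suc k)) x - u (r k) x) \<le> ennreal ((1/2)^k)" .
  qed auto
  also have "\<dots> < \<infinity>"
    by (subst suminf_ennreal2) auto
  finally have "AE x in lborel. (\<Sum>k. 2^k * ennreal ((cmod (u (r (Suc k)) x - u (r k) x))\<^sup>2)) \<noteq> \<infinity>"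
    by (intro nn_integral_noteq_infinite) auto
  then have conv: "AE x in lborel. convergent (\<lambda>k. u (r k) x)"
  proof eventually_elim
    case (elim x)
    let ?d = "\<lambda>k. u (r (Suc k)) x - u (r k) x"
    obtain C where C: "0 \<le> C" "(\<Sum>k. 2^k * ennreal ((cmod (?d k))\<^sup>2)) = ennreal C"
      using elim by (cases "(\<Sum>k. 2^k * ennreal ((cmod (?d k))\<^sup>2))") auto
    have le: "cmod (?d k) \<le> sqrt C * (1 / sqrt 2)^k" for k
    proof -
      have "2^k * ennreal ((cmod (?d k))\<^sup>2) \<le> (\<Sum>k. 2^k * ennreal ((cmod (?d k))\<^sup>2))"
        using sum_le_suminf[of "\<lambda>k. 2^k * ennreal ((cmod (?d k))\<^sup>2)" "{k}"] by simp
      then have "ennreal (2^k * (cmod (?d k))\<^sup>2) \<le> ennreal C"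
        unfolding C by (simp add: ennreal_mult ennreal_power[symmetric])
      then have "2^k * (cmod (?d k))\<^sup>2 \<le> C" using C(1) by (simp add: ennreal_le_iff)
      then have "(cmod (?d k))\<^sup>2 \<le> C * (1/2)^k" by (simp add: power_divide field_simps)
      then have "sqrt ((cmod (?d k))\<^sup>2) \<le> sqrt (C * (1/2)^k)" by (rule real_sqrt_le_mono)
      then show ?thesis by (simp add: real_sqrt_mult real_sqrt_power real_sqrt_divide)
    qed
    have "summable ?d"
    proof (rule summable_comparison_test')
      show "summable (\<lambda>k. sqrt C * (1 / sqrt 2)^k)"
        by (intro summable_mult summable_geometric) auto
      show "norm (?d k) \<le> sqrt C * (1 / sqrt 2)^k" if "k \<ge> 0" for k using le .
    qed
    then have "(\<lambda>n. \<Sum>k<n. ?d k) \<longlonglongrightarrow> suminf ?d" by (rule summable_LIMSEQ)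
    then have "(\<lambda>n. (\<Sum>k<n. ?d k) + u (r 0) x) \<longlonglongrightarrow> suminf ?d + u (r 0) x" by (intro tendsto_intros)
    then have "(\<lambda>n. u (r n) x) \<longlonglongrightarrow> suminf ?d + u (r 0) x"
      unfolding sum_lessThan_telescope[of "\<lambda>k. u (r k) x"] by simp
    then show ?case by (rule convergentI)
  qed
  define g where "g x = lim (\<lambda>k. u (r k) x)" for x
  have [measurable]: "g \<in> borel_measurable borel" unfolding g_def[abs_def] by measurable
  have lim: "AE x in lborel. (\<lambda>k. u (r k) x) \<longlonglongrightarrow> g x"
    using conv by eventually_elim (simp add: g_def convergent_LIMSEQ_iff)
  \<comment> \<open>The limit lies within distance 1 of the square integrable function
    \<open>u (r 0)\<close>, hence is square integrable itself.\<close>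
  have "sqnorm (\<lambda>x. u (r 0) x - g x) \<le> liminf (\<lambda>k. sqnorm (\<lambda>x. u (r 0) x - u (r k) x))"
    by (rule sqnorm_fatou) (use lim in \<open>auto elim!: eventually_mono intro!: tendsto_intros\<close>)
  also have "\<dots> \<le> ennreal 1"
  proof (rule Liminf_le)
    have "sqnorm (\<lambda>x. u (r 0) x - u (r k) x) \<le> ennreal ((1/4)^0)" for k
      using rN[of 0] strict_mono_less_eq[OF r, of 0 k] by (intro N) auto
    then show "\<forall>\<^sub>F k in sequentially. sqnorm (\<lambda>x. u (r 0) x - u (r k) x) \<le> ennreal 1" by simp
  qed simp
  finally have "square_integrable (\<lambda>x. u (r 0) x - g x)"
    by (auto simp: square_integrable_def intro: le_less_trans)
  from square_integrable_diff[OF u[of "r 0"] this] have "square_integrable g" by simp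
  with r lim show ?thesis using that by blast
qed

section \<open>Truncations and the Plancherel extension\<close>

text \<open>A truncated square integrable function is integrable, so \<open>ft\<close> applies to
  it. The symmetric window is that of \<open>fourier_truncated\<close>.\<close>

definition trunc :: "real \<Rightarrow> (real \<Rightarrow> complex) \<Rightarrow> real \<Rightarrow> complex" where
  "trunc R f x = indicator {-R..R} x * f x"

lemma trunc_measurable [measurable]: "f \<in> borel_measurable borel \<Longrightarrow> trunc R f \<in> borel_measurable borel"
  unfolding trunc_def[abs_def] by measurable

lemma cmod_trunc_le: "cmod (trunc R f x) \<le> cmod (f x)"
  by (auto simp: trunc_def indicator_def)

lemma square_integrable_trunc: "square_integrable f \<Longrightarrow> square_integrable (trunc R f)"
  by (rule square_integrable_bound) (auto simp: square_integrable_def cmod_trunc_le)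

lemma sqnorm_trunc_le: "sqnorm (trunc R f) \<le> sqnorm f"
  by (rule sqnorm_mono) (rule cmod_trunc_le)

lemma sqnorm_minus_trunc_le: "sqnorm (\<lambda>x. f x - trunc R f x) \<le> sqnorm f"
  by (rule sqnorm_mono) (auto simp: trunc_def indicator_def)

lemma integrable_trunc:
  assumes "square_integrable f" shows "integrable lborel (trunc R f)"
  using integrable_mult_square_integrable[OF square_integrable_indicator assms]
  by (simp add: trunc_def[abs_def])

lemma sqnorm_minus_trunc_tendsto:
  assumes f: "square_integrable f"
  shows "((\<lambda>R. sqnorm (\<lambda>x. f x - trunc R f x)) \<longlongrightarrow> 0) at_top"
proof (rule tendsto_at_topI_sequentially)
  fix X :: "nat \<Rightarrow> real" assume X: "filterlim X at_top sequentially"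
  have [measurable]: "f \<in> borel_measurable borel" using f by (simp add: square_integrable_def)
  show "(\<lambda>n. sqnorm (\<lambda>x. f x - trunc (X n) f x)) \<longlonglongrightarrow> 0"
  proof (rule sqnorm_dominated[OF _ f])
    show "cmod (f x - trunc (X n) f x) \<le> cmod (f x)" for n x by (auto simp: trunc_def indicator_def)
    show "AE x in lborel. (\<lambda>n. f x - trunc (X n) f x) \<longlonglongrightarrow> 0"
    proof (rule AE_I2)
      fix x
      have "\<forall>\<^sub>F n in sequentially. \<bar>x\<bar> \<le> X n" using X by (simp add: filterlim_at_top)
      then have "\<forall>\<^sub>F n in sequentially. 0 = f x - trunc (X n) f x"
        by eventually_elim (auto simp: trunc_def indicator_def)
      then show "(\<lambda>n. f x - trunc (X n) f x) \<longlonglongrightarrow> 0"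
        by (rule Lim_transform_eventually[OF tendsto_const])
    qed
  qed auto
qed

lemma sqnorm_minus_trunc_tendsto_nat:
  "square_integrable f \<Longrightarrow> (\<lambda>n. sqnorm (\<lambda>x. f x - trunc (real n) f x)) \<longlonglongrightarrow> 0"
  using filterlim_compose[OF sqnorm_minus_trunc_tendsto filterlim_real_sequentially] .

lemma ft_trunc_diff_le:
  assumes f: "square_integrable f"
  shows "sqnorm (\<lambda>x. ft (trunc R f) x - ft (trunc S f) x) \<le> ennreal (2 * pi) * sqnorm (\<lambda>x. trunc R f x - trunc S f x)"
proof -
  have "ft (\<lambda>t. trunc R f t - trunc S f t) = (\<lambda>x. ft (trunc R f) x - ft (trunc S f) x)"
    using ft_diff[OF integrable_trunc[OF f] integrable_trunc[OF f]] by blast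
  then show ?thesis
    using ft_bessel[OF Bochner_Integration.integrable_diff[OF integrable_trunc[OF f, of R] integrable_trunc[OF f, of S]]]
    by simp
qed

lemma square_integrable_ft:
  assumes "square_integrable f" "integrable lborel f"
  shows "square_integrable (ft f)"
proof -
  have [measurable]: "f \<in> borel_measurable borel" using assms by auto
  have "sqnorm (ft f) < \<infinity>"
    using assms(1) by (intro le_less_trans[OF ft_bessel[OF assms(2)]])
      (auto simp: square_integrable_def ennreal_mult_less_top)
  then show ?thesis by (simp add: square_integrable_def)
qed

text \<open>The limit is built along integers, but the claim is an estimate for every real
  \<open>R\<close>; convergence along the continuous parameter then follows at once. The estimate
  comes from the Bessel inequality for differences of truncations and Fatou's lemma.\<close>

lemma plancherel_limit_exists:
  assumes f: "square_integrable f"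
  shows "\<exists>g. square_integrable g \<and>
    (\<forall>R. sqnorm (\<lambda>x. ft (trunc R f) x - g x) \<le> ennreal (2 * pi) * sqnorm (\<lambda>x. f x - trunc R f x))"
proof -
  have [measurable]: "f \<in> borel_measurable borel" using f by (simp add: square_integrable_def)
  let ?u = "\<lambda>n. ft (trunc (real n) f)"
  have u: "square_integrable (?u n)" for n
    by (intro square_integrable_ft square_integrable_trunc integrable_trunc f)
  have cauchy: "\<exists>N::nat. \<forall>m\<ge>N. \<forall>n\<ge>N. sqnorm (\<lambda>x. ?u m x - ?u n x) \<le> ennreal e" if "0 < e" for e :: real
  proof -
    have "(\<lambda>n. ennreal (2 * pi) * (2 * sqnorm (\<lambda>x. f x - trunc (real n) f x))) \<longlonglongrightarrow> ennreal (2 * pi) * (2 * 0)"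
      by (intro ennreal_tendsto_cmult sqnorm_minus_trunc_tendsto_nat f) auto
    moreover have "ennreal (2 * pi) * (2 * 0) < ennreal (e / 2)" using that by simp
    ultimately have "\<forall>\<^sub>F n in sequentially. ennreal (2 * pi) * (2 * sqnorm (\<lambda>x. f x - trunc (real n) f x)) < ennreal (e / 2)"
      by (rule order_tendstoD(2))
    then obtain N where N: "\<And>n. n \<ge> N \<Longrightarrow> ennreal (2 * pi) * (2 * sqnorm (\<lambda>x. f x - trunc (real n) f x)) \<le> ennreal (e / 2)"
      unfolding eventually_sequentially by (meson less_imp_le)
    have "sqnorm (\<lambda>x. ?u m x - ?u n x) \<le> ennreal e" if "m \<ge> N" "n \<ge> N" for m n
    proof -
      have "sqnorm (\<lambda>x. trunc (real m) f x - trunc (real n) f x) \<le>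
          2 * sqnorm (\<lambda>x. f x - trunc (real n) f x) + 2 * sqnorm (\<lambda>x. f x - trunc (real m) f x)"
        using sqnorm_diff_le[of "\<lambda>x. f x - trunc (real n) f x" "\<lambda>x. f x - trunc (real m) f x"] by simp
      then have "ennreal (2 * pi) * sqnorm (\<lambda>x. trunc (real m) f x - trunc (real n) f x) \<le>
          ennreal (2 * pi) * (2 * sqnorm (\<lambda>x. f x - trunc (real n) f x) + 2 * sqnorm (\<lambda>x. f x - trunc (real m) f x))"
        by (rule mult_left_mono) simp
      also have "\<dots> \<le> ennreal (e / 2) + ennreal (e / 2)"
        unfolding distrib_left by (intro add_mono N that)
      also have "\<dots> = ennreal e" using \<open>0 < e\<close> by (simp flip: ennreal_plus)
      finally show ?thesis using ft_trunc_diff_le[OF f] by (rule order_trans[rotated])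
    qed
    then show ?thesis by blast
  qed
  obtain g r where g: "square_integrable g" and r: "strict_mono r"
    and lim: "AE x in lborel. (\<lambda>k. ?u (r k) x) \<longlonglongrightarrow> g x"
    using sqnorm_complete[OF u cauchy] by blast
  have [measurable]: "g \<in> borel_measurable borel" using g by (simp add: square_integrable_def)
  have "sqnorm (\<lambda>x. ft (trunc R f) x - g x) \<le> ennreal (2 * pi) * sqnorm (\<lambda>x. f x - trunc R f x)" for R
  proof -
    have "sqnorm (\<lambda>x. ft (trunc R f) x - g x) \<le> liminf (\<lambda>k. sqnorm (\<lambda>x. ft (trunc R f) x - ?u (r k) x))"
      by (rule sqnorm_fatou) (use lim in \<open>auto elim!: eventually_mono intro!: tendsto_intros\<close>)
    also have "\<dots> \<le> ennreal (2 * pi) * sqnorm (\<lambda>x. f x - trunc R f x)"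
    proof (rule Liminf_le)
      \<comment> \<open>As soon as \<open>r k\<close> exceeds \<open>R\<close>, the difference of
        the two truncations is a piece of \<open>f - trunc R f\<close>.\<close>
      obtain K where K: "R \<le> real K" using real_arch_simple by blast
      have "sqnorm (\<lambda>x. ft (trunc R f) x - ?u (r k) x) \<le> ennreal (2 * pi) * sqnorm (\<lambda>x. f x - trunc R f x)"
        if "k \<ge> K" for k
      proof -
        have "real K \<le> real (r k)" using that seq_suble[OF r, of k] by linarith
        then have "sqnorm (\<lambda>x. trunc R f x - trunc (real (r k)) f x) \<le> sqnorm (\<lambda>x. f x - trunc R f x)"
          using K by (intro sqnorm_mono) (auto simp: trunc_def indicator_def)
        then show ?thesis
          by (intro order_trans[OF ft_trunc_diff_le[OF f]] mult_left_mono) auto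
      qed
      then show "\<forall>\<^sub>F k in sequentially. sqnorm (\<lambda>x. ft (trunc R f) x - ?u (r k) x) \<le> ennreal (2 * pi) * sqnorm (\<lambda>x. f x - trunc R f x)"
        by (auto simp: eventually_sequentially)
    qed simp
    finally show ?thesis .
  qed
  with g show ?thesis by blast
qed

text \<open>The choice operator fixes a function, but the defining property only fixes it up to null
  sets. Hence all identities for \<open>plancherel\<close>, even congruence in \<open>f\<close>,
  hold almost everywhere.\<close>

definition plancherel :: "(real \<Rightarrow> complex) \<Rightarrow> real \<Rightarrow> complex" where
  "plancherel f = (SOME g. square_integrable g \<and>
    (\<forall>R. sqnorm (\<lambda>x. ft (trunc R f) x - g x) \<le> ennreal (2 * pi) * sqnorm (\<lambda>x. f x - trunc R f x)))"

lemma
  assumes "square_integrable f"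
  shows square_integrable_plancherel: "square_integrable (plancherel f)"
    and plancherel_approx:
      "sqnorm (\<lambda>x. ft (trunc R f) x - plancherel f x) \<le> ennreal (2 * pi) * sqnorm (\<lambda>x. f x - trunc R f x)"
  using someI_ex[OF plancherel_limit_exists[OF assms]] unfolding plancherel_def by blast+

lemma plancherel_tendsto:
  assumes f: "square_integrable f"
  shows "((\<lambda>R. sqnorm (\<lambda>x. ft (trunc R f) x - plancherel f x)) \<longlongrightarrow> 0) at_top"
proof (rule tendsto_0_le_ennreal)
  show "((\<lambda>R. ennreal (2 * pi) * sqnorm (\<lambda>x. f x - trunc R f x)) \<longlongrightarrow> 0) at_top"
    using ennreal_tendsto_cmult[OF _ sqnorm_minus_trunc_tendsto[OF f], of "ennreal (2 * pi)"] by simp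
qed (rule plancherel_approx[OF f])

lemma plancherel_unique:
  assumes f: "square_integrable f" and h: "square_integrable h"
    and lim: "((\<lambda>R. sqnorm (\<lambda>x. ft (trunc R f) x - h x)) \<longlongrightarrow> 0) at_top"
  shows "AE x in lborel. plancherel f x = h x"
proof -
  have [measurable]: "f \<in> borel_measurable borel" "h \<in> borel_measurable borel" "plancherel f \<in> borel_measurable borel"
    using f h square_integrable_plancherel[OF f] by (simp_all add: square_integrable_def)
  show ?thesis
    by (rule sqnorm_limit_unique[OF _ _ _ plancherel_tendsto[OF f] lim]) (auto intro: ft_measurable)
qed

text \<open>The value \<open>2 * pi\<close> would be sharp; splitting with the factor 2 loses a
  factor 4. Only boundedness matters for what follows.\<close>

lemma sqnorm_plancherel_le:
  assumes f: "square_integrable f"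
  shows "sqnorm (plancherel f) \<le> ennreal (8 * pi) * sqnorm f"
proof -
  have [measurable]: "f \<in> borel_measurable borel" "plancherel f \<in> borel_measurable borel"
    using f square_integrable_plancherel[OF f] by (simp_all add: square_integrable_def)
  have "sqnorm (plancherel f) \<le> 2 * sqnorm (ft (trunc 0 f)) + 2 * sqnorm (\<lambda>x. ft (trunc 0 f) x - plancherel f x)"
    using sqnorm_diff_le[of "ft (trunc 0 f)" "\<lambda>x. ft (trunc 0 f) x - plancherel f x"] by simp
  also have "\<dots> \<le> 2 * (ennreal (2 * pi) * sqnorm f) + 2 * (ennreal (2 * pi) * sqnorm f)"
    by (intro add_mono mult_left_mono order_trans[OF ft_bessel] order_trans[OF plancherel_approx]
        integrable_trunc f sqnorm_trunc_le sqnorm_minus_trunc_le) auto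
  also have "\<dots> = (2 * ennreal (2 * pi) + 2 * ennreal (2 * pi)) * sqnorm f"
    by (simp only: distrib_right mult.assoc)
  also have "2 * ennreal (2 * pi) + 2 * ennreal (2 * pi) = ennreal (8 * pi)"
  proof -
    have "2 * ennreal (2 * pi) + 2 * ennreal (2 * pi) = ennreal (2 * (2 * pi) + 2 * (2 * pi))"
      by (subst ennreal_plus) (auto simp: ennreal_mult)
    then show ?thesis by simp
  qed
  finally show ?thesis .
qed

lemma plancherel_add:
  assumes f: "square_integrable f" and g: "square_integrable g"
  shows "AE x in lborel. plancherel (\<lambda>x. f x + g x) x = plancherel f x + plancherel g x"
proof (rule plancherel_unique)
  have [measurable]: "f \<in> borel_measurable borel" "g \<in> borel_measurable borel" 
     "plancherel f \<in> borel_measurable borel" "plancherel g \<in> borel_measurable borel"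
    using f g square_integrable_plancherel[OF f] square_integrable_plancherel[OF g] by (simp_all add: square_integrable_def)
  have eq: "ft (trunc R (\<lambda>x. f x + g x)) x = ft (trunc R f) x + ft (trunc R g) x" for R x
    using ft_add[OF integrable_trunc[OF f, of R] integrable_trunc[OF g, of R], of x]
    by (simp add: trunc_def[abs_def] distrib_left)
  show "((\<lambda>R. sqnorm (\<lambda>x. ft (trunc R (\<lambda>x. f x + g x)) x - (plancherel f x + plancherel g x))) \<longlongrightarrow> 0) at_top"
  proof (rule tendsto_0_le_ennreal)
    show "((\<lambda>R. 2 * sqnorm (\<lambda>x. ft (trunc R f) x - plancherel f x) + 2 * sqnorm (\<lambda>x. ft (trunc R g) x - plancherel g x)) \<longlongrightarrow> 0) at_top"
      using tendsto_add[OF ennreal_tendsto_cmult[OF _ plancherel_tendsto[OF f], of 2] ennreal_tendsto_cmult[OF _ plancherel_tendsto[OF g], of 2]]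
      by simp
    show "sqnorm (\<lambda>x. ft (trunc R (\<lambda>x. f x + g x)) x - (plancherel f x + plancherel g x))
       \<le> 2 * sqnorm (\<lambda>x. ft (trunc R f) x - plancherel f x) + 2 * sqnorm (\<lambda>x. ft (trunc R g) x - plancherel g x)" for R
      using sqnorm_add_le[of "\<lambda>x. ft (trunc R f) x - plancherel f x" "\<lambda>x. ft (trunc R g) x - plancherel g x"]
      by (simp add: eq algebra_simps)
  qed
qed (intro square_integrable_add square_integrable_plancherel f g)+

lemma plancherel_cmult:
  assumes f: "square_integrable f"
  shows "AE x in lborel. plancherel (\<lambda>x. c * f x) x = c * plancherel f x"
proof (rule plancherel_unique)
  have [measurable]: "f \<in> borel_measurable borel" "plancherel f \<in> borel_measurable borel"
    using f square_integrable_plancherel[OF f] by (simp_all add: square_integrable_def)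
  have "ft (trunc R (\<lambda>x. c * f x)) x = c * ft (trunc R f) x" for R x
    using ft_cmult[of c "trunc R f" x] by (simp add: trunc_def[abs_def] mult.left_commute)
  then have "sqnorm (\<lambda>x. ft (trunc R (\<lambda>x. c * f x)) x - c * plancherel f x)
      = ennreal ((cmod c)\<^sup>2) * sqnorm (\<lambda>x. ft (trunc R f) x - plancherel f x)" for R
    by (subst sqnorm_cmult[symmetric]) (auto simp: right_diff_distrib)
  then show "((\<lambda>R. sqnorm (\<lambda>x. ft (trunc R (\<lambda>x. c * f x)) x - c * plancherel f x)) \<longlongrightarrow> 0) at_top"
    using ennreal_tendsto_cmult[OF _ plancherel_tendsto[OF f], of "ennreal ((cmod c)\<^sup>2)"] by simp
qed (intro square_integrable_cmult square_integrable_plancherel f)+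

lemma plancherel_diff:
  assumes f: "square_integrable f" and g: "square_integrable g"
  shows "AE x in lborel. plancherel (\<lambda>x. f x - g x) x = plancherel f x - plancherel g x"
  using plancherel_add[OF f square_integrable_cmult[OF g, of "-1"]] plancherel_cmult[OF g, of "-1"]
  by eventually_elim simp

lemma plancherel_cong_AE:
  assumes f: "square_integrable f" and g: "square_integrable g" and "AE x in lborel. f x = g x"
  shows "AE x in lborel. plancherel f x = plancherel g x"
proof (rule plancherel_unique[OF f square_integrable_plancherel[OF g]])
  have [measurable]: "f \<in> borel_measurable borel" "g \<in> borel_measurable borel" 
    using f g by (simp_all add: square_integrable_def)
  have "ft (trunc R f) = ft (trunc R g)" for R
    unfolding ft_def[abs_def] using assms(3)
    by (intro ext integral_cong_AE) (auto simp: trunc_def elim!: eventually_mono)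
  then show "((\<lambda>R. sqnorm (\<lambda>x. ft (trunc R f) x - plancherel g x)) \<longlongrightarrow> 0) at_top"
    using plancherel_tendsto[OF g] by simp
qed

text \<open>For integrable \<open>f\<close> the Bessel inequality applies to the remainder
  \<open>f - trunc R f\<close> itself, so the truncated transforms tend to \<open>ft f\<close> in
  L2.\<close>

lemma plancherel_eq_ft:
  assumes f: "square_integrable f" and int: "integrable lborel f"
  shows "AE x in lborel. plancherel f x = ft f x"
proof (rule plancherel_unique[OF f square_integrable_ft[OF f int]])
  show "((\<lambda>R. sqnorm (\<lambda>x. ft (trunc R f) x - ft f x)) \<longlongrightarrow> 0) at_top"
  proof (rule tendsto_0_le_ennreal)
    show "((\<lambda>R. ennreal (2 * pi) * sqnorm (\<lambda>x. f x - trunc R f x)) \<longlongrightarrow> 0) at_top"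
      using ennreal_tendsto_cmult[OF _ sqnorm_minus_trunc_tendsto[OF f], of "ennreal (2 * pi)"] by simp
    show "sqnorm (\<lambda>x. ft (trunc R f) x - ft f x) \<le> ennreal (2 * pi) * sqnorm (\<lambda>x. f x - trunc R f x)" for R
    proof -
      have "(\<lambda>x. ft f x - ft (trunc R f) x) = ft (\<lambda>x. f x - trunc R f x)"
        using ft_diff[OF int integrable_trunc[OF f, of R]] by (auto simp: fun_eq_iff)
      then show ?thesis
        using ft_bessel[OF Bochner_Integration.integrable_diff[OF int integrable_trunc[OF f, of R]]]
        by (subst sqnorm_minus_commute) simp
    qed
  qed
qed

text \<open>The two factors are truncated one after the other, since continuity of the pairing is
  available with one factor held fixed.\<close>

lemma plancherel_multiplication_formula:
  assumes f: "square_integrable f" and g: "square_integrable g"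
  shows "(\<integral>x. plancherel f x * g x \<partial>lborel) = (\<integral>x. f x * plancherel g x \<partial>lborel)"
proof -
  note si = square_integrable_trunc square_integrable_plancherel integrable_trunc square_integrable_ft
  have ft_lim: "(\<lambda>n. sqnorm (\<lambda>x. ft (trunc (real n) h) x - plancherel h x)) \<longlonglongrightarrow> 0" if "square_integrable h" for h
    using filterlim_compose[OF plancherel_tendsto[OF that] filterlim_real_sequentially] .
  have tr_lim: "(\<lambda>n. sqnorm (\<lambda>x. trunc (real n) h x - h x)) \<longlonglongrightarrow> 0" if "square_integrable h" for h
    using sqnorm_minus_trunc_tendsto_nat[OF that] by (subst sqnorm_minus_commute)
  have step: "(\<integral>x. plancherel f x * trunc (real m) g x \<partial>lborel) = (\<integral>x. f x * ft (trunc (real m) g) x \<partial>lborel)" for m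
  proof (rule LIMSEQ_unique)
    show "(\<lambda>n. \<integral>x. ft (trunc (real n) f) x * trunc (real m) g x \<partial>lborel) \<longlonglongrightarrow> (\<integral>x. plancherel f x * trunc (real m) g x \<partial>lborel)"
      by (rule integral_mult_tendsto) (intro si f g ft_lim)+
    have "(\<lambda>n. \<integral>x. trunc (real n) f x * ft (trunc (real m) g) x \<partial>lborel) \<longlonglongrightarrow> (\<integral>x. f x * ft (trunc (real m) g) x \<partial>lborel)"
      by (rule integral_mult_tendsto) (intro si f g tr_lim)+
    then show "(\<lambda>n. \<integral>x. ft (trunc (real n) f) x * trunc (real m) g x \<partial>lborel) \<longlonglongrightarrow> (\<integral>x. f x * ft (trunc (real m) g) x \<partial>lborel)"
      by (simp add: ft_multiplication_formula[OF integrable_trunc[OF f] integrable_trunc[OF g]])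
  qed
  have "(\<lambda>m. \<integral>x. trunc (real m) g x * plancherel f x \<partial>lborel) \<longlonglongrightarrow> (\<integral>x. g x * plancherel f x \<partial>lborel)"
    by (rule integral_mult_tendsto) (intro si f g tr_lim)+
  moreover have "(\<lambda>m. \<integral>x. ft (trunc (real m) g) x * f x \<partial>lborel) \<longlonglongrightarrow> (\<integral>x. plancherel g x * f x \<partial>lborel)"
    by (rule integral_mult_tendsto) (intro si f g ft_lim)+
  ultimately have "(\<integral>x. g x * plancherel f x \<partial>lborel) = (\<integral>x. plancherel g x * f x \<partial>lborel)"
    using step by (intro LIMSEQ_unique[of "\<lambda>m. \<integral>x. trunc (real m) g x * plancherel f x \<partial>lborel"]) (simp_all add: mult.commute)
  then show ?thesis by (simp add: mult.commute)
qed

section \<open>The inversion formula\<close>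

text \<open>The narrowing Gaussians form an approximate identity. The end points are excluded
  because the indicator jumps there.\<close>

lemma integral_indicator_normal_density_tendsto:
  assumes y: "- y \<noteq> a" "- y \<noteq> b"
  shows "(\<lambda>n. \<integral>t. indicator {a..b} t * normal_density 0 (1 / real (Suc n)) (t + y) \<partial>lborel)
    \<longlonglongrightarrow> (indicator {a..b} (- y) :: real)"
proof -
  \<comment> \<open>Rescaling moves \<open>n\<close> from the density into the indicator, so one
    fixed density dominates all integrands.\<close>
  have "(\<integral>t. indicator {a..b} t * normal_density 0 (1 / real (Suc n)) (t + y) \<partial>lborel)
     = (\<integral>z. indicator {a..b} (- y + z / real (Suc n)) * std_normal_density z \<partial>lborel)" for n
  proof -
    have [simp]: "normal_density 0 (1 / real (Suc n)) (z / real (Suc n)) = real (Suc n) * std_normal_density z" for z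
    proof -
      have "real (Suc n) = sqrt ((real (Suc n))\<^sup>2)" by simp
      then show ?thesis
        by (simp add: normal_density_def real_sqrt_divide power_divide del: real_sqrt_abs real_sqrt_power of_nat_Suc)
    qed
    show ?thesis
      by (subst lborel_integral_real_affine[where c="1 / real (Suc n)" and t="- y"])
         (simp_all add: mult.left_commute[of _ "real (Suc n)"] mult.left_commute[of _ "1 + real n"] del: of_nat_Suc)
  qed
  moreover have "(\<lambda>n. \<integral>z. indicator {a..b} (- y + z / real (Suc n)) * std_normal_density z \<partial>lborel)
     \<longlonglongrightarrow> (\<integral>z. indicator {a..b} (- y) * std_normal_density z \<partial>lborel)"
  proof (rule integral_dominated_convergence[where w="std_normal_density"])
    show "AE z in lborel. (\<lambda>n. indicator {a..b} (- y + z / real (Suc n)) * std_normal_density z)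
       \<longlonglongrightarrow> indicator {a..b} (- y) * std_normal_density z"
    proof (rule AE_I2, intro tendsto_mult tendsto_const)
      fix z :: real
      have lim: "(\<lambda>n. - y + z / real (Suc n)) \<longlonglongrightarrow> - y" by real_asymp
      consider "- y < a" | "b < - y" | "a < - y" "- y < b" using y by linarith
      then have "\<forall>\<^sub>F n in sequentially. indicator {a..b} (- y) = (indicator {a..b} (- y + z / real (Suc n)) :: real)"
      proof cases
        case 1
        then show ?thesis
          using order_tendstoD(2)[OF lim, of a] by (auto simp: indicator_def elim: eventually_mono)
      next
        case 2
        then show ?thesis
          using order_tendstoD(1)[OF lim, of b] by (auto simp: indicator_def elim: eventually_mono)
      next
        case 3
        have "\<forall>\<^sub>F n in sequentially. a < - y + z / real (Suc n) \<and> - y + z / real (Suc n) < b"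
          using order_tendstoD(1)[OF lim 3(1)] order_tendstoD(2)[OF lim 3(2)] by (rule eventually_conj)
        then show ?thesis
          using 3 by (auto simp: indicator_def elim: eventually_mono)
      qed
      then show "(\<lambda>n. indicator {a..b} (- y + z / real (Suc n))) \<longlonglongrightarrow> (indicator {a..b} (- y) :: real)"
        by (rule Lim_transform_eventually[OF tendsto_const])
    qed
  qed (auto simp: indicator_def)
  ultimately show ?thesis by simp
qed

text \<open>The transform of an indicator is in general not integrable, so its second transform is
  not a Fourier integral. Gaussian damping makes it integrable; the damped transforms converge in L2
  to the second transform and, by the smoothing formula, pointwise to the reflected indicator off
  the end points.\<close>

lemma plancherel_twice_indicator:
  defines "ind \<equiv> \<lambda>a b :: real. (indicator {a..b} :: real \<Rightarrow> complex)"
  shows "AE y in lborel. plancherel (plancherel (ind a b)) y = complex_of_real (2 * pi) * ind a b (- y)"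
proof -
  let ?X = "ind a b"
  have X: "square_integrable ?X" unfolding ind_def by (rule square_integrable_indicator)
  have Xint: "integrable lborel ?X"
  proof -
    have "(\<lambda>x. ?X x * ?X x) = ?X" by (auto simp: ind_def indicator_def)
    then show ?thesis using integrable_mult_square_integrable[OF X X] by simp
  qed
  have [measurable]: "?X \<in> borel_measurable borel" using X by (simp add: square_integrable_def)
  define u where "u = ft ?X"
  have u: "square_integrable u" unfolding u_def by (rule square_integrable_ft[OF X Xint])
  have [measurable]: "u \<in> borel_measurable borel" using u by (simp add: square_integrable_def)
  have u_bound: "cmod (u x) \<le> (\<integral>t. cmod (?X t) \<partial>lborel)" for x unfolding u_def by (rule ft_bound[OF Xint])
  define v where "v n x = u x * of_real (gauss (real (Suc n)) x)" for n x
  have [measurable]: "v n \<in> borel_measurable borel" for n unfolding v_def[abs_def] by measurable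
  have v_le: "cmod (v n x) \<le> cmod (u x)" for n x
    using gauss_pos[of "real (Suc n)" x] gauss_le_1[of "real (Suc n)" x]
    by (simp add: v_def norm_mult mult_left_le less_imp_le)
  have v: "square_integrable (v n)" for n by (rule square_integrable_bound[OF u _ v_le]) simp
  have vint: "integrable lborel (v n)" for n
  proof (rule Bochner_Integration.integrable_bound)
    show "integrable lborel (\<lambda>x. (\<integral>t. cmod (?X t) \<partial>lborel) * gauss (real (Suc n)) x)"
      by (intro integrable_mult_right integrable_gauss) simp
    show "AE x in lborel. norm (v n x) \<le> norm ((\<integral>t. cmod (?X t) \<partial>lborel) * gauss (real (Suc n)) x)"
      using u_bound gauss_pos[of "real (Suc n)"]
      by (auto simp: v_def norm_mult abs_mult less_imp_le intro!: mult_right_mono)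
  qed simp
  have v_tendsto: "(\<lambda>n. sqnorm (\<lambda>x. v n x - u x)) \<longlonglongrightarrow> 0"
  proof (rule sqnorm_dominated[OF _ square_integrable_cmult[OF u, of 2]])
    show "cmod (v n x - u x) \<le> cmod (2 * u x)" for n x
      using norm_triangle_ineq4[of "v n x" "u x"] v_le[of n x] by (simp add: norm_mult)
    show "AE x in lborel. (\<lambda>n. v n x - u x) \<longlonglongrightarrow> 0"
    proof (rule AE_I2)
      fix x
      have "(\<lambda>n. gauss (real (Suc n)) x) \<longlonglongrightarrow> 1" unfolding gauss_def by real_asymp
      then have "(\<lambda>n. u x * of_real (gauss (real (Suc n)) x) - u x) \<longlonglongrightarrow> u x * of_real 1 - u x"
        by (intro tendsto_intros)
      then show "(\<lambda>n. v n x - u x) \<longlonglongrightarrow> 0" by (simp add: v_def)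
    qed
  qed simp
  have Pu: "square_integrable (plancherel u)" by (rule square_integrable_plancherel[OF u])
  have [measurable]: "plancherel u \<in> borel_measurable borel" using Pu by (simp add: square_integrable_def)
  have "AE y in lborel. plancherel u y = complex_of_real (2 * pi) * ?X (- y)"
  proof (rule sqnorm_limit_AE_unique[where u="\<lambda>n. ft (v n)"])
    show "(\<lambda>n. sqnorm (\<lambda>x. ft (v n) x - plancherel u x)) \<longlonglongrightarrow> 0"
    proof (rule tendsto_0_le_ennreal)
      show "(\<lambda>n. ennreal (8 * pi) * sqnorm (\<lambda>x. v n x - u x)) \<longlonglongrightarrow> 0"
        using ennreal_tendsto_cmult[OF _ v_tendsto, of "ennreal (8 * pi)"] by simp
      fix n
      have "sqnorm (\<lambda>x. ft (v n) x - plancherel u x) = sqnorm (plancherel (\<lambda>x. v n x - u x))"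
      proof (rule sqnorm_cong_AE)
        show "AE x in lborel. ft (v n) x - plancherel u x = plancherel (\<lambda>x. v n x - u x) x"
          using plancherel_diff[OF v u, of n] plancherel_eq_ft[OF v vint, of n] by eventually_elim simp
      qed
      also have "\<dots> \<le> ennreal (8 * pi) * sqnorm (\<lambda>x. v n x - u x)"
        by (rule sqnorm_plancherel_le[OF square_integrable_diff[OF v u]])
      finally show "sqnorm (\<lambda>x. ft (v n) x - plancherel u x) \<le> \<dots>" .
    qed
    have "AE y in lborel. y \<noteq> - a \<and> y \<noteq> - b" using AE_lborel_singleton[of "-a"] AE_lborel_singleton[of "-b"] by eventually_elim simp
    then show "AE y in lborel. (\<lambda>n. ft (v n) y) \<longlonglongrightarrow> complex_of_real (2 * pi) * ?X (- y)"
    proof eventually_elim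
      case (elim y)
      have "ft (v n) y = complex_of_real (2 * pi) * of_real (\<integral>t. indicator {a..b} t * normal_density 0 (1 / real (Suc n)) (t + y) \<partial>lborel)" for n
      proof -
        have "ft (v n) y = (\<integral>x. ft ?X x * (of_real (gauss (real (Suc n)) x) * exp (\<i> * of_real x * of_real y)) \<partial>lborel)"
          unfolding ft_def[of "v n"] v_def u_def by (simp add: mult.assoc)
        also have "\<dots> = complex_of_real (2 * pi) * (\<integral>t. ?X t * complex_of_real (normal_density 0 (1 / real (Suc n)) (t + y)) \<partial>lborel)"
          by (rule ft_gauss_smoothing[OF Xint]) simp
        also have "(\<integral>t. ?X t * complex_of_real (normal_density 0 (1 / real (Suc n)) (t + y)) \<partial>lborel)
           = (\<integral>t. complex_of_real (indicator {a..b} t * normal_density 0 (1 / real (Suc n)) (t + y)) \<partial>lborel)"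
          by (intro Bochner_Integration.integral_cong) (auto simp: ind_def indicator_def)
        also have "\<dots> = of_real (\<integral>t. indicator {a..b} t * normal_density 0 (1 / real (Suc n)) (t + y) \<partial>lborel)"
          by (rule integral_complex_of_real)
        finally show ?thesis .
      qed
      moreover have "(\<lambda>n. complex_of_real (2 * pi) * of_real (\<integral>t. indicator {a..b} t * normal_density 0 (1 / real (Suc n)) (t + y) \<partial>lborel))
         \<longlonglongrightarrow> complex_of_real (2 * pi) * of_real (indicator {a..b} (- y))"
        using elim by (intro tendsto_intros integral_indicator_normal_density_tendsto) auto
      moreover have "complex_of_real (indicator {a..b} (- y)) = ?X (- y)"
        by (simp add: ind_def indicator_def)
      ultimately show ?case by (simp only:)
    qed
  qed (auto intro: ft_measurable)
  moreover have "AE y in lborel. plancherel (plancherel ?X) y = plancherel u y"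
    unfolding u_def by (intro plancherel_cong_AE square_integrable_plancherel X plancherel_eq_ft Xint)
      (use u in \<open>simp add: u_def\<close>)
  ultimately show ?thesis by eventually_elim simp
qed

text \<open>By the multiplication formula the difference of the two sides integrates to \<open>0\<close> against
  every interval, which reduces the claim to indicators.\<close>

theorem plancherel_inversion:
  assumes f: "square_integrable f"
  shows "AE x in lborel. plancherel (plancherel f) x = complex_of_real (2 * pi) * f (- x)"
proof -
  note Pf = square_integrable_plancherel[OF f]
  note PPf = square_integrable_plancherel[OF Pf]
  note Rf = square_integrable_cmult[OF square_integrable_reflect[OF f], of "complex_of_real (2 * pi)"]
  have "AE x in lborel. plancherel (plancherel f) x - complex_of_real (2 * pi) * f (- x) = 0"
  proof (rule AE_eq_0_if_interval_integrals_0[OF square_integrable_diff[OF PPf Rf]])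
    fix a b :: real
    let ?X = "indicator {a..b} :: real \<Rightarrow> complex"
    note X = square_integrable_indicator[of a b]
    note PX = square_integrable_plancherel[OF X]
    have [measurable]: "f \<in> borel_measurable borel" "plancherel (plancherel ?X) \<in> borel_measurable borel"
      using f square_integrable_plancherel[OF PX] by (simp_all add: square_integrable_def)
    have "(\<integral>x. plancherel (plancherel f) x * ?X x \<partial>lborel) = (\<integral>x. plancherel f x * plancherel ?X x \<partial>lborel)"
      by (rule plancherel_multiplication_formula[OF Pf X])
    also have "\<dots> = (\<integral>x. f x * plancherel (plancherel ?X) x \<partial>lborel)"
      by (rule plancherel_multiplication_formula[OF f PX])
    also have "\<dots> = (\<integral>x. f x * (complex_of_real (2 * pi) * ?X (- x)) \<partial>lborel)"
      using plancherel_twice_indicator[of a b] by (intro integral_cong_AE) (auto elim!: eventually_mono)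
    also have "\<dots> = (\<integral>x. complex_of_real (2 * pi) * f (- x) * ?X x \<partial>lborel)"
      by (subst lborel_integral_real_affine[where c="-1" and t=0]) (simp_all add: mult_ac)
    finally have *: "(\<integral>x. plancherel (plancherel f) x * ?X x \<partial>lborel) = (\<integral>x. complex_of_real (2 * pi) * f (- x) * ?X x \<partial>lborel)" .
    have "(\<integral>x. (plancherel (plancherel f) x - complex_of_real (2 * pi) * f (- x)) * ?X x \<partial>lborel)
       = (\<integral>x. plancherel (plancherel f) x * ?X x \<partial>lborel) - (\<integral>x. complex_of_real (2 * pi) * f (- x) * ?X x \<partial>lborel)"
      unfolding left_diff_distrib
      by (rule Bochner_Integration.integral_diff) (intro integrable_mult_square_integrable PPf Rf X)+
    also have "\<dots> = 0" using * by simp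
    finally show "(\<integral>x. (plancherel (plancherel f) x - complex_of_real (2 * pi) * f (- x)) * ?X x \<partial>lborel) = 0" .
  qed
  then show ?thesis by eventually_elim simp
qed

text \<open>Multiplication commutes with truncation, so the shift is visible on each Fourier
  integral and passes to the limit by translation invariance of \<open>sqnorm\<close>.\<close>

lemma plancherel_modulation:
  assumes f: "square_integrable f"
  shows "AE x in lborel. plancherel (\<lambda>t. exp (\<i> * of_real t * of_real a) * f t) x = plancherel f (x + a)"
proof (rule plancherel_unique)
  have [measurable]: "f \<in> borel_measurable borel" "plancherel f \<in> borel_measurable borel"
    using f square_integrable_plancherel[OF f] by (simp_all add: square_integrable_def)
  show "square_integrable (\<lambda>t. exp (\<i> * of_real t * of_real a) * f t)"
    by (rule square_integrable_bound[OF f]) (auto simp: norm_mult)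
  show "square_integrable (\<lambda>x. plancherel f (x + a))"
    by (intro square_integrable_translate square_integrable_plancherel f)
  have "ft (trunc R (\<lambda>t. exp (\<i> * of_real t * of_real a) * f t)) x = ft (trunc R f) (x + a)" for R x
    unfolding ft_def trunc_def
    by (intro Bochner_Integration.integral_cong) (simp_all add: exp_add distrib_left mult_ac)
  then have "sqnorm (\<lambda>x. ft (trunc R (\<lambda>t. exp (\<i> * of_real t * of_real a) * f t)) x - plancherel f (x + a))
     = sqnorm (\<lambda>x. ft (trunc R f) x - plancherel f x)" for R
    using sqnorm_translate[of "\<lambda>x. ft (trunc R f) x - plancherel f x" a] by simp
  then show "((\<lambda>R. sqnorm (\<lambda>x. ft (trunc R (\<lambda>t. exp (\<i> * of_real t * of_real a) * f t)) x - plancherel f (x + a))) \<longlongrightarrow> 0) at_top"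
    using plancherel_tendsto[OF f] by simp
qed

text \<open>The two reflections cancel. Hence a multiple of the third power of the transform inverts
  it on both sides; bijectivity on L2 and boundedness of the inverse both come from this
  identity.\<close>

lemma plancherel_four_times:
  assumes f: "square_integrable f"
  shows "AE x in lborel. plancherel (plancherel (plancherel (plancherel f))) x = complex_of_real (4 * pi\<^sup>2) * f x"
proof -
  have PPf: "square_integrable (plancherel (plancherel f))"
    by (intro square_integrable_plancherel f)
  have [measurable]: "f \<in> borel_measurable borel" "plancherel (plancherel f) \<in> borel_measurable borel"
    using f PPf by (simp_all add: square_integrable_def)
  \<comment> \<open>The exceptional null set of the inversion formula must be reflected as
    well.\<close>
  have "AE x in lborel. plancherel (plancherel f) (0 + - 1 * x) = complex_of_real (2 * pi) * f (- (0 + - 1 * x))"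
    by (rule AE_borel_affine[OF _ _ plancherel_inversion[OF f]]) auto
  with plancherel_inversion[OF PPf] show ?thesis
    by eventually_elim (simp add: power2_eq_square)
qed

section \<open>Transfer to classes modulo a.e. equality\<close>

text \<open>A Borel representative, because Fubini's theorem and affine substitutions are available for
  \<^const>\<open>lborel\<close> rather than for \<^const>\<open>lebesgue\<close>.\<close>

definition brep :: "L0 \<Rightarrow> real \<Rightarrow> complex" where
  "brep f = (SOME g. g \<in> borel_measurable borel \<and> abs_L0 g = f)"

lemma lebesgue_measurable_if_borel [intro]:
  "f \<in> borel_measurable borel \<Longrightarrow> f \<in> borel_measurable lebesgue"
  by (rule measurable_completion) simp

lemma abs_L0_eq_iff:
  assumes "f \<in> borel_measurable lebesgue" "g \<in> borel_measurable lebesgue"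
  shows "abs_L0 f = abs_L0 g \<longleftrightarrow> (AE x in lborel. f x = g x)"
  using Quotient3_rel[OF Quotient3_L0, of f g] assms by (simp add: AE_completion_iff)

text \<open>Real and imaginary part are replaced separately by Borel functions and then
  glued.\<close>

lemma borel_representative_exists: "\<exists>g. g \<in> borel_measurable borel \<and> abs_L0 g = f"
proof -
  have "(\<lambda>x. Re (rep_L0 f x)) \<in> borel_measurable (completion lborel)"
    "(\<lambda>x. Im (rep_L0 f x)) \<in> borel_measurable (completion lborel)" by measurable
  from this[THEN completion_ex_borel_measurable_real] obtain u v where
    uv: "u \<in> borel_measurable lborel" "AE x in lborel. Re (rep_L0 f x) = u x"
    "v \<in> borel_measurable lborel" "AE x in lborel. Im (rep_L0 f x) = v x"
    by blast
  then have [measurable]: "u \<in> borel_measurable borel" "v \<in> borel_measurable borel" by simp_all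
  have m: "(\<lambda>x. Complex (u x) (v x)) \<in> borel_measurable borel"
    unfolding Complex_eq by measurable
  have "AE x in lborel. Complex (u x) (v x) = rep_L0 f x"
    using uv(2,4) by eventually_elim (simp add: complex_eq_iff)
  then have "abs_L0 (\<lambda>x. Complex (u x) (v x)) = abs_L0 (rep_L0 f)"
    by (subst abs_L0_eq_iff) (use m in auto)
  with m show ?thesis by (auto simp: abs_rep_L0)
qed

lemma brep_measurable [measurable]: "brep f \<in> borel_measurable borel"
  and abs_brep [simp]: "abs_L0 (brep f) = f"
  using someI_ex[OF borel_representative_exists[of f]] by (auto simp: brep_def)

lemma brep_measurable_lebesgue [measurable, simp]: "brep f \<in> borel_measurable lebesgue"
  by (rule lebesgue_measurable_if_borel) measurable

lemma AE_brep_abs: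
  assumes "f \<in> borel_measurable lebesgue"
  shows "AE x in lborel. brep (abs_L0 f) x = f x"
  using abs_L0_eq_iff[of "brep (abs_L0 f)" f] assms by auto

lemma AE_rep_brep: "AE x in lborel. rep_L0 f x = brep f x"
  using abs_L0_eq_iff[of "rep_L0 f" "brep f"] by (auto simp: abs_rep_L0)

lemma L0_eq_iff: "f = g \<longleftrightarrow> (AE x in lborel. brep f x = brep g x)"
  using abs_L0_eq_iff[of "brep f" "brep g"] by auto

text \<open>Representatives are chosen class by class, so the ring operations reach them only almost
  everywhere. Later proofs collect such facts and finish pointwise.\<close>

lemma brep_plus: "AE x in lborel. brep (f + g) x = brep f x + brep g x"
  and brep_minus: "AE x in lborel. brep (f - g) x = brep f x - brep g x"
  and brep_times: "AE x in lborel. brep (f * g) x = brep f x * brep g x"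
  and brep_uminus: "AE x in lborel. brep (- f) x = - brep f x"
proof -
  have [measurable]: "brep f \<in> borel_measurable lebesgue" "brep g \<in> borel_measurable lebesgue" by auto
  show "AE x in lborel. brep (f + g) x = brep f x + brep g x"
    using AE_brep_abs[of "\<lambda>x. brep f x + brep g x"] plus_L0.abs_eq[of "brep f" "brep g"] by auto
  show "AE x in lborel. brep (f - g) x = brep f x - brep g x"
    using AE_brep_abs[of "\<lambda>x. brep f x - brep g x"] minus_L0.abs_eq[of "brep f" "brep g"] by auto
  show "AE x in lborel. brep (f * g) x = brep f x * brep g x"
    using AE_brep_abs[of "\<lambda>x. brep f x * brep g x"] times_L0.abs_eq[of "brep f" "brep g"] by auto
  show "AE x in lborel. brep (- f) x = - brep f x"
    using AE_brep_abs[of "\<lambda>x. - brep f x"] uminus_L0.abs_eq[of "brep f"] by auto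
qed

lemma brep_const: "AE x in lborel. brep (const_L0 c) x = c"
  using AE_brep_abs[of "\<lambda>_. c"] const_L0.abs_eq[of c] by auto

lemma brep_0: "AE x in lborel. brep 0 x = 0"
  using AE_brep_abs[of "\<lambda>_. 0"] by (auto simp: zero_L0_def)

lemma const_L0_hom:
  "const_L0 (a + b) = const_L0 a + const_L0 b"
  "const_L0 (a - b) = const_L0 a - const_L0 b"
  "const_L0 (a * b) = const_L0 a * const_L0 b"
  "const_L0 0 = 0" "const_L0 1 = 1"
  "const_L0 (- a) = - const_L0 a"
  by (transfer, simp)+

lemma const_L0_of_nat: "const_L0 (of_nat n) = of_nat n"
  by (induction n) (simp_all add: const_L0_hom)

lemma const_L0_mult_brep: "AE x in lborel. brep (const_L0 c * f) x = c * brep f x"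
  using brep_times[of "const_L0 c" f] brep_const[of c] by eventually_elim simp

section \<open>Classes in L2 and in Linf\<close>

lemma L2_iff: "f \<in> L2 \<longleftrightarrow> square_integrable (brep f)"
proof -
  have "(\<integral>\<^sup>+x. ennreal ((cmod (rep_L0 f x))\<^sup>2) \<partial>lebesgue) = sqnorm (brep f)"
    unfolding nn_integral_completion sqnorm_def
    using AE_rep_brep[of f] by (intro nn_integral_cong_AE) (auto elim!: eventually_mono)
  then show ?thesis by (simp add: L2_def square_integrable_def)
qed

lemma square_integrable_cong_AE:
  "f \<in> borel_measurable borel \<Longrightarrow> g \<in> borel_measurable borel \<Longrightarrow> AE x in lborel. f x = g x \<Longrightarrow>
   square_integrable f \<longleftrightarrow> square_integrable g"
  using sqnorm_cong_AE[of f g] by (auto simp: square_integrable_def)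

lemma abs_L0_L2_iff:
  assumes "g \<in> borel_measurable borel"
  shows "abs_L0 g \<in> L2 \<longleftrightarrow> square_integrable g"
  unfolding L2_iff using assms AE_brep_abs[of g] by (intro square_integrable_cong_AE) auto

lemma L2_add: "f \<in> L2 \<Longrightarrow> g \<in> L2 \<Longrightarrow> f + g \<in> L2"
proof -
  assume fg: "f \<in> L2" "g \<in> L2"
  have "square_integrable (brep (f + g)) \<longleftrightarrow> square_integrable (\<lambda>x. brep f x + brep g x)"
    by (intro square_integrable_cong_AE brep_plus) measurable
  with fg show ?thesis by (simp add: L2_iff square_integrable_add)
qed

lemma L2_const_mult: "f \<in> L2 \<Longrightarrow> const_L0 c * f \<in> L2"
proof -
  assume f: "f \<in> L2"
  have "square_integrable (brep (const_L0 c * f)) \<longleftrightarrow> square_integrable (\<lambda>x. c * brep f x)"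
    by (intro square_integrable_cong_AE const_L0_mult_brep) measurable
  with f show ?thesis by (simp add: L2_iff square_integrable_cmult)
qed

lemma Linf_iff: "a \<in> Linf \<longleftrightarrow> (\<exists>M::real. AE x in lborel. cmod (brep a x) \<le> M)"
proof
  assume "a \<in> Linf"
  then obtain M where M: "0 \<le> M" "Linf_norm a = ennreal M" by (cases "Linf_norm a") (auto simp: Linf_def)
  have "AE x in lborel. ennreal (cmod (rep_L0 a x)) \<le> ennreal M"
    using esssup_AE[where M=lebesgue and f="\<lambda>x. ennreal (cmod (rep_L0 a x))"] M by (simp add: Linf_norm_def AE_completion_iff)
  with AE_rep_brep[of a] have "AE x in lborel. cmod (brep a x) \<le> M"
    by eventually_elim (use M in \<open>auto simp: ennreal_le_iff\<close>)
  then show "\<exists>M::real. AE x in lborel. cmod (brep a x) \<le> M" ..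
next
  assume "\<exists>M::real. AE x in lborel. cmod (brep a x) \<le> M"
  then obtain M where "AE x in lborel. cmod (brep a x) \<le> M" ..
  with AE_rep_brep[of a] have "AE x in lborel. ennreal (cmod (rep_L0 a x)) \<le> ennreal M"
    by eventually_elim (auto intro: ennreal_leI)
  then have "Linf_norm a \<le> ennreal M"
    unfolding Linf_norm_def by (intro esssup_I) (auto simp: AE_completion_iff)
  then show "a \<in> Linf" by (auto simp: Linf_def intro: le_less_trans)
qed

lemma Linf_add: "a \<in> Linf \<Longrightarrow> b \<in> Linf \<Longrightarrow> a + b \<in> Linf"
proof -
  assume "a \<in> Linf" "b \<in> Linf"
  then obtain M N where MN: "AE x in lborel. cmod (brep a x) \<le> M" "AE x in lborel. cmod (brep b x) \<le> N"
    by (auto simp: Linf_iff)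
  have "AE x in lborel. cmod (brep (a + b) x) \<le> M + N"
    using brep_plus[of a b] MN by eventually_elim (auto intro: norm_triangle_mono)
  then show "a + b \<in> Linf" by (auto simp: Linf_iff)
qed

lemma Linf_mult: "a \<in> Linf \<Longrightarrow> b \<in> Linf \<Longrightarrow> a * b \<in> Linf"
proof -
  assume "a \<in> Linf" "b \<in> Linf"
  then obtain M N where MN: "AE x in lborel. cmod (brep a x) \<le> M" "AE x in lborel. cmod (brep b x) \<le> N"
    by (auto simp: Linf_iff)
  have "AE x in lborel. cmod (brep (a * b) x) \<le> M * N"
    using brep_times[of a b] MN
    by eventually_elim (auto simp: norm_mult intro!: mult_mono intro: order_trans[OF norm_ge_zero])
  then show "a * b \<in> Linf" by (auto simp: Linf_iff)
qed

lemma const_L0_Linf: "const_L0 c \<in> Linf"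
  unfolding Linf_iff by (rule exI[of _ "cmod c"]) (use brep_const[of c] in \<open>auto elim: eventually_mono\<close>)

lemma Linf_mult_L2:
  assumes "a \<in> Linf" "f \<in> L2" shows "a * f \<in> L2"
proof -
  obtain M where M: "AE x in lborel. cmod (brep a x) \<le> M" using assms by (auto simp: Linf_iff)
  have f: "square_integrable (brep f)" using assms by (simp add: L2_iff)
  have "sqnorm (brep (a * f)) \<le> sqnorm (\<lambda>x. of_real M * brep f x)"
    unfolding sqnorm_def
  proof (rule nn_integral_mono_AE)
    show "AE x in lborel. ennreal ((cmod (brep (a * f) x))\<^sup>2) \<le> ennreal ((cmod (of_real M * brep f x))\<^sup>2)"
      using M brep_times[of a f]
      by eventually_elim (auto simp: norm_mult intro!: ennreal_leI power_mono mult_right_mono)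
  qed
  also have "\<dots> < \<infinity>" using square_integrable_cmult[OF f] by (simp add: square_integrable_def)
  finally show ?thesis by (simp add: L2_iff square_integrable_def)
qed

section \<open>The Fourier transform on classes and its inverse\<close>

lemma fourier_truncated_eq:
  assumes f: "f \<in> L2"
  shows "fourier_truncated R f x = ft (trunc R (brep f)) x"
proof -
  have "fourier_truncated R f x = (\<integral>t. indicator {-R..R} t *\<^sub>R (brep f t * exp (\<i> * of_real t * of_real x)) \<partial>lebesgue)"
    unfolding fourier_truncated_def set_lebesgue_integral_def
  proof (rule integral_cong_AE)
    have [measurable]: "brep f \<in> borel_measurable lebesgue" by auto
    have [measurable]: "(\<lambda>t. exp (\<i> * complex_of_real t * complex_of_real x)) \<in> borel_measurable lebesgue"
      by (rule lebesgue_measurable_if_borel) measurable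
    have [measurable]: "{-R..R} \<in> sets lebesgue" by simp
    show "(\<lambda>t. indicat_real {-R..R} t *\<^sub>R (rep_L0 f t * exp (\<i> * of_real t * of_real x))) \<in> borel_measurable lebesgue"
      "(\<lambda>t. indicat_real {-R..R} t *\<^sub>R (brep f t * exp (\<i> * of_real t * of_real x))) \<in> borel_measurable lebesgue"
      by measurable
    show "AE t in lebesgue. indicat_real {-R..R} t *\<^sub>R (rep_L0 f t * exp (\<i> * of_real t * of_real x)) =
        indicat_real {-R..R} t *\<^sub>R (brep f t * exp (\<i> * of_real t * of_real x))"
      unfolding AE_completion_iff using AE_rep_brep[of f] by eventually_elim simp
  qed
  also have "\<dots> = (\<integral>t. indicator {-R..R} t *\<^sub>R (brep f t * exp (\<i> * of_real t * of_real x)) \<partial>lborel)"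
    by (rule integral_completion) measurable
  also have "\<dots> = ft (trunc R (brep f)) x"
    unfolding ft_def trunc_def
    by (intro Bochner_Integration.integral_cong) (auto simp: indicator_def)
  finally show ?thesis .
qed

text \<open>Limits in L2 are unique up to null sets, which is equality in \<open>L0\<close>;
  therefore the definite description in \<open>fourier\<close> denotes.\<close>

lemma fourier_eq:
  assumes f: "f \<in> L2"
  shows "fourier f = abs_L0 (plancherel (brep f))"
proof -
  have si: "square_integrable (brep f)" using f by (simp add: L2_iff)
  note P = square_integrable_plancherel[OF si]
  have Pm [measurable]: "plancherel (brep f) \<in> borel_measurable borel" using P by (simp add: square_integrable_def)
  have eq: "(\<integral>\<^sup>+x. ennreal ((cmod (fourier_truncated R f x - rep_L0 g x))\<^sup>2) \<partial>lebesgue)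
      = sqnorm (\<lambda>x. ft (trunc R (brep f)) x - brep g x)" for R g
    unfolding nn_integral_completion sqnorm_def fourier_truncated_eq[OF f]
    using AE_rep_brep[of g] by (intro nn_integral_cong_AE) (auto elim!: eventually_mono)
  show ?thesis
    unfolding fourier_def eq
  proof (rule the_equality)
    have "sqnorm (\<lambda>x. ft (trunc R (brep f)) x - brep (abs_L0 (plancherel (brep f))) x)
       = sqnorm (\<lambda>x. ft (trunc R (brep f)) x - plancherel (brep f) x)" for R
      using AE_brep_abs[OF lebesgue_measurable_if_borel[OF Pm]] by (intro sqnorm_cong_AE) (auto elim: eventually_mono)
    then show "abs_L0 (plancherel (brep f)) \<in> L2 \<and>
       ((\<lambda>R. sqnorm (\<lambda>x. ft (trunc R (brep f)) x - brep (abs_L0 (plancherel (brep f))) x)) \<longlongrightarrow> 0) at_top"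
      using plancherel_tendsto[OF si] P by (simp add: abs_L0_L2_iff)
    fix g assume g: "g \<in> L2 \<and> ((\<lambda>R. sqnorm (\<lambda>x. ft (trunc R (brep f)) x - brep g x)) \<longlongrightarrow> 0) at_top"
    then have "AE x in lborel. plancherel (brep f) x = brep g x"
      by (intro plancherel_unique si) (auto simp: L2_iff)
    then have "abs_L0 (plancherel (brep f)) = abs_L0 (brep g)"
      by (subst abs_L0_eq_iff) auto
    then show "g = abs_L0 (plancherel (brep f))" by simp
  qed
qed

lemma fourier_L2:
  assumes "f \<in> L2" shows "fourier f \<in> L2"
  unfolding fourier_eq[OF assms]
  using square_integrable_plancherel[of "brep f"] assms
  by (subst abs_L0_L2_iff) (auto simp: L2_iff square_integrable_def)

lemma brep_fourier:
  assumes f: "f \<in> L2"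
  shows "AE x in lborel. brep (fourier f) x = plancherel (brep f) x"
  unfolding fourier_eq[OF f]
  using square_integrable_plancherel[of "brep f"] f
  by (intro AE_brep_abs lebesgue_measurable_if_borel) (simp add: L2_iff square_integrable_def)

lemma fourier_add:
  assumes f: "f \<in> L2" and g: "g \<in> L2"
  shows "fourier (f + g) = fourier f + fourier g"
proof -
  have si: "square_integrable (brep f)" "square_integrable (brep g)" "square_integrable (brep (f + g))"
    using f g L2_add[OF f g] by (auto simp: L2_iff)
  have "AE x in lborel. brep (fourier (f + g)) x = brep (fourier f + fourier g) x"
    using brep_fourier[OF f] brep_fourier[OF g] brep_fourier[OF L2_add[OF f g]]
      plancherel_cong_AE[OF si(3) square_integrable_add[OF si(1,2)] brep_plus] plancherel_add[OF si(1,2)]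
      brep_plus[of "fourier f" "fourier g"]
    by eventually_elim simp
  then show ?thesis unfolding L0_eq_iff .
qed

lemma fourier_const_mult:
  assumes f: "f \<in> L2"
  shows "fourier (const_L0 c * f) = const_L0 c * fourier f"
proof -
  have si: "square_integrable (brep f)" "square_integrable (brep (const_L0 c * f))"
    using f L2_const_mult[OF f] by (auto simp: L2_iff)
  have "AE x in lborel. brep (fourier (const_L0 c * f)) x = brep (const_L0 c * fourier f) x"
    using brep_fourier[OF f] brep_fourier[OF L2_const_mult[OF f, of c]]
      plancherel_cong_AE[OF si(2) square_integrable_cmult[OF si(1)] const_L0_mult_brep] plancherel_cmult[OF si(1), of c]
      const_L0_mult_brep[of c "fourier f"]
    by eventually_elim simp
  then show ?thesis unfolding L0_eq_iff .
qed

lemma sqnorm_fourier_le: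
  assumes f: "f \<in> L2"
  shows "sqnorm (brep (fourier f)) \<le> ennreal (8 * pi) * sqnorm (brep f)"
  using sqnorm_plancherel_le[of "brep f"] sqnorm_cong_AE[OF brep_fourier[OF f]] f by (simp add: L2_iff)

lemma fourier_four_times:
  assumes f: "f \<in> L2"
  shows "fourier (fourier (fourier (fourier f))) = const_L0 (of_real (4 * pi\<^sup>2)) * f"
proof -
  have si: "square_integrable (brep f)" using f by (simp add: L2_iff)
  let ?P = plancherel
  note P = square_integrable_plancherel
  have 2: "AE x in lborel. brep (fourier (fourier f)) x = ?P (?P (brep f)) x"
    using brep_fourier[OF fourier_L2[OF f]] plancherel_cong_AE[OF _ P[OF si] brep_fourier[OF f]] fourier_L2[OF f]
    by (auto simp: L2_iff elim: eventually_elim2)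
  have 3: "AE x in lborel. brep (fourier (fourier (fourier f))) x = ?P (?P (?P (brep f))) x"
    using brep_fourier[OF fourier_L2[OF fourier_L2[OF f]]] plancherel_cong_AE[OF _ P[OF P[OF si]] 2] fourier_L2[OF fourier_L2[OF f]]
    by (auto simp: L2_iff elim: eventually_elim2)
  have 4: "AE x in lborel. brep (fourier (fourier (fourier (fourier f)))) x = ?P (?P (?P (?P (brep f)))) x"
    using brep_fourier[OF fourier_L2[OF fourier_L2[OF fourier_L2[OF f]]]] plancherel_cong_AE[OF _ P[OF P[OF P[OF si]]] 3]
      fourier_L2[OF fourier_L2[OF fourier_L2[OF f]]]
    by (auto simp: L2_iff elim: eventually_elim2)
  have "AE x in lborel. brep (fourier (fourier (fourier (fourier f)))) x = brep (const_L0 (of_real (4 * pi\<^sup>2)) * f) x"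
    using 4 plancherel_four_times[OF si] const_L0_mult_brep[of "of_real (4 * pi\<^sup>2)" f]
    by eventually_elim simp
  then show ?thesis unfolding L0_eq_iff .
qed

lemma const_L0_inverse_mult: "c \<noteq> 0 \<Longrightarrow> const_L0 (inverse c) * (const_L0 c * f) = f"
  by (simp add: mult.assoc[symmetric] const_L0_hom(3)[symmetric] const_L0_hom(5))

lemma inj_on_fourier: "inj_on fourier L2"
proof (rule inj_onI)
  fix f g assume fg: "f \<in> L2" "g \<in> L2" and "fourier f = fourier g"
  then have "const_L0 (of_real (4 * pi\<^sup>2)) * f = const_L0 (of_real (4 * pi\<^sup>2)) * g"
    using fourier_four_times[OF fg(1)] fourier_four_times[OF fg(2)] by simp
  then have "const_L0 (inverse (of_real (4 * pi\<^sup>2))) * (const_L0 (of_real (4 * pi\<^sup>2)) * f)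
     = const_L0 (inverse (of_real (4 * pi\<^sup>2))) * (const_L0 (of_real (4 * pi\<^sup>2)) * g)" by simp
  then show "f = g" by (subst (asm) (1 2) const_L0_inverse_mult) auto
qed

lemma inverse_fourier_fourier: "f \<in> L2 \<Longrightarrow> inverse_fourier (fourier f) = f"
  unfolding inverse_fourier_def by (rule inv_into_f_f[OF inj_on_fourier])

text \<open>Replaces the inverse function, a choice, by an explicit expression on L2, from which
  linearity and boundedness can be read off.\<close>

lemma inverse_fourier_eq:
  assumes g: "g \<in> L2"
  shows "inverse_fourier g = const_L0 (inverse (of_real (4 * pi\<^sup>2))) * fourier (fourier (fourier g))"
proof -
  let ?h = "const_L0 (inverse (of_real (4 * pi\<^sup>2))) * fourier (fourier (fourier g))"
  have h: "?h \<in> L2" by (intro L2_const_mult fourier_L2 g)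
  have "fourier ?h = const_L0 (inverse (of_real (4 * pi\<^sup>2))) * (const_L0 (of_real (4 * pi\<^sup>2)) * g)"
    by (simp only: fourier_const_mult fourier_L2 g fourier_four_times)
  also have "\<dots> = g" by (rule const_L0_inverse_mult) simp
  finally show ?thesis using inverse_fourier_fourier[OF h] by simp
qed

lemma inverse_fourier_L2: "g \<in> L2 \<Longrightarrow> inverse_fourier g \<in> L2"
  by (simp add: inverse_fourier_eq L2_const_mult fourier_L2 del: of_real_mult of_real_power)

lemma fourier_inverse_fourier:
  assumes g: "g \<in> L2" shows "fourier (inverse_fourier g) = g"
proof -
  have "fourier (inverse_fourier g) = const_L0 (inverse (of_real (4 * pi\<^sup>2))) * (const_L0 (of_real (4 * pi\<^sup>2)) * g)"
    by (simp only: inverse_fourier_eq fourier_const_mult fourier_L2 g fourier_four_times)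
  also have "\<dots> = g" by (rule const_L0_inverse_mult) simp
  finally show ?thesis .
qed

lemma inverse_fourier_add:
  assumes "f \<in> L2" "g \<in> L2"
  shows "inverse_fourier (f + g) = inverse_fourier f + inverse_fourier g"
  using inverse_fourier_fourier[OF L2_add[OF inverse_fourier_L2[OF assms(1)] inverse_fourier_L2[OF assms(2)]]]
  by (simp add: fourier_add inverse_fourier_L2 fourier_inverse_fourier assms)

lemma inverse_fourier_const_mult:
  assumes "f \<in> L2"
  shows "inverse_fourier (const_L0 c * f) = const_L0 c * inverse_fourier f"
  using inverse_fourier_fourier[OF L2_const_mult[OF inverse_fourier_L2[OF assms], of c]]
  by (simp add: fourier_const_mult inverse_fourier_L2 fourier_inverse_fourier assms)

lemma sqnorm_inverse_fourier_le:
  "\<exists>C::real. \<forall>g\<in>L2. sqnorm (brep (inverse_fourier g)) \<le> ennreal C * sqnorm (brep g)"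
proof (intro exI ballI)
  let ?c = "inverse (complex_of_real (4 * pi\<^sup>2))"
  fix g assume g: "g \<in> L2"
  have "sqnorm (brep (inverse_fourier g)) = ennreal ((cmod ?c)\<^sup>2) * sqnorm (brep (fourier (fourier (fourier g))))"
    unfolding inverse_fourier_eq[OF g]
    unfolding sqnorm_cong_AE[OF const_L0_mult_brep] by (rule sqnorm_cmult) measurable
  also have "\<dots> \<le> ennreal ((cmod ?c)\<^sup>2) * (ennreal (8 * pi) * (ennreal (8 * pi) * (ennreal (8 * pi) * sqnorm (brep g))))"
    by (intro mult_left_mono order_trans[OF sqnorm_fourier_le] fourier_L2 g) auto
  also have "\<dots> = ennreal ((cmod ?c)\<^sup>2 * (8 * pi)^3) * sqnorm (brep g)"
    by (simp only: power3_eq_cube ennreal_mult ennreal_mult'' mult.assoc zero_le_power2 mult_nonneg_nonneg pi_ge_zero zero_le_numeral)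
  finally show "sqnorm (brep (inverse_fourier g)) \<le> ennreal ((cmod ?c)\<^sup>2 * (8 * pi)^3) * sqnorm (brep g)" .
qed

section \<open>Waves and translation of the transform\<close>

text \<open>Multiplication by a wave is isometric in every Banach function space and in L2, and
  commutes with multiplication by any symbol. These are the conjugating operators of the
  proof.\<close>

definition wave :: "real \<Rightarrow> L0" where
  "wave a = abs_L0 (\<lambda>t. exp (\<i> * of_real t * of_real a))"

lemma brep_wave: "AE t in lborel. brep (wave a) t = exp (\<i> * of_real t * of_real a)"
  unfolding wave_def by (rule AE_brep_abs, rule lebesgue_measurable_if_borel) measurable

lemma wave_Linf: "wave a \<in> Linf"
  unfolding Linf_iff by (rule exI[of _ 1]) (use brep_wave[of a] in \<open>auto elim: eventually_mono\<close>)

lemma brep_fourier_wave: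
  assumes f: "f \<in> L2"
  shows "AE x in lborel. brep (fourier (wave a * f)) x = plancherel (brep f) (x + a)"
proof -
  have wf: "wave a * f \<in> L2" by (rule Linf_mult_L2[OF wave_Linf f])
  have si: "square_integrable (brep f)" "square_integrable (brep (wave a * f))"
    using f wf by (auto simp: L2_iff)
  have si': "square_integrable (\<lambda>t. exp (\<i> * of_real t * of_real a) * brep f t)"
    by (rule square_integrable_bound[OF si(1)]) (auto simp: norm_mult)
  have "AE x in lborel. brep (wave a * f) x = exp (\<i> * of_real x * of_real a) * brep f x"
    using brep_times[of "wave a" f] brep_wave[of a] by eventually_elim simp
  from plancherel_cong_AE[OF si(2) si' this] plancherel_modulation[OF si(1), of a] brep_fourier[OF wf]
  show ?thesis by eventually_elim simp
qed

section \<open>Banach function spaces with absolutely continuous norm\<close>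

locale banach_function_space =
  fixes \<rho> :: "(real \<Rightarrow> ennreal) \<Rightarrow> ennreal"
  assumes bfn: "banach_function_norm \<rho>"
begin

lemma rho_eq_0_iff: "f \<in> borel_measurable lebesgue \<Longrightarrow> \<rho> f = 0 \<longleftrightarrow> (AE x in lborel. f x = 0)"
  using bfn unfolding banach_function_norm_def AE_completion_iff by blast

lemma rho_scale: "f \<in> borel_measurable lebesgue \<Longrightarrow> 0 \<le> a \<Longrightarrow> \<rho> (\<lambda>x. ennreal a * f x) = ennreal a * \<rho> f"
  using bfn unfolding banach_function_norm_def by blast

lemma rho_add:
  "f \<in> borel_measurable lebesgue \<Longrightarrow> g \<in> borel_measurable lebesgue \<Longrightarrow> \<rho> (\<lambda>x. f x + g x) \<le> \<rho> f + \<rho> g"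
  using bfn unfolding banach_function_norm_def by blast

lemma rho_mono:
  "f \<in> borel_measurable lebesgue \<Longrightarrow> g \<in> borel_measurable lebesgue \<Longrightarrow> AE x in lborel. g x \<le> f x \<Longrightarrow> \<rho> g \<le> \<rho> f"
  using bfn unfolding banach_function_norm_def AE_completion_iff by blast

lemma rho_tendsto:
  "f \<in> borel_measurable lebesgue \<Longrightarrow> (\<And>n::nat. F n \<in> borel_measurable lebesgue) \<Longrightarrow>
   AE x in lborel. incseq (\<lambda>n. F n x) \<and> (\<lambda>n. F n x) \<longlonglongrightarrow> f x \<Longrightarrow> (\<lambda>n. \<rho> (F n)) \<longlonglongrightarrow> \<rho> f"
  using bfn unfolding banach_function_norm_def AE_completion_iff by blast

lemma rho_indicator: "E \<in> sets lebesgue \<Longrightarrow> emeasure lebesgue E < \<infinity> \<Longrightarrow> \<rho> (indicator E) < \<infinity>"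
  using bfn unfolding banach_function_norm_def by blast

lemma rho_integral:
  "E \<in> sets lebesgue \<Longrightarrow> emeasure lebesgue E < \<infinity> \<Longrightarrow>
   \<exists>C::real. 0 < C \<and> (\<forall>f\<in>borel_measurable lebesgue. (\<integral>\<^sup>+x\<in>E. f x \<partial>lebesgue) \<le> ennreal C * \<rho> f)"
  using bfn unfolding banach_function_norm_def by blast

abbreviation nrm :: "L0 \<Rightarrow> ennreal" where "nrm \<equiv> bfs_norm \<rho>"

lemma measurable_cmod_brep [measurable]: "(\<lambda>x. ennreal (cmod (brep f x))) \<in> borel_measurable lebesgue"
  by (rule lebesgue_measurable_if_borel) measurable

lemma nrm_abs: "f \<in> borel_measurable lebesgue \<Longrightarrow> nrm (abs_L0 f) = \<rho> (\<lambda>x. ennreal (cmod (f x)))"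
  by (rule bfs_norm_abs_L0[OF bfn])

lemma nrm_eq: "nrm f = \<rho> (\<lambda>x. ennreal (cmod (brep f x)))"
  using nrm_abs[of "brep f"] by simp

lemma nrm_mono: "AE x in lborel. cmod (brep f x) \<le> cmod (brep g x) \<Longrightarrow> nrm f \<le> nrm g"
  unfolding nrm_eq by (rule rho_mono) (auto elim: eventually_mono intro: ennreal_leI)

lemma nrm_cong: "AE x in lborel. cmod (brep f x) = cmod (brep g x) \<Longrightarrow> nrm f = nrm g"
  by (intro antisym nrm_mono) (auto elim: eventually_mono)

lemma nrm_add: "nrm (f + g) \<le> nrm f + nrm g"
proof -
  have "nrm (f + g) \<le> \<rho> (\<lambda>x. ennreal (cmod (brep f x)) + ennreal (cmod (brep g x)))"
    unfolding nrm_eq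
  proof (rule rho_mono)
    show "AE x in lborel. ennreal (cmod (brep (f + g) x)) \<le> ennreal (cmod (brep f x)) + ennreal (cmod (brep g x))"
      using brep_plus[of f g]
      by eventually_elim (simp add: norm_triangle_ineq ennreal_leI flip: ennreal_plus)
  qed auto
  also have "\<dots> \<le> nrm f + nrm g" unfolding nrm_eq by (rule rho_add) auto
  finally show ?thesis .
qed

lemma nrm_const_mult: "nrm (const_L0 c * f) = ennreal (cmod c) * nrm f"
proof -
  have "nrm (const_L0 c * f) = \<rho> (\<lambda>x. ennreal (cmod c) * ennreal (cmod (brep f x)))"
    unfolding nrm_eq
    by (intro antisym rho_mono)
      (use const_L0_mult_brep[of c f] in \<open>auto simp: norm_mult ennreal_mult elim!: eventually_mono\<close>)
  also have "\<dots> = ennreal (cmod c) * nrm f"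
    unfolding nrm_eq by (rule rho_scale) auto
  finally show ?thesis .
qed

lemma nrm_0_iff: "nrm f = 0 \<longleftrightarrow> f = 0"
proof -
  have "nrm f = 0 \<longleftrightarrow> (AE x in lborel. ennreal (cmod (brep f x)) = 0)"
    unfolding nrm_eq by (rule rho_eq_0_iff) simp
  also have "\<dots> \<longleftrightarrow> (AE x in lborel. brep f x = brep 0 x)"
    using brep_0 by (auto simp: ennreal_eq_0_iff elim: eventually_elim2)
  finally show ?thesis by (simp add: L0_eq_iff[of f 0])
qed

lemma nrm_uminus: "nrm (- f) = nrm f"
  using brep_uminus[of f] by (intro nrm_cong) (auto elim: eventually_mono)

lemma nrm_minus_commute: "nrm (f - g) = nrm (g - f)"
  using nrm_uminus[of "f - g"] by simp

lemma nrm_diff: "nrm (f - g) \<le> nrm f + nrm g"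
  using nrm_add[of f "- g"] by (simp add: nrm_uminus)

lemma nrm_triangle: "nrm (f - h) \<le> nrm (f - g) + nrm (g - h)"
  using nrm_add[of "f - g" "g - h"] by simp

lemma nrm_wave: "nrm (wave a * f) = nrm f"
proof (rule nrm_cong)
  show "AE x in lborel. cmod (brep (wave a * f) x) = cmod (brep f x)"
    using brep_times[of "wave a" f] brep_wave[of a] by eventually_elim (simp add: norm_mult)
qed

lemma bfs_iff: "f \<in> bfs \<rho> \<longleftrightarrow> nrm f < \<infinity>"
  by (simp add: bfs_def)

lemma bfs_add: "f \<in> bfs \<rho> \<Longrightarrow> g \<in> bfs \<rho> \<Longrightarrow> f + g \<in> bfs \<rho>"
  unfolding bfs_iff by (rule le_less_trans[OF nrm_add]) simp

lemma bfs_diff: "f \<in> bfs \<rho> \<Longrightarrow> g \<in> bfs \<rho> \<Longrightarrow> f - g \<in> bfs \<rho>"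
  unfolding bfs_iff by (rule le_less_trans[OF nrm_diff]) simp

lemma bfs_const_mult: "f \<in> bfs \<rho> \<Longrightarrow> const_L0 c * f \<in> bfs \<rho>"
  unfolding bfs_iff nrm_const_mult by (simp add: ennreal_mult_less_top)

lemma bfs_0: "0 \<in> bfs \<rho>"
  using nrm_0_iff[of 0] by (simp add: bfs_iff)

lemma bfs_wave: "f \<in> bfs \<rho> \<Longrightarrow> wave a * f \<in> bfs \<rho>"
  by (simp add: bfs_iff nrm_wave)

lemma bfs_mono: "g \<in> bfs \<rho> \<Longrightarrow> AE x in lborel. cmod (brep f x) \<le> cmod (brep g x) \<Longrightarrow> f \<in> bfs \<rho>"
  unfolding bfs_iff using nrm_mono by (metis le_less_trans)

text \<open>Turns smallness in the norm of the space into smallness in L1 of an interval, where it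
  can be combined with L2 estimates.\<close>

lemma local_integral_le:
  "\<exists>C::real. 0 < C \<and> (\<forall>f. (\<integral>\<^sup>+x. ennreal (cmod (brep f x)) * indicator {a..b} x \<partial>lborel) \<le> ennreal C * nrm f)"
proof -
  have "{a..b} \<in> sets lebesgue" "emeasure lebesgue {a..b} < \<infinity>"
    by (auto simp: emeasure_lborel_Icc_eq)
  from rho_integral[OF this] obtain C where "0 < C"
    "\<And>f. f \<in> borel_measurable lebesgue \<Longrightarrow> (\<integral>\<^sup>+x\<in>{a..b}. f x \<partial>lebesgue) \<le> ennreal C * \<rho> f"
    by blast
  then show ?thesis
    unfolding nrm_eq nn_integral_completion by (intro exI[of _ C]) auto
qed

text \<open>\<open>enn2real\<close> sends an infinite norm to 0, but the zero test and the triangle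
  inequality are demanded on the carrier only, where norms of differences are finite.\<close>

sublocale bfs: Metric_space "bfs \<rho>" "\<lambda>f g. enn2real (nrm (f - g))"
proof
  show "enn2real (nrm (f - g)) = enn2real (nrm (g - f))" for f g by (subst nrm_minus_commute) simp
  show "(enn2real (nrm (f - g)) = 0) = (f = g)" if "f \<in> bfs \<rho>" "g \<in> bfs \<rho>" for f g
    using bfs_diff[OF that] nrm_0_iff[of "f - g"] by (auto simp: bfs_iff enn2real_eq_0_iff)
  show "enn2real (nrm (f - h)) \<le> enn2real (nrm (f - g)) + enn2real (nrm (g - h))"
    if "f \<in> bfs \<rho>" "g \<in> bfs \<rho>" "h \<in> bfs \<rho>" for f g h
  proof -
    have "nrm (f - g) < \<infinity>" "nrm (g - h) < \<infinity>"
      using bfs_diff[OF that(1,2)] bfs_diff[OF that(2,3)] by (auto simp: bfs_iff)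
    then show ?thesis
      using enn2real_mono[OF nrm_triangle[of f h g]] by (simp add: enn2real_plus)
  qed
qed simp

lemma bfs_topology_eq: "bfs_topology \<rho> = bfs.mtopology"
  by (simp add: bfs_topology_def norm_topology_def)

section \<open>Restrictions and test functions\<close>

definition cut :: "real set \<Rightarrow> L0 \<Rightarrow> L0" where
  "cut E f = abs_L0 (\<lambda>x. indicator E x * brep f x)"

lemma brep_cut:
  assumes [measurable]: "E \<in> sets borel"
  shows "AE x in lborel. brep (cut E f) x = indicator E x * brep f x"
  unfolding cut_def by (rule AE_brep_abs, rule lebesgue_measurable_if_borel) measurable

lemma nrm_cut: "E \<in> sets borel \<Longrightarrow> nrm (cut E f) = \<rho> (\<lambda>x. ennreal (cmod (brep f x)) * indicator E x)"
proof -
  assume E: "E \<in> sets borel"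
  have "(\<lambda>x. indicator E x * brep f x) \<in> borel_measurable lebesgue"
    by (rule lebesgue_measurable_if_borel) (use E in measurable)
  moreover have "(\<lambda>x. ennreal (cmod (indicator E x * brep f x))) = (\<lambda>x. ennreal (cmod (brep f x)) * indicator E x)"
    by (auto simp: fun_eq_iff indicator_def)
  ultimately show ?thesis unfolding cut_def using nrm_abs by metis
qed

lemma nrm_cut_mono:
  assumes "E \<in> sets borel" "F \<in> sets borel" "E \<subseteq> F"
  shows "nrm (cut E f) \<le> nrm (cut F f)"
proof (rule nrm_mono)
  show "AE x in lborel. cmod (brep (cut E f) x) \<le> cmod (brep (cut F f) x)"
    using brep_cut[OF assms(1), of f] brep_cut[OF assms(2), of f]
    by eventually_elim (use assms(3) in \<open>auto simp: indicator_def\<close>)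
qed

lemma cut_bfs: "E \<in> sets borel \<Longrightarrow> f \<in> bfs \<rho> \<Longrightarrow> cut E f \<in> bfs \<rho>"
  using brep_cut[of E f] by (elim bfs_mono) (auto elim!: eventually_mono simp: indicator_def)

text \<open>The test function of the main argument: by (A4) it belongs to the space, and it lies in
  L2, so that \<open>W0\<close> acts on it by the Fourier formula.\<close>

definition interval_ind :: "real \<Rightarrow> L0" where
  "interval_ind r = abs_L0 (indicator {-r..r})"

lemma brep_interval_ind: "AE x in lborel. brep (interval_ind r) x = indicator {-r..r} x"
  unfolding interval_ind_def by (rule AE_brep_abs, rule lebesgue_measurable_if_borel) measurable

lemma interval_ind_L2: "interval_ind r \<in> L2"
  unfolding interval_ind_def by (subst abs_L0_L2_iff) (auto intro: square_integrable_indicator)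

lemma interval_ind_bfs: "interval_ind r \<in> bfs \<rho>"
proof -
  have "nrm (interval_ind r) = \<rho> (indicator {-r..r})"
    unfolding nrm_eq
    by (intro antisym rho_mono lebesgue_measurable_if_borel)
      (use brep_interval_ind[of r] in \<open>auto elim!: eventually_mono simp: indicator_def\<close>)
  also have "\<dots> < \<infinity>" by (rule rho_indicator) (auto simp: emeasure_lborel_Icc_eq)
  finally show ?thesis by (simp add: bfs_iff)
qed

section \<open>Bounded operators and the operator norm\<close>

lemma bounded_opsD:
  assumes "T \<in> bounded_ops \<rho>"
  shows "\<And>f. f \<notin> bfs \<rho> \<Longrightarrow> T f = 0" "\<And>f. f \<in> bfs \<rho> \<Longrightarrow> T f \<in> bfs \<rho>"
    "\<And>f g. f \<in> bfs \<rho> \<Longrightarrow> g \<in> bfs \<rho> \<Longrightarrow> T (f + g) = T f + T g"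
    "\<And>c f. f \<in> bfs \<rho> \<Longrightarrow> T (const_L0 c * f) = const_L0 c * T f"
    "\<exists>C::real. \<forall>f\<in>bfs \<rho>. nrm (T f) \<le> ennreal C * nrm f"
  using assms unfolding bounded_ops_def by blast+

lemma bounded_op_diff:
  assumes T: "T \<in> bounded_ops \<rho>" and "f \<in> bfs \<rho>" "g \<in> bfs \<rho>"
  shows "T (f - g) = T f - T g"
  using bounded_opsD(3)[OF T bfs_diff[OF assms(2,3)] assms(3)] by (simp add: algebra_simps)

lemma bounded_op_0: "T \<in> bounded_ops \<rho> \<Longrightarrow> T 0 = 0"
  using bounded_op_diff[of T 0 0] bfs_0 by simp

lemma bounded_op_sum:
  "finite A \<Longrightarrow> T \<in> bounded_ops \<rho> \<Longrightarrow> (\<And>i. i \<in> A \<Longrightarrow> f i \<in> bfs \<rho>) \<Longrightarrow>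
    (\<Sum>i\<in>A. f i) \<in> bfs \<rho> \<and> T (\<Sum>i\<in>A. f i) = (\<Sum>i\<in>A. T (f i))"
  by (induction A rule: finite_induct) (auto simp: bounded_op_0 bfs_0 bfs_add bounded_opsD(3))

lemma op_norm_le:
  assumes "\<And>f. f \<in> bfs \<rho> \<Longrightarrow> nrm (T f) \<le> C * nrm f"
  shows "op_norm \<rho> T \<le> C"
  unfolding op_norm_def
proof (rule SUP_least)
  fix f assume f: "f \<in> {f \<in> bfs \<rho>. nrm f \<le> 1}"
  then have "C * nrm f \<le> C * 1" by (intro mult_left_mono) auto
  with assms[of f] f show "nrm (T f) \<le> C" by (auto intro: order_trans)
qed

lemma op_norm_finite: "T \<in> bounded_ops \<rho> \<Longrightarrow> op_norm \<rho> T < \<infinity>"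
proof -
  assume "T \<in> bounded_ops \<rho>"
  then obtain C :: real where "\<And>f. f \<in> bfs \<rho> \<Longrightarrow> nrm (T f) \<le> ennreal C * nrm f"
    using bounded_opsD(5) by blast
  then have "op_norm \<rho> T \<le> ennreal C" by (rule op_norm_le)
  then show ?thesis by (auto intro: le_less_trans)
qed

lemma nrm_op_le:
  assumes T: "T \<in> bounded_ops \<rho>" and f: "f \<in> bfs \<rho>"
  shows "nrm (T f) \<le> op_norm \<rho> T * nrm f"
proof (cases "f = 0")
  case True
  then show ?thesis using bounded_op_0[OF T] nrm_0_iff[of 0] by simp
next
  case False
  obtain r where r: "0 \<le> r" "nrm f = ennreal r" using f by (cases "nrm f") (auto simp: bfs_iff)
  with False have r0: "0 < r" using nrm_0_iff[of f] by (cases "r = 0") auto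
  let ?g = "const_L0 (of_real (1 / r)) * f"
  have "nrm ?g = ennreal (1 / r) * ennreal r"
    using r0 r by (simp add: nrm_const_mult norm_divide)
  also have "\<dots> = 1" using r0 by (simp add: ennreal_mult[symmetric])
  finally have "nrm ?g = 1" .
  moreover have "?g \<in> bfs \<rho>" by (rule bfs_const_mult[OF f])
  ultimately have "nrm (T ?g) \<le> op_norm \<rho> T"
    unfolding op_norm_def by (intro SUP_upper) auto
  moreover have "T f = const_L0 (of_real r) * T ?g"
  proof -
    have "const_L0 (of_real r) * T ?g = (const_L0 (of_real r) * const_L0 (of_real (1 / r))) * T f"
      by (simp add: bounded_opsD(4)[OF T f] mult.assoc)
    also have "const_L0 (of_real r) * const_L0 (of_real (1 / r)) = 1"
      using r0 by (simp flip: const_L0_hom(3) add: const_L0_hom(5))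
    finally show ?thesis by simp
  qed
  then have "nrm (T f) = ennreal r * nrm (T ?g)" using r0 by (simp add: nrm_const_mult)
  ultimately show ?thesis using r by (simp add: mult.commute mult_left_mono)
qed

end

section \<open>Separability and dominated convergence in the norm\<close>

locale separable_bfs = banach_function_space +
  assumes separable: "separable_space (bfs_topology \<rho>)"
begin

text \<open>If \<open>nrm (cut (E n) f)\<close> stays above \<open>\<epsilon>\<close>, property (A3) yields disjoint pieces \<open>D i\<close> of norm above
  \<open>\<epsilon>\<close>; the functions \<open>cut (\<Union>i\<in>S. D i) f\<close>, \<open>S \<subseteq> \<nat>\<close>, then form an uncountable separated family.\<close>

lemma absolutely_continuous_norm:
  assumes f: "f \<in> bfs \<rho>" and E: "\<And>n::nat. E n \<in> sets borel" and dec: "decseq E"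
    and null: "AE x in lborel. x \<notin> (\<Inter>n. E n)"
  shows "(\<lambda>n. nrm (cut (E n) f)) \<longlonglongrightarrow> 0"
proof (rule ccontr)
  assume not: "\<not> (\<lambda>n. nrm (cut (E n) f)) \<longlonglongrightarrow> 0"
  \<comment> \<open>The norms decrease with \<open>n\<close>, so failing to tend to 0 means staying
    above one positive level for all \<open>n\<close>.\<close>
  obtain e where e: "0 < e" "\<And>n. e < nrm (cut (E n) f)"
  proof (rule ccontr)
    assume "\<not> thesis"
    with that have *: "\<exists>n. nrm (cut (E n) f) \<le> e" if "0 < e" for e using that by (meson not_le)
    have "(\<lambda>n. nrm (cut (E n) f)) \<longlonglongrightarrow> 0"
    proof (rule order_tendstoI)
      fix a :: ennreal assume "0 < a"
      then obtain e where e: "0 < e" "e < a" using dense by blast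
      from *[OF e(1)] obtain n where n: "nrm (cut (E n) f) \<le> e" ..
      have "nrm (cut (E m) f) < a" if "m \<ge> n" for m
        using nrm_cut_mono[OF E E decseqD[OF dec that], of f] n e by (meson le_less_trans)
      then show "\<forall>\<^sub>F n in sequentially. nrm (cut (E n) f) < a" by (auto simp: eventually_sequentially)
    qed simp
    with not show False by simp
  qed
  have "\<exists>m>n. e < nrm (cut (E n - E m) f)" for n
  proof -
    have "(\<lambda>m. \<rho> (\<lambda>x. ennreal (cmod (brep f x)) * indicator (E n - E m) x)) \<longlonglongrightarrow>
       \<rho> (\<lambda>x. ennreal (cmod (brep f x)) * indicator (E n) x)"
    proof (rule rho_tendsto)
      show "AE x in lborel. incseq (\<lambda>m. ennreal (cmod (brep f x)) * indicator (E n - E m) x) \<and>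
        (\<lambda>m. ennreal (cmod (brep f x)) * indicator (E n - E m) x) \<longlonglongrightarrow> ennreal (cmod (brep f x)) * indicator (E n) x"
        using null
      proof (eventually_elim, intro conjI)
        fix x assume x: "x \<notin> (\<Inter>n. E n)"
        show "incseq (\<lambda>m. ennreal (cmod (brep f x)) * indicator (E n - E m) x)"
        proof (rule monoI)
          fix i j :: nat assume "i \<le> j"
          with dec have "E j \<subseteq> E i" by (auto simp: decseq_def)
          then show "ennreal (cmod (brep f x)) * indicator (E n - E i) x \<le> ennreal (cmod (brep f x)) * indicator (E n - E j) x"
            by (intro mult_left_mono) (auto simp: indicator_def)
        qed
        obtain k where k: "x \<notin> E k" using x by auto
        have "indicator (E n - E m) x = (indicator (E n) x :: ennreal)" if "m \<ge> k" for m
          using k decseqD[OF dec that] by (auto simp: indicator_def)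
        then have "\<forall>\<^sub>F m in sequentially. ennreal (cmod (brep f x)) * indicator (E n) x = ennreal (cmod (brep f x)) * indicator (E n - E m) x"
          by (intro eventually_sequentiallyI[of k]) simp
        then show "(\<lambda>m. ennreal (cmod (brep f x)) * indicator (E n - E m) x) \<longlonglongrightarrow> ennreal (cmod (brep f x)) * indicator (E n) x"
          by (rule Lim_transform_eventually[OF tendsto_const])
      qed
      note [measurable] = E
      show "(\<lambda>x. ennreal (cmod (brep f x)) * indicator (E n - E m) x) \<in> borel_measurable lebesgue" for m
        by (intro lebesgue_measurable_if_borel) measurable
      show "(\<lambda>x. ennreal (cmod (brep f x)) * indicator (E n) x) \<in> borel_measurable lebesgue"
        by (intro lebesgue_measurable_if_borel) measurable
    qed
    then have "(\<lambda>m. nrm (cut (E n - E m) f)) \<longlonglongrightarrow> nrm (cut (E n) f)"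
      using E by (simp add: nrm_cut sets.Diff)
    from order_tendstoD(1)[OF this e(2)] have "\<forall>\<^sub>F m in sequentially. n < m \<and> e < nrm (cut (E n - E m) f)"
      using eventually_gt_at_top[of n] by eventually_elim simp
    then show ?thesis using eventually_happens' sequentially_bot by blast
  qed
  then obtain nxt where nxt: "\<And>n. n < nxt n" "\<And>n. e < nrm (cut (E n - E (nxt n)) f)" by metis
  define k where "k i = (nxt ^^ i) 0" for i
  have kS: "k (Suc i) = nxt (k i)" for i by (simp add: k_def)
  have kmono: "strict_mono k" by (rule strict_monoI_Suc) (simp add: kS nxt)
  define D where "D i = E (k i) - E (k (Suc i))" for i
  have D: "D i \<in> sets borel" "e < nrm (cut (D i) f)" for i
    using E nxt(2)[of "k i"] by (auto simp: D_def kS)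
  have disj: "D i \<inter> D j = {}" if "i < j" for i j
  proof -
    have "k (Suc i) \<le> k j" using that strict_mono_less_eq[OF kmono] by (simp add: Suc_le_eq)
    then have "E (k j) \<subseteq> E (k (Suc i))" by (rule decseqD[OF dec])
    then show ?thesis by (auto simp: D_def)
  qed
  have disj': "i = j" if "x \<in> D i" "x \<in> D j" for i j x
    using disj[of i j] disj[of j i] that by (cases i j rule: linorder_cases) auto
  define F where "F S = cut (\<Union>i\<in>S. D i) f" for S
  have UD: "(\<Union>i\<in>S. D i) \<in> sets borel" for S :: "nat set" using D by blast
  have F_bfs: "F S \<in> bfs \<rho>" for S unfolding F_def by (rule cut_bfs[OF UD f])
  have sep: "e < nrm (F S - F T)" if ST: "S \<noteq> T" for S T
  proof -
    \<comment> \<open>An index in exactly one of the two sets leaves the piece \<open>D i\<close>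
      uncancelled in \<open>F S - F T\<close>.\<close>
    obtain i where i: "i \<in> S \<longleftrightarrow> i \<notin> T" using ST by blast
    have "nrm (cut (D i) f) \<le> nrm (F S - F T)"
    proof (rule nrm_mono)
      show "AE x in lborel. cmod (brep (cut (D i) f) x) \<le> cmod (brep (F S - F T) x)"
        using brep_cut[OF D(1)[of i], of f] brep_minus[of "F S" "F T"] brep_cut[OF UD[of S], of f] brep_cut[OF UD[of T], of f]
      proof eventually_elim
        case (elim x)
        show ?case
        proof (cases "x \<in> D i")
          case True
          then have "x \<in> (\<Union>j\<in>S. D j) \<longleftrightarrow> i \<in> S" "x \<in> (\<Union>j\<in>T. D j) \<longleftrightarrow> i \<in> T"
            using disj' by blast+
          then show ?thesis using elim True i unfolding F_def by (cases "i \<in> S") (simp_all del: UN_iff)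
        qed (use elim in simp)
      qed
    qed
    with D(2)[of i] show ?thesis by (meson less_le_trans)
  qed
  obtain U where U: "countable U" "U \<subseteq> bfs \<rho>" "bfs.mtopology closure_of U = bfs \<rho>"
    using separable unfolding separable_space_def bfs_topology_eq by auto
  \<comment> \<open>The separation level is an extended real, whereas the balls of the metric have
    real radii.\<close>
  obtain e' :: real where e': "0 < e'" "ennreal e' \<le> e"
  proof (cases e)
    case (real r)
    then show ?thesis using e(1) that[of r] by auto
  next
    case top
    then show ?thesis using that[of 1] by auto
  qed
  have "\<exists>u\<in>U. enn2real (nrm (F S - u)) < e' / 2" for S
  proof -
    have "F S \<in> bfs.mtopology closure_of U" using F_bfs U(3) by simp
    then have "\<forall>r>0. \<exists>y\<in>U. y \<in> bfs.mball (F S) r" unfolding bfs.metric_closure_of by blast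
    then obtain y where "y \<in> U" "y \<in> bfs.mball (F S) (e' / 2)" using e'(1) by (meson half_gt_zero)
    then show ?thesis by auto
  qed
  then obtain u where u: "\<And>S. u S \<in> U" "\<And>S. enn2real (nrm (F S - u S)) < e' / 2" by metis
  \<comment> \<open>A point of \<open>U\<close> chosen for both \<open>F S\<close> and
    \<open>F T\<close> would put them within \<open>e'\<close>, hence within \<open>e\<close>, of
    each other. So the subsets of the naturals would embed into the countable set
    \<open>U\<close>.\<close>
  have "inj u"
  proof (rule injI)
    fix S T assume eq: "u S = u T"
    show "S = T"
    proof (rule ccontr)
      assume "S \<noteq> T"
      have lt: "nrm (F S - u S) \<le> ennreal (e' / 2)" for S
        using u(2)[of S] bfs_diff[OF F_bfs[of S], of "u S"] u(1)[of S] U(2)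
        by (cases "nrm (F S - u S)") (auto simp: bfs_iff)
      have "nrm (F S - F T) \<le> nrm (F S - u S) + nrm (F T - u T)"
        using nrm_triangle[of "F S" "F T" "u S"] nrm_minus_commute[of "u S" "F T"] eq by simp
      also have "\<dots> \<le> ennreal (e' / 2) + ennreal (e' / 2)" by (intro add_mono lt)
      also have "\<dots> = ennreal e'" using e'(1) by (simp flip: ennreal_plus)
      also have "\<dots> \<le> e" by (rule e')
      finally show False using sep[OF \<open>S \<noteq> T\<close>] by simp
    qed
  qed
  moreover have "countable (range u)" using U(1) u(1) by (meson countable_subset image_subsetI)
  ultimately have "countable (UNIV :: nat set set)" by (metis countable_image_inj_on)
  then obtain h :: "nat set \<Rightarrow> nat" where "inj h" using countableE by blast
  then have "surj (inv_into UNIV h)" by (rule inj_imp_surj_inv)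
  then show False using Cantors_theorem[of "UNIV::nat set"] by auto
qed

text \<open>Split at \<open>|g n| = d |f|\<close>. Below this level the norm is at most
  \<open>d * nrm f\<close>; above it \<open>g n\<close> is dominated by \<open>f\<close> on sets
  decreasing to a null set, where the norm of \<open>f\<close> is absolutely continuous.\<close>

lemma bfs_dominated_convergence:
  assumes f: "f \<in> bfs \<rho>"
    and bound: "\<And>n::nat. AE x in lborel. cmod (brep (g n) x) \<le> cmod (brep f x)"
    and lim: "AE x in lborel. (\<lambda>n. brep (g n) x) \<longlonglongrightarrow> 0"
  shows "(\<lambda>n. nrm (g n)) \<longlonglongrightarrow> 0"
proof (rule order_tendstoI)
  fix a :: ennreal assume a: "0 < a"
  obtain r where r: "0 \<le> r" "nrm f = ennreal r" using f by (cases "nrm f") (auto simp: bfs_iff)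
  obtain e :: real where e: "0 < e" "ennreal e < a"
  proof (cases a)
    case (real s)
    then show ?thesis using a that[of "s / 2"] by (auto simp: ennreal_less_iff)
  next
    case top
    then show ?thesis using that[of 1] by auto
  qed
  \<comment> \<open>Chosen so that \<open>d * nrm f <= e / 2\<close>; the \<open>+ 1\<close> covers
    \<open>nrm f = 0\<close>.\<close>
  define d where "d = e / (2 * (r + 1))"
  have d: "0 < d" "d * r \<le> e / 2" using e r by (auto simp: d_def field_simps)
  \<comment> \<open>The whole tail \<open>m >= n\<close> enters, which makes the sets decreasing.
    The strict inequality keeps out the points where \<open>f\<close> vanishes, since almost
    everywhere \<open>g m\<close> vanishes there too.\<close>
  define E where "E n = {x. \<exists>m\<ge>n. d * cmod (brep f x) < cmod (brep (g m) x)}" for n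
  have E: "E n \<in> sets borel" for n
  proof -
    have "E n = (\<Union>m\<in>{n..}. {x. d * cmod (brep f x) < cmod (brep (g m) x)})" by (auto simp: E_def)
    also have "\<dots> \<in> sets borel" by measurable
    finally show ?thesis .
  qed
  have "decseq E" unfolding decseq_def E_def by (auto intro: order_trans)
  moreover have bound_all: "AE x in lborel. \<forall>n. cmod (brep (g n) x) \<le> cmod (brep f x)"
    unfolding AE_all_countable using bound by blast
  moreover have "AE x in lborel. x \<notin> (\<Inter>n. E n)"
    using bound_all lim
  proof eventually_elim
    case (elim x)
    show ?case
    proof (cases "brep f x = 0")
      case True
      then show ?thesis using elim by (auto simp: E_def)
    next
      case False
      have "(\<lambda>n. cmod (brep (g n) x)) \<longlonglongrightarrow> 0" using elim(2) by (rule tendsto_norm_zero)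
      from order_tendstoD(2)[OF this, of "d * cmod (brep f x)"] False d(1)
      obtain n where "\<And>m. m \<ge> n \<Longrightarrow> cmod (brep (g m) x) < d * cmod (brep f x)"
        by (auto simp: eventually_sequentially)
      then have "x \<notin> E n" by (auto simp: E_def not_less less_imp_le)
      then show ?thesis by auto
    qed
  qed
  ultimately have "(\<lambda>n. nrm (cut (E n) f)) \<longlonglongrightarrow> 0" by (intro absolutely_continuous_norm[OF f E])
  from order_tendstoD(2)[OF this, of "ennreal (e / 2)"] e
  have "\<forall>\<^sub>F n in sequentially. nrm (cut (E n) f) < ennreal (e / 2)" by simp
  then show "\<forall>\<^sub>F n in sequentially. nrm (g n) < a"
  proof eventually_elim
    case (elim n)
    have "nrm (g n) \<le> \<rho> (\<lambda>x. ennreal d * ennreal (cmod (brep f x)) + ennreal (cmod (brep f x)) * indicator (E n) x)"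
      unfolding nrm_eq
    proof (rule rho_mono)
      show "AE x in lborel. ennreal (cmod (brep (g n) x)) \<le> ennreal d * ennreal (cmod (brep f x)) + ennreal (cmod (brep f x)) * indicator (E n) x"
        using bound[of n]
      proof eventually_elim
        case (elim x)
        show ?case
        proof (cases "x \<in> E n")
          case True
          then show ?thesis using elim by (simp add: ennreal_leI add_increasing)
        next
          case False
          then have "cmod (brep (g n) x) \<le> d * cmod (brep f x)" by (auto simp: E_def)
          then show ?thesis using False d(1) by (simp add: ennreal_mult[symmetric] ennreal_leI)
        qed
      qed
    qed (use E[of n] in \<open>intro lebesgue_measurable_if_borel, measurable\<close>)+
    also have "\<dots> \<le> \<rho> (\<lambda>x. ennreal d * ennreal (cmod (brep f x))) + \<rho> (\<lambda>x. ennreal (cmod (brep f x)) * indicator (E n) x)"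
      by (rule rho_add) (use E[of n] in \<open>intro lebesgue_measurable_if_borel, measurable\<close>)+
    also have "\<dots> = ennreal d * nrm f + nrm (cut (E n) f)"
      using d(1) by (simp add: rho_scale nrm_eq[symmetric] nrm_cut[OF E])
    also have "\<dots> \<le> ennreal (e / 2) + ennreal (e / 2)"
    proof (rule add_mono)
      show "ennreal d * nrm f \<le> ennreal (e / 2)"
        using d r by (simp add: ennreal_mult[symmetric] ennreal_leI)
    qed (use elim in simp)
    also have "\<dots> = ennreal e" using e(1) by (simp flip: ennreal_plus)
    finally show ?case using e(2) by (meson le_less_trans)
  qed
qed simp

text \<open>Restricting \<open>f\<close> to where both \<open>|f|\<close> and \<open>|x|\<close> are
  at most \<open>n\<close> gives a bounded function of bounded support; dominated convergence in the
  space removes the restriction.\<close>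

lemma L2_dense:
  assumes f: "f \<in> bfs \<rho>"
  shows "\<exists>g. (\<forall>n::nat. g n \<in> L2 \<inter> bfs \<rho>) \<and> (\<lambda>n. nrm (f - g n)) \<longlonglongrightarrow> 0"
proof -
  define E where "E n = {x. cmod (brep f x) \<le> real n} \<inter> {- real n..real n}" for n
  have E: "E n \<in> sets borel" for n unfolding E_def by measurable
  define g where "g n = cut (E n) f" for n
  have "g n \<in> L2" for n
  proof -
    have "sqnorm (brep (g n)) \<le> sqnorm (\<lambda>x. of_nat n * indicator {- real n..real n} x)"
      unfolding sqnorm_def
    proof (rule nn_integral_mono_AE)
      show "AE x in lborel. ennreal ((cmod (brep (g n) x))\<^sup>2) \<le> ennreal ((cmod (of_nat n * indicator {- real n..real n} x))\<^sup>2)"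
        using brep_cut[OF E[of n], of f]
        by eventually_elim (auto simp: g_def E_def norm_mult indicator_def intro!: ennreal_leI power_mono)
    qed
    also have "\<dots> < \<infinity>"
      using square_integrable_cmult[OF square_integrable_indicator, of "of_nat n" "- real n" "real n"]
      by (simp add: square_integrable_def)
    finally show ?thesis by (simp add: L2_iff square_integrable_def)
  qed
  moreover have "g n \<in> bfs \<rho>" for n unfolding g_def by (rule cut_bfs[OF E f])
  moreover have "(\<lambda>n. nrm (f - g n)) \<longlonglongrightarrow> 0"
  proof (rule bfs_dominated_convergence[OF f])
    have ae: "AE x in lborel. brep (f - g n) x = brep f x - indicator (E n) x * brep f x" for n
      using brep_cut[OF E[of n], of f] brep_minus[of f "g n"] by eventually_elim (simp add: g_def)
    show "AE x in lborel. cmod (brep (f - g n) x) \<le> cmod (brep f x)" for n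
      using ae[of n] by eventually_elim (auto simp: indicator_def)
    have "AE x in lborel. \<forall>n. brep (f - g n) x = brep f x - indicator (E n) x * brep f x"
      unfolding AE_all_countable using ae by blast
    then show "AE x in lborel. (\<lambda>n. brep (f - g n) x) \<longlonglongrightarrow> 0"
    proof eventually_elim
      case (elim x)
      obtain N where N: "max (cmod (brep f x)) \<bar>x\<bar> \<le> real N" using real_arch_simple by blast
      have "x \<in> E n" if "n \<ge> N" for n
      proof -
        have "real N \<le> real n" using that by simp
        then show ?thesis using N by (auto simp: E_def)
      qed
      then have "\<forall>\<^sub>F n in sequentially. 0 = brep (f - g n) x"
        unfolding eventually_sequentially using elim by (intro exI[of _ N]) auto
      then show ?case by (rule Lim_transform_eventually[OF tendsto_const])
    qed
  qed
  ultimately show ?thesis by blast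
qed

subsection \<open>The algebra of multipliers\<close>

text \<open>Bounded operators that agree on a dense subspace coincide. This makes the definite
  description in \<open>W0\<close> meaningful.\<close>

lemma is_multiplier_op_unique:
  assumes T: "is_multiplier_op \<rho> a T" and S: "is_multiplier_op \<rho> a S"
  shows "T = S"
proof
  fix f
  have bo: "T \<in> bounded_ops \<rho>" "S \<in> bounded_ops \<rho>" using T S by (auto simp: is_multiplier_op_def)
  show "T f = S f"
  proof (cases "f \<in> bfs \<rho>")
    case False
    then show ?thesis using bounded_opsD(1)[OF bo(1)] bounded_opsD(1)[OF bo(2)] by simp
  next
    case True
    from L2_dense[OF True] obtain g where g: "\<And>n::nat. g n \<in> L2 \<inter> bfs \<rho>" "(\<lambda>n. nrm (f - g n)) \<longlonglongrightarrow> 0"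
      by blast
    have fg: "f - g n \<in> bfs \<rho>" for n using True g by (auto intro: bfs_diff)
    have eq: "T (g n) = S (g n)" for n using T S g(1)[of n] by (auto simp: is_multiplier_op_def)
    have "nrm (T f - S f) \<le> op_norm \<rho> T * nrm (f - g n) + op_norm \<rho> S * nrm (f - g n)" for n
    proof -
      have "T f - S f = T (f - g n) - S (f - g n)"
        using True g eq[of n] by (simp add: bounded_op_diff bo)
      then have "nrm (T f - S f) \<le> nrm (T (f - g n)) + nrm (S (f - g n))" by (simp add: nrm_diff)
      also have "\<dots> \<le> op_norm \<rho> T * nrm (f - g n) + op_norm \<rho> S * nrm (f - g n)"
        by (intro add_mono nrm_op_le bo fg)
      finally show ?thesis .
    qed
    moreover have "(\<lambda>n. op_norm \<rho> T * nrm (f - g n) + op_norm \<rho> S * nrm (f - g n)) \<longlonglongrightarrow> op_norm \<rho> T * 0 + op_norm \<rho> S * 0"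
      using op_norm_finite[OF bo(1)] op_norm_finite[OF bo(2)]
      by (intro tendsto_add ennreal_tendsto_cmult g) auto
    ultimately have "nrm (T f - S f) \<le> op_norm \<rho> T * 0 + op_norm \<rho> S * 0"
      by (intro tendsto_lowerbound[where F=sequentially]) auto
    then show ?thesis using nrm_0_iff[of "T f - S f"] by simp
  qed
qed

lemma W0_eqI: "is_multiplier_op \<rho> a T \<Longrightarrow> W0 \<rho> a = T"
  unfolding W0_def using is_multiplier_op_unique by blast

lemma is_multiplier_op_W0: "a \<in> multipliers \<rho> \<Longrightarrow> is_multiplier_op \<rho> a (W0 \<rho> a)"
  using W0_eqI by (auto simp: multipliers_def)

lemma W0_bounded_op: "a \<in> multipliers \<rho> \<Longrightarrow> W0 \<rho> a \<in> bounded_ops \<rho>"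
  using is_multiplier_op_W0 by (simp add: is_multiplier_op_def)

lemma W0_L2: "a \<in> multipliers \<rho> \<Longrightarrow> f \<in> L2 \<inter> bfs \<rho> \<Longrightarrow> W0 \<rho> a f = inverse_fourier (a * fourier f)"
  using is_multiplier_op_W0 unfolding is_multiplier_op_def by blast

lemma multipliersI: "a \<in> Linf \<Longrightarrow> is_multiplier_op \<rho> a T \<Longrightarrow> a \<in> multipliers \<rho>"
  by (auto simp: multipliers_def)

lemma multipliers_Linf: "a \<in> multipliers \<rho> \<Longrightarrow> a \<in> Linf"
  by (simp add: multipliers_def)

lemma bounded_ops_add:
  assumes S: "S \<in> bounded_ops \<rho>" and T: "T \<in> bounded_ops \<rho>"
  shows "(\<lambda>f. S f + T f) \<in> bounded_ops \<rho>"
proof -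
  have "nrm (S f + T f) \<le> ennreal (enn2real (op_norm \<rho> S + op_norm \<rho> T)) * nrm f" if f: "f \<in> bfs \<rho>" for f
  proof -
    have "nrm (S f + T f) \<le> op_norm \<rho> S * nrm f + op_norm \<rho> T * nrm f"
      by (intro order_trans[OF nrm_add] add_mono nrm_op_le S T f)
    also have "\<dots> = (op_norm \<rho> S + op_norm \<rho> T) * nrm f" by (simp add: distrib_right)
    also have "op_norm \<rho> S + op_norm \<rho> T = ennreal (enn2real (op_norm \<rho> S + op_norm \<rho> T))"
      using op_norm_finite[OF S] op_norm_finite[OF T] by simp
    finally show ?thesis .
  qed
  then have "\<exists>C::real. \<forall>f\<in>bfs \<rho>. nrm (S f + T f) \<le> ennreal C * nrm f" by blast
  then show ?thesis
    using S T by (auto simp: bounded_ops_def bfs_add distrib_left)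
qed

lemma bounded_ops_const_mult:
  assumes S: "S \<in> bounded_ops \<rho>"
  shows "(\<lambda>f. const_L0 c * S f) \<in> bounded_ops \<rho>"
proof -
  have "nrm (const_L0 c * S f) \<le> ennreal (enn2real (ennreal (cmod c) * op_norm \<rho> S)) * nrm f" if f: "f \<in> bfs \<rho>" for f
  proof -
    have "nrm (const_L0 c * S f) \<le> ennreal (cmod c) * op_norm \<rho> S * nrm f"
      unfolding nrm_const_mult mult.assoc by (intro mult_left_mono nrm_op_le S f) simp
    also have "ennreal (cmod c) * op_norm \<rho> S = ennreal (enn2real (ennreal (cmod c) * op_norm \<rho> S))"
      using op_norm_finite[OF S] by (simp add: ennreal_mult_less_top)
    finally show ?thesis .
  qed
  then have "\<exists>C::real. \<forall>f\<in>bfs \<rho>. nrm (const_L0 c * S f) \<le> ennreal C * nrm f" by blast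
  then show ?thesis
    using S by (auto simp: bounded_ops_def bfs_const_mult distrib_left mult.left_commute)
qed

lemma bounded_ops_comp:
  assumes S: "S \<in> bounded_ops \<rho>" and T: "T \<in> bounded_ops \<rho>"
  shows "S \<circ> T \<in> bounded_ops \<rho>"
proof -
  have "nrm (S (T f)) \<le> ennreal (enn2real (op_norm \<rho> S * op_norm \<rho> T)) * nrm f" if f: "f \<in> bfs \<rho>" for f
  proof -
    have "nrm (S (T f)) \<le> op_norm \<rho> S * op_norm \<rho> T * nrm f"
      unfolding mult.assoc
      by (intro order_trans[OF nrm_op_le[OF S]] mult_left_mono nrm_op_le T f bounded_opsD(2)[OF T]) simp
    also have "op_norm \<rho> S * op_norm \<rho> T = ennreal (enn2real (op_norm \<rho> S * op_norm \<rho> T))"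
      using op_norm_finite[OF S] op_norm_finite[OF T] by (simp add: ennreal_mult_less_top)
    finally show ?thesis .
  qed
  then have "\<exists>C::real. \<forall>f\<in>bfs \<rho>. nrm ((S \<circ> T) f) \<le> ennreal C * nrm f" by auto
  then show ?thesis
    using S T bounded_op_0[OF S] by (auto simp: bounded_ops_def)
qed

lemma multiplier_op_add:
  assumes a: "a \<in> multipliers \<rho>" and b: "b \<in> multipliers \<rho>"
  shows "is_multiplier_op \<rho> (a + b) (\<lambda>f. W0 \<rho> a f + W0 \<rho> b f)"
  unfolding is_multiplier_op_def
proof (intro conjI ballI)
  fix f assume f: "f \<in> L2 \<inter> bfs \<rho>"
  have "a * fourier f \<in> L2" "b * fourier f \<in> L2"
    using a b f by (auto intro!: Linf_mult_L2 multipliers_Linf fourier_L2)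
  then show "W0 \<rho> a f + W0 \<rho> b f = inverse_fourier ((a + b) * fourier f)"
    by (simp add: W0_L2[OF a f] W0_L2[OF b f] distrib_right inverse_fourier_add)
qed (intro bounded_ops_add W0_bounded_op a b)

lemma multiplier_op_const_mult:
  assumes a: "a \<in> multipliers \<rho>"
  shows "is_multiplier_op \<rho> (const_L0 c * a) (\<lambda>f. const_L0 c * W0 \<rho> a f)"
  unfolding is_multiplier_op_def
proof (intro conjI ballI)
  fix f assume f: "f \<in> L2 \<inter> bfs \<rho>"
  have "a * fourier f \<in> L2"
    using a f by (auto intro!: Linf_mult_L2 multipliers_Linf fourier_L2)
  then show "const_L0 c * W0 \<rho> a f = inverse_fourier (const_L0 c * a * fourier f)"
    by (simp add: W0_L2[OF a f] mult.assoc inverse_fourier_const_mult)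
qed (intro bounded_ops_const_mult W0_bounded_op a)

text \<open>The subspace on which \<open>W0\<close> is given by the Fourier formula is invariant;
  this is what makes \<open>W0\<close> multiplicative in the symbol.\<close>

lemma W0_L2_bfs:
  assumes "a \<in> multipliers \<rho>" "f \<in> L2 \<inter> bfs \<rho>"
  shows "W0 \<rho> a f \<in> L2 \<inter> bfs \<rho>"
proof
  show "W0 \<rho> a f \<in> L2"
    unfolding W0_L2[OF assms]
    using assms by (intro inverse_fourier_L2 Linf_mult_L2 multipliers_Linf fourier_L2) auto
  show "W0 \<rho> a f \<in> bfs \<rho>"
    using bounded_opsD(2)[OF W0_bounded_op[OF assms(1)]] assms by blast
qed

lemma multiplier_op_mult:
  assumes a: "a \<in> multipliers \<rho>" and b: "b \<in> multipliers \<rho>"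
  shows "is_multiplier_op \<rho> (a * b) (W0 \<rho> a \<circ> W0 \<rho> b)"
  unfolding is_multiplier_op_def
proof (intro conjI ballI)
  fix f assume f: "f \<in> L2 \<inter> bfs \<rho>"
  have "b * fourier f \<in> L2" using b f by (auto intro!: Linf_mult_L2 multipliers_Linf fourier_L2)
  then show "(W0 \<rho> a \<circ> W0 \<rho> b) f = inverse_fourier (a * b * fourier f)"
    using W0_L2[OF a W0_L2_bfs[OF b f]] by (simp add: W0_L2[OF b f] fourier_inverse_fourier mult.assoc)
qed (intro bounded_ops_comp W0_bounded_op a b)

lemma mult_op_const_bounded: "mult_op \<rho> (const_L0 c) \<in> bounded_ops \<rho>"
proof -
  have "\<exists>C::real. \<forall>f\<in>bfs \<rho>. nrm (const_L0 c * f) \<le> ennreal C * nrm f"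
    by (rule exI[of _ "cmod c"]) (simp add: nrm_const_mult)
  then show ?thesis
    by (auto simp: bounded_ops_def mult_op_def bfs_const_mult bfs_add distrib_left mult.left_commute)
qed

lemma multiplier_op_const: "is_multiplier_op \<rho> (const_L0 c) (mult_op \<rho> (const_L0 c))"
  unfolding is_multiplier_op_def using mult_op_const_bounded
  by (auto simp: mult_op_def inverse_fourier_const_mult fourier_L2 inverse_fourier_fourier)

lemma multipliers_add: "a \<in> multipliers \<rho> \<Longrightarrow> b \<in> multipliers \<rho> \<Longrightarrow> a + b \<in> multipliers \<rho>"
  by (meson multipliersI multiplier_op_add Linf_add multipliers_Linf)

lemma multipliers_const_mult: "a \<in> multipliers \<rho> \<Longrightarrow> const_L0 c * a \<in> multipliers \<rho>"
  by (meson multipliersI multiplier_op_const_mult Linf_mult const_L0_Linf multipliers_Linf)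

lemma multipliers_mult: "a \<in> multipliers \<rho> \<Longrightarrow> b \<in> multipliers \<rho> \<Longrightarrow> a * b \<in> multipliers \<rho>"
  by (meson multipliersI multiplier_op_mult Linf_mult multipliers_Linf)

lemma multipliers_const: "const_L0 c \<in> multipliers \<rho>"
  by (meson multipliersI multiplier_op_const const_L0_Linf)

lemma multipliers_uminus: "a \<in> multipliers \<rho> \<Longrightarrow> - a \<in> multipliers \<rho>"
  using multipliers_const_mult[of a "-1"] by (simp add: const_L0_hom)

lemma multipliers_diff: "a \<in> multipliers \<rho> \<Longrightarrow> b \<in> multipliers \<rho> \<Longrightarrow> a - b \<in> multipliers \<rho>"
  using multipliers_add[OF _ multipliers_uminus, of a b] by simp

lemma W0_add: "a \<in> multipliers \<rho> \<Longrightarrow> b \<in> multipliers \<rho> \<Longrightarrow> W0 \<rho> (a + b) f = W0 \<rho> a f + W0 \<rho> b f"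
  by (simp add: W0_eqI[OF multiplier_op_add])

lemma W0_const_mult: "a \<in> multipliers \<rho> \<Longrightarrow> W0 \<rho> (const_L0 c * a) f = const_L0 c * W0 \<rho> a f"
  by (simp add: W0_eqI[OF multiplier_op_const_mult])

lemma W0_mult: "a \<in> multipliers \<rho> \<Longrightarrow> b \<in> multipliers \<rho> \<Longrightarrow> W0 \<rho> (a * b) f = W0 \<rho> a (W0 \<rho> b f)"
  by (simp add: W0_eqI[OF multiplier_op_mult])

lemma W0_diff: "a \<in> multipliers \<rho> \<Longrightarrow> b \<in> multipliers \<rho> \<Longrightarrow> W0 \<rho> (a - b) f = W0 \<rho> a f - W0 \<rho> b f"
  using W0_add[of "a - b" b f] multipliers_diff[of a b] by (simp add: algebra_simps)

abbreviation mnorm :: "L0 \<Rightarrow> ennreal" where "mnorm a \<equiv> op_norm \<rho> (W0 \<rho> a)"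

lemma mnorm_finite: "a \<in> multipliers \<rho> \<Longrightarrow> mnorm a < \<infinity>"
  by (rule op_norm_finite[OF W0_bounded_op])

lemma nrm_W0_le: "a \<in> multipliers \<rho> \<Longrightarrow> f \<in> bfs \<rho> \<Longrightarrow> nrm (W0 \<rho> a f) \<le> mnorm a * nrm f"
  by (rule nrm_op_le[OF W0_bounded_op])

lemma mnorm_add:
  assumes "a \<in> multipliers \<rho>" "b \<in> multipliers \<rho>"
  shows "mnorm (a + b) \<le> mnorm a + mnorm b"
proof (rule op_norm_le)
  fix f assume "f \<in> bfs \<rho>"
  then have "nrm (W0 \<rho> a f + W0 \<rho> b f) \<le> mnorm a * nrm f + mnorm b * nrm f"
    by (intro order_trans[OF nrm_add] add_mono nrm_W0_le assms)
  then show "nrm (W0 \<rho> (a + b) f) \<le> (mnorm a + mnorm b) * nrm f"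
    by (simp add: W0_add assms distrib_right)
qed

lemma mnorm_mult:
  assumes "a \<in> multipliers \<rho>" "b \<in> multipliers \<rho>"
  shows "mnorm (a * b) \<le> mnorm a * mnorm b"
proof (rule op_norm_le)
  fix f assume f: "f \<in> bfs \<rho>"
  have "nrm (W0 \<rho> a (W0 \<rho> b f)) \<le> mnorm a * (mnorm b * nrm f)"
    by (intro order_trans[OF nrm_W0_le] mult_left_mono nrm_W0_le assms f bounded_opsD(2)[OF W0_bounded_op]) simp
  then show "nrm (W0 \<rho> (a * b) f) \<le> mnorm a * mnorm b * nrm f"
    by (simp add: W0_mult assms mult.assoc)
qed

lemma mnorm_const_mult:
  assumes "a \<in> multipliers \<rho>"
  shows "mnorm (const_L0 c * a) \<le> ennreal (cmod c) * mnorm a"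
proof (rule op_norm_le)
  fix f assume "f \<in> bfs \<rho>"
  then have "ennreal (cmod c) * nrm (W0 \<rho> a f) \<le> ennreal (cmod c) * (mnorm a * nrm f)"
    by (intro mult_left_mono nrm_W0_le assms) auto
  then show "nrm (W0 \<rho> (const_L0 c * a) f) \<le> ennreal (cmod c) * mnorm a * nrm f"
    by (simp add: W0_const_mult assms nrm_const_mult mult.assoc)
qed

text \<open>Stated for arbitrary \<open>a\<close>, because a \<^locale>\<open>Metric_space\<close> is symmetric on the whole type.
  If \<open>a * fourier f \<notin> L2\<close>, then \<open>inverse_fourier\<close> returns a junk value, which linearity of the
  operator forces to be \<open>0\<close>.\<close>

lemma is_multiplier_op_uminus:
  assumes T: "is_multiplier_op \<rho> a T"
  shows "is_multiplier_op \<rho> (- a) (\<lambda>f. - T f)"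
  unfolding is_multiplier_op_def
proof (intro conjI ballI)
  have bo: "T \<in> bounded_ops \<rho>" using T by (simp add: is_multiplier_op_def)
  show "(\<lambda>f. - T f) \<in> bounded_ops \<rho>"
    using bounded_ops_const_mult[OF bo, of "-1"] by (simp add: const_L0_hom)
  \<comment> \<open>Off the range of \<open>fourier\<close> the predicate behind the choice is
    constantly false, so the junk value is the same for all such \<open>g\<close>.\<close>
  have junk: "inverse_fourier g = (SOME y. False)" if "g \<notin> L2" for g
  proof -
    have "(\<lambda>y. y \<in> L2 \<and> fourier y = g) = (\<lambda>_. False)" using that fourier_L2 by (auto simp: fun_eq_iff)
    then show ?thesis by (simp only: inverse_fourier_def inv_into_def)
  qed
  fix f assume f: "f \<in> L2 \<inter> bfs \<rho>"
  show "- T f = inverse_fourier (- a * fourier f)"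
  proof (cases "a * fourier f \<in> L2")
    case True
    then show ?thesis
      using inverse_fourier_const_mult[OF True, of "-1"] T f by (simp add: const_L0_hom is_multiplier_op_def)
  next
    case False
    have nL2: "const_L0 c * (a * fourier f) \<notin> L2" if "c \<noteq> 0" for c
      using L2_const_mult[of "const_L0 c * (a * fourier f)" "inverse c"] const_L0_inverse_mult[OF that] False by auto
    \<comment> \<open>Both \<open>f\<close> and its double receive the same junk value, so
      \<open>T f\<close> equals twice \<open>T f\<close>.\<close>
    have "const_L0 2 * f \<in> L2 \<inter> bfs \<rho>" using f by (auto intro: L2_const_mult bfs_const_mult)
    then have "T (const_L0 2 * f) = inverse_fourier (a * fourier (const_L0 2 * f))"
      using T unfolding is_multiplier_op_def by blast
    then have "const_L0 2 * T f = inverse_fourier (const_L0 2 * (a * fourier f))"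
      using f by (simp add: bounded_opsD(4)[OF bo] fourier_const_mult mult.left_commute)
    also have "\<dots> = (SOME y. False)" by (rule junk[OF nL2]) simp
    also have "\<dots> = T f" using T f junk[OF False] by (simp add: is_multiplier_op_def)
    finally have "T f = 0"
      using const_L0_hom(1)[of 1 1] by (simp add: const_L0_hom(5) distrib_right)
    moreover have "inverse_fourier (- a * fourier f) = (SOME y. False)"
      using junk[OF nL2[of "-1"]] by (simp add: const_L0_hom)
    ultimately show ?thesis using T f junk[OF False] by (simp add: is_multiplier_op_def)
  qed
qed

lemma mnorm_uminus: "mnorm (- a) = mnorm a"
proof (cases "\<exists>T. is_multiplier_op \<rho> a T")
  case True
  then obtain T where T: "is_multiplier_op \<rho> a T" ..
  have "op_norm \<rho> (\<lambda>f. - T f) = op_norm \<rho> T" by (simp add: op_norm_def nrm_uminus)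
  then show ?thesis by (simp add: W0_eqI[OF T] W0_eqI[OF is_multiplier_op_uminus[OF T]])
next
  case False
  \<comment> \<open>If neither symbol has an operator, both definite descriptions are taken of the
    same empty predicate and hence agree.\<close>
  moreover have "\<not> is_multiplier_op \<rho> (- a) T" for T
    using is_multiplier_op_uminus[of "- a" T] False by auto
  ultimately have "is_multiplier_op \<rho> (- a) = is_multiplier_op \<rho> a" by (auto simp: fun_eq_iff)
  then show ?thesis by (simp add: W0_def)
qed

end

section \<open>The transform of an interval indicator\<close>

text \<open>Where this vanishes is used twice: for \<open>r = 1\<close> only on a null set, so one
  test function detects every nonzero symbol; for \<open>r = m * pi\<close> at all nonzero integers,
  which is orthogonality of the integer waves.\<close>

lemma ft_indicator:
  assumes r: "0 \<le> r" and x: "x \<noteq> 0"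
  shows "ft (indicator {-r..r}) x = of_real (2 * sin (r * x) / x)"
proof -
  let ?F = "\<lambda>t::real. exp (\<i> * of_real t * of_real x) / (\<i> * of_real x)"
  have "ft (indicator {-r..r}) x = (\<integral>t. indicator {-r..r} t *\<^sub>R exp (\<i> * of_real t * of_real x) \<partial>lborel)"
    unfolding ft_def by (intro Bochner_Integration.integral_cong) (auto simp: indicator_def)
  also have "\<dots> = ?F r - ?F (- r)"
  proof (rule integral_FTC_atLeastAtMost)
    show "(?F has_vector_derivative exp (\<i> * of_real t * of_real x)) (at t within {- r..r})" for t
    proof -
      have "((\<lambda>z. exp (\<i> * z * of_real x) / (\<i> * of_real x)) has_field_derivative exp (\<i> * of_real t * of_real x)) (at (of_real t))"
        using x by (auto intro!: derivative_eq_intros)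
      from has_vector_derivative_real_field[OF this] show ?thesis by (simp add: o_def)
    qed
    show "continuous_on {- r..r} (\<lambda>t. exp (\<i> * complex_of_real t * of_real x))"
      by (intro continuous_intros)
  qed (use r in simp)
  also have "\<dots> = (cis (r * x) - cis (- (r * x))) / (\<i> * of_real x)"
    by (simp add: cis_conv_exp diff_divide_distrib mult.assoc)
  also have "cis (r * x) - cis (- (r * x)) = \<i> * of_real (2 * sin (r * x))"
    by (simp add: complex_eq_iff)
  also have "\<i> * of_real (2 * sin (r * x)) / (\<i> * of_real x) = of_real (2 * sin (r * x) / x)"
    by simp
  finally show ?thesis .
qed

lemma AE_ft_indicator_nonzero: "AE x in lborel. ft (indicator {-1..1}) x \<noteq> 0"
proof -
  have "{x::real. sin x = 0} \<subseteq> range (\<lambda>i::int. of_int i * pi)"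
    by (auto simp: sin_zero_iff_int2)
  then have "countable {x::real. sin x = 0}" by (rule countable_subset) simp
  then have "{x::real. sin x = 0} \<in> null_sets lborel" by (rule countable_imp_null_set_lborel)
  from AE_not_in[OF this] show ?thesis
  proof eventually_elim
    case (elim x)
    then have "x \<noteq> 0" "sin x \<noteq> 0" by auto
    then show ?case using ft_indicator[of 1 x] by simp
  qed
qed

lemma integrable_indicator_Icc: "integrable lborel (indicator {a..b::real} :: real \<Rightarrow> complex)"
  using integrable_trunc[OF square_integrable_indicator[of a b], of "max \<bar>a\<bar> \<bar>b\<bar>"]
  by (rule Bochner_Integration.integrable_cong[THEN iffD1, rotated 2]) (auto simp: trunc_def indicator_def)

section \<open>The multiplier norm as a metric and closures of subalgebras\<close>

context separable_bfs
begin

text \<open>A single test function suffices: the product of the symbol with its transform is 0, and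
  that transform is nonzero almost everywhere.\<close>

lemma mnorm_eq_0:
  assumes a: "a \<in> multipliers \<rho>" and "mnorm a = 0"
  shows "a = 0"
proof -
  have "nrm (W0 \<rho> a (interval_ind 1)) = 0" using nrm_W0_le[OF a interval_ind_bfs, of 1] assms(2) by simp
  then have "W0 \<rho> a (interval_ind 1) = 0" by (simp add: nrm_0_iff)
  then have "inverse_fourier (a * fourier (interval_ind 1)) = 0"
    using W0_L2[OF a] interval_ind_L2[of 1] interval_ind_bfs[of 1] by simp
  then have "a * fourier (interval_ind 1) = fourier 0"
    using fourier_inverse_fourier[OF Linf_mult_L2[OF multipliers_Linf[OF a] fourier_L2[OF interval_ind_L2[of 1]]]] by simp
  also have "fourier 0 = 0" using fourier_const_mult[OF interval_ind_L2[of 1], of 0] by (simp add: const_L0_hom(4))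
  finally have 0: "a * fourier (interval_ind 1) = 0" .
  have si: "square_integrable (brep (interval_ind 1))" using interval_ind_L2 by (simp add: L2_iff)
  have "AE x in lborel. brep a x = brep 0 x"
    using brep_times[of a "fourier (interval_ind 1)"] brep_0 brep_fourier[OF interval_ind_L2[of 1]]
      plancherel_cong_AE[OF si square_integrable_indicator brep_interval_ind]
      plancherel_eq_ft[OF square_integrable_indicator integrable_indicator_Icc, of "-1" 1]
      AE_ft_indicator_nonzero
    unfolding 0 by eventually_elim simp
  then show ?thesis by (simp add: L0_eq_iff[of a 0])
qed

sublocale mult: Metric_space "multipliers \<rho>" "\<lambda>a b. enn2real (mnorm (a - b))"
proof
  show "enn2real (mnorm (a - b)) = enn2real (mnorm (b - a))" for a b
    using mnorm_uminus[of "a - b"] by simp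
  show "(enn2real (mnorm (a - b)) = 0) = (a = b)" if "a \<in> multipliers \<rho>" "b \<in> multipliers \<rho>" for a b
  proof
    assume "enn2real (mnorm (a - b)) = 0"
    then have "mnorm (a - b) = 0" using mnorm_finite[OF multipliers_diff[OF that]] by (auto simp: enn2real_eq_0_iff)
    then show "a = b" using mnorm_eq_0[OF multipliers_diff[OF that]] by simp
  next
    assume "a = b"
    have "mnorm (a - b) = 0"
    proof -
      have "W0 \<rho> (a - b) f = 0" for f using W0_diff[OF that] \<open>a = b\<close> by simp
      then have "mnorm (a - b) \<le> 0" using nrm_0_iff[of 0] by (intro op_norm_le) simp
      then show ?thesis by simp
    qed
    then show "enn2real (mnorm (a - b)) = 0" by simp
  qed
  show "enn2real (mnorm (a - c)) \<le> enn2real (mnorm (a - b)) + enn2real (mnorm (b - c))"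
    if "a \<in> multipliers \<rho>" "b \<in> multipliers \<rho>" "c \<in> multipliers \<rho>" for a b c
  proof -
    have "mnorm (a - c) \<le> mnorm (a - b) + mnorm (b - c)"
      using mnorm_add[of "a - b" "b - c"] multipliers_diff that by simp
    then show ?thesis
      using enn2real_mono[of "mnorm (a - c)" "mnorm (a - b) + mnorm (b - c)"]
        mnorm_finite[OF multipliers_diff[OF that(1,2)]] mnorm_finite[OF multipliers_diff[OF that(2,3)]]
      by (simp add: enn2real_plus)
  qed
qed simp

lemma multiplier_topology_eq: "multiplier_topology \<rho> = mult.mtopology"
  by (simp add: multiplier_topology_def norm_topology_def)

lemma mult_closure_iff:
  assumes "B \<subseteq> multipliers \<rho>"
  shows "a \<in> mult.mtopology closure_of B \<longleftrightarrow>
    a \<in> multipliers \<rho> \<and> (\<forall>e>0. \<exists>b\<in>B. mnorm (a - b) < ennreal e)"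
proof -
  have "enn2real (mnorm (a - b)) < e \<longleftrightarrow> mnorm (a - b) < ennreal e"
    if "a \<in> multipliers \<rho>" "b \<in> multipliers \<rho>" "0 < e" for a b e
    using mnorm_finite[OF multipliers_diff[OF that(1,2)]] that(3)
    by (cases "mnorm (a - b)") (auto simp: ennreal_less_iff)
  then show ?thesis
    unfolding mult.metric_closure_of mult.in_mball mem_Collect_eq using assms by (metis subsetD)
qed

text \<open>Continuity of the operations for a submultiplicative norm; products rest on
  \<open>f * g - a * b = f * (g - b) + (f - a) * b\<close>.\<close>

lemma closure_complex_subalgebra:
  assumes B: "B \<subseteq> multipliers \<rho>" and alg: "complex_subalgebra B"
  shows "complex_subalgebra (mult.mtopology closure_of B)"
  unfolding complex_subalgebra_def
proof (intro conjI ballI allI)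
  let ?A = "mult.mtopology closure_of B"
  note iff = mult_closure_iff[OF B]
  show "0 \<in> ?A"
    using closure_of_subset[of B mult.mtopology] B alg by (auto simp: complex_subalgebra_def)
  fix f assume f: "f \<in> ?A"
  then have fM: "f \<in> multipliers \<rho>" by (simp add: iff)
  {
    fix c
    have "\<exists>b\<in>B. mnorm (const_L0 c * f - b) < ennreal e" if e: "0 < e" for e
    proof -
      have "0 < e / (cmod c + 1)" using e by (simp add: add_nonneg_pos)
      then obtain b where b: "b \<in> B" "mnorm (f - b) < ennreal (e / (cmod c + 1))"
        using f iff by blast
      have bM: "b \<in> multipliers \<rho>" using b B by auto
      have "mnorm (const_L0 c * f - const_L0 c * b) \<le> ennreal (cmod c) * mnorm (f - b)"
        using mnorm_const_mult[OF multipliers_diff[OF fM bM]] by (simp add: right_diff_distrib)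
      also have "\<dots> \<le> ennreal (cmod c) * ennreal (e / (cmod c + 1))" using b by (intro mult_left_mono) auto
      also have "\<dots> = ennreal (cmod c * (e / (cmod c + 1)))" using e by (intro ennreal_mult[symmetric]) auto
      also have "\<dots> < ennreal e"
      proof -
        have "0 < cmod c + 1" by (simp add: add_nonneg_pos)
        then have "cmod c * (e / (cmod c + 1)) < e" using e by (simp add: field_simps)
        then show ?thesis using e by (simp add: ennreal_less_iff)
      qed
      finally show ?thesis using b alg by (auto simp: complex_subalgebra_def)
    qed
    then show "const_L0 c * f \<in> ?A" using multipliers_const_mult[OF fM] iff by blast
  }
  fix g assume g: "g \<in> ?A"
  then have gM: "g \<in> multipliers \<rho>" by (simp add: iff)
  have "\<exists>b\<in>B. mnorm (f + g - b) < ennreal e" if e: "0 < e" for e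
  proof -
    obtain a b where ab: "a \<in> B" "mnorm (f - a) < ennreal (e / 2)" "b \<in> B" "mnorm (g - b) < ennreal (e / 2)"
      using f g iff e by (meson half_gt_zero)
    have M: "a \<in> multipliers \<rho>" "b \<in> multipliers \<rho>" using ab B by auto
    have "mnorm (f + g - (a + b)) \<le> mnorm (f - a) + mnorm (g - b)"
      using mnorm_add[OF multipliers_diff[OF fM M(1)] multipliers_diff[OF gM M(2)]] by (simp add: algebra_simps)
    also have "\<dots> < ennreal (e / 2) + ennreal (e / 2)" by (rule add_strict_mono[OF ab(2,4)])
    also have "\<dots> = ennreal e" using e by (simp flip: ennreal_plus)
    finally show ?thesis using ab alg by (auto simp: complex_subalgebra_def)
  qed
  then show "f + g \<in> ?A" using multipliers_add[OF fM gM] iff by blast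
  have "\<exists>b\<in>B. mnorm (f * g - b) < ennreal e" if e: "0 < e" for e
  proof -
    \<comment> \<open>\<open>b\<close> is chosen before \<open>a\<close>, because the tolerance for
      \<open>a\<close> involves the norm of \<open>b\<close>. The \<open>+ 1\<close> keeps the
      denominators positive.\<close>
    obtain F where F: "0 \<le> F" "mnorm f = ennreal F" using mnorm_finite[OF fM] by (cases "mnorm f") auto
    have "0 < min 1 (e / (2 * (F + 1)))" using e F by simp
    then obtain b where b: "b \<in> B" "mnorm (g - b) < ennreal (min 1 (e / (2 * (F + 1))))" using g iff by blast
    have bM: "b \<in> multipliers \<rho>" using b B by auto
    obtain G where G: "0 \<le> G" "mnorm b = ennreal G" using mnorm_finite[OF bM] by (cases "mnorm b") auto
    have "0 < e / (2 * (G + 1))" using e G by simp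
    then obtain a where a: "a \<in> B" "mnorm (f - a) < ennreal (e / (2 * (G + 1)))" using f iff by blast
    have aM: "a \<in> multipliers \<rho>" using a B by auto
    have "mnorm (f * g - a * b) = mnorm (f * (g - b) + (f - a) * b)" by (simp add: algebra_simps)
    also have "\<dots> \<le> mnorm (f * (g - b)) + mnorm ((f - a) * b)"
      by (intro mnorm_add multipliers_mult multipliers_diff fM gM aM bM)
    also have "\<dots> \<le> mnorm f * mnorm (g - b) + mnorm (f - a) * mnorm b"
      by (intro add_mono mnorm_mult multipliers_diff fM gM aM bM)
    also have "\<dots> \<le> ennreal F * ennreal (e / (2 * (F + 1))) + ennreal (e / (2 * (G + 1))) * ennreal G"
      unfolding F(2) G(2)
      using a(2) order_trans[OF less_imp_le[OF b(2)] ennreal_leI[OF min.cobounded2]]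
      by (intro add_mono mult_left_mono mult_right_mono) auto
    also have "\<dots> = ennreal (F * (e / (2 * (F + 1))) + e / (2 * (G + 1)) * G)"
    proof -
      have "ennreal F * ennreal u + ennreal v * ennreal G = ennreal (F * u + v * G)" if "0 \<le> u" "0 \<le> v" for u v
        using F G that by (simp add: ennreal_mult)
      then show ?thesis using F G e by simp
    qed
    also have "\<dots> < ennreal e"
    proof -
      have "F * (e / (2 * (F + 1))) < e / 2" "e / (2 * (G + 1)) * G < e / 2"
        using F G e by (auto simp: field_simps)
      then have "F * (e / (2 * (F + 1))) + e / (2 * (G + 1)) * G < e" by linarith
      with e show ?thesis by (rule ennreal_lessI)
    qed
    finally show ?thesis using a b alg by (auto simp: complex_subalgebra_def)
  qed
  then show "f * g \<in> ?A" using multipliers_mult[OF fM gM] iff by blast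
qed

text \<open>The closure of \<open>B\<close> is itself one of the closed subalgebras intersected in
  \<open>SO_diamond\<close>, so the generators decide.\<close>

lemma SO_diamond_subset_closure:
  assumes B: "B \<subseteq> multipliers \<rho>" "complex_subalgebra B"
    and gen: "\<And>p a. a \<in> SO3 p \<Longrightarrow> abs_L0 (a \<circ> Some) \<in> multipliers \<rho> \<Longrightarrow> abs_L0 (a \<circ> Some) \<in> B"
  shows "SO_diamond \<rho> \<subseteq> mult.mtopology closure_of B"
proof -
  have "SO_mult \<rho> p \<subseteq> mult.mtopology closure_of B" for p
    unfolding SO_mult_def multiplier_topology_eq
    by (subst closure_of_restrict) (use gen in \<open>auto intro!: closure_of_mono\<close>)
  moreover have "complex_subalgebra (mult.mtopology closure_of B)" by (rule closure_complex_subalgebra[OF B])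
  ultimately show ?thesis unfolding SO_diamond_def multiplier_topology_eq
    by (intro Inter_lower) auto
qed

end

section \<open>Slowly oscillating symbols\<close>

text \<open>This is all that is needed of slow oscillation at \<open>p\<close>: for finite \<open>p\<close> it holds by continuity at
  \<open>\<infinity>\<close>, and for \<open>p = \<infinity>\<close> by the mean value theorem.\<close>

definition slowly_varying :: "L0 set" where
  "slowly_varying = {b. \<exists>\<beta>. \<beta> \<in> borel_measurable borel \<and> (\<exists>M. \<forall>x. cmod (\<beta> x) \<le> M) \<and>
     (AE x in lborel. brep b x = \<beta> x) \<and> (\<forall>x. (\<lambda>n. \<beta> (x + real n) - \<beta> (real n)) \<longlonglongrightarrow> 0)}"

lemma slowly_varyingI:
  "\<beta> \<in> borel_measurable borel \<Longrightarrow> (\<And>x. cmod (\<beta> x) \<le> M) \<Longrightarrow> AE x in lborel. brep b x = \<beta> x \<Longrightarrow>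
   (\<And>x. (\<lambda>n. \<beta> (x + real n) - \<beta> (real n)) \<longlonglongrightarrow> 0) \<Longrightarrow> b \<in> slowly_varying"
  unfolding slowly_varying_def by blast

lemma slowly_varying_const: "const_L0 c \<in> slowly_varying"
  by (rule slowly_varyingI[of "\<lambda>_. c" "cmod c"]) (auto intro: brep_const)

lemma slowly_varying_add:
  assumes "a \<in> slowly_varying" "b \<in> slowly_varying"
  shows "a + b \<in> slowly_varying"
proof -
  obtain \<alpha> \<beta> M N where
    [measurable]: "\<alpha> \<in> borel_measurable borel" "\<beta> \<in> borel_measurable borel" and
    M: "\<And>x. cmod (\<alpha> x) \<le> M" "\<And>x. cmod (\<beta> x) \<le> N" and
    ae: "AE x in lborel. brep a x = \<alpha> x" "AE x in lborel. brep b x = \<beta> x" and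
    lim: "\<And>x. (\<lambda>n. \<alpha> (x + real n) - \<alpha> (real n)) \<longlonglongrightarrow> 0" "\<And>x. (\<lambda>n. \<beta> (x + real n) - \<beta> (real n)) \<longlonglongrightarrow> 0"
    using assms unfolding slowly_varying_def by auto
  show ?thesis
  proof (rule slowly_varyingI)
    show "cmod (\<alpha> x + \<beta> x) \<le> M + N" for x using M[of x] by (intro norm_triangle_mono)
    show "AE x in lborel. brep (a + b) x = \<alpha> x + \<beta> x"
      using ae brep_plus[of a b] by eventually_elim simp
    show "(\<lambda>n. \<alpha> (x + real n) + \<beta> (x + real n) - (\<alpha> (real n) + \<beta> (real n))) \<longlonglongrightarrow> 0" for x
      using tendsto_add[OF lim(1)[of x] lim(2)[of x]] by (simp add: algebra_simps)
  qed simp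
qed

text \<open>Inserting \<open>alpha(n) * beta(x + n)\<close> writes the difference as two products of
  a null sequence with a bounded one.\<close>

lemma slowly_varying_mult:
  assumes "a \<in> slowly_varying" "b \<in> slowly_varying"
  shows "a * b \<in> slowly_varying"
proof -
  obtain \<alpha> \<beta> M N where
    [measurable]: "\<alpha> \<in> borel_measurable borel" "\<beta> \<in> borel_measurable borel" and
    M: "\<And>x. cmod (\<alpha> x) \<le> M" "\<And>x. cmod (\<beta> x) \<le> N" and
    ae: "AE x in lborel. brep a x = \<alpha> x" "AE x in lborel. brep b x = \<beta> x" and
    lim: "\<And>x. (\<lambda>n. \<alpha> (x + real n) - \<alpha> (real n)) \<longlonglongrightarrow> 0" "\<And>x. (\<lambda>n. \<beta> (x + real n) - \<beta> (real n)) \<longlonglongrightarrow> 0"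
    using assms unfolding slowly_varying_def by auto
  have M0: "0 \<le> M" using order_trans[OF norm_ge_zero M(1)] .
  show ?thesis
  proof (rule slowly_varyingI)
    show "cmod (\<alpha> x * \<beta> x) \<le> M * N" for x
      using M[of x] M0 unfolding norm_mult by (intro mult_mono) auto
    show "AE x in lborel. brep (a * b) x = \<alpha> x * \<beta> x"
      using ae brep_times[of a b] by eventually_elim simp
    show "(\<lambda>n. \<alpha> (x + real n) * \<beta> (x + real n) - \<alpha> (real n) * \<beta> (real n)) \<longlonglongrightarrow> 0" for x
    proof -
      have "Bfun (\<lambda>n. \<beta> (x + real n)) sequentially" by (rule BfunI[of _ N]) (simp add: M)
      moreover have "Bfun (\<lambda>n. \<alpha> (real n)) sequentially" by (rule BfunI[of _ M]) (simp add: M)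
      ultimately have "Zfun (\<lambda>n. (\<alpha> (x + real n) - \<alpha> (real n)) * \<beta> (x + real n) + \<alpha> (real n) * (\<beta> (x + real n) - \<beta> (real n))) sequentially"
        using lim[of x] unfolding tendsto_Zfun_iff
        by (intro Zfun_add bounded_bilinear.Zfun_prod_Bfun[OF bounded_bilinear_mult] bounded_bilinear.Bfun_prod_Zfun[OF bounded_bilinear_mult]) auto
      then show ?thesis unfolding tendsto_Zfun_iff by (simp add: algebra_simps)
    qed
  qed simp
qed

lemma SO3_differentiable:
  assumes "a \<in> SO3 p" "Some x \<noteq> p"
  shows "(a \<circ> Some) differentiable (at x)"
  using assms by (auto simp: SO3_def eval_nat_numeral)

lemma SO3_slowly_varying:
  assumes a: "a \<in> SO3 p"
  shows "abs_L0 (a \<circ> Some) \<in> slowly_varying"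
proof -
  let ?b = "a \<circ> Some"
  have aSO: "a \<in> SO p" using a by (simp add: SO3_def)
  have m: "?b \<in> borel_measurable borel"
  proof (rule borel_measurable_continuous_countable_exceptions)
    have "{x. Some x = p} \<subseteq> {the p}" by auto
    then show "countable {x. Some x = p}" by (rule countable_subset) simp
    show "continuous_on (- {x. Some x = p}) ?b"
      by (intro continuous_at_imp_continuous_on ballI differentiable_imp_continuous_within SO3_differentiable[OF a]) simp
  qed
  obtain M0 where M0: "\<And>y. y \<noteq> p \<Longrightarrow> cmod (a y) \<le> M0"
    using aSO unfolding SO_def bounded_iff by blast
  \<comment> \<open>The value at \<open>p\<close> itself is arbitrary, so it enters the bound
    separately.\<close>
  have bound: "cmod (?b x) \<le> max M0 (cmod (a p))" for x
    using M0[of "Some x"] by (cases "Some x = p") (auto simp: le_max_iff_disj)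
  show ?thesis
  proof (rule slowly_varyingI[OF m bound])
    show "AE x in lborel. brep (abs_L0 ?b) x = ?b x"
      by (rule AE_brep_abs[OF lebesgue_measurable_if_borel[OF m]])
    fix x :: real
    show "(\<lambda>n. ?b (x + real n) - ?b (real n)) \<longlonglongrightarrow> 0"
    proof (cases p)
      case (Some l)
      have cont: "continuous_map (subtopology Rdot (UNIV - {p})) euclidean a"
        using aSO by (simp add: SO_def)
      have top: "topspace (subtopology Rdot (UNIV - {p})) = UNIV - {p}"
        by (auto simp: Rdot_def UNIV_option_conv)
      \<comment> \<open>Neighbourhoods of \<open>None\<close> are complements of compact sets, which
        \<open>y + n\<close> eventually leaves; exceeding \<open>l\<close> keeps it off the
        exceptional point.\<close>
      have lim: "(\<lambda>n. ?b (y + real n)) \<longlonglongrightarrow> a None" for y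
      proof (rule topological_tendstoI)
        fix U assume U: "open U" "a None \<in> U"
        have "openin (subtopology Rdot (UNIV - {p})) {z \<in> topspace (subtopology Rdot (UNIV - {p})). a z \<in> U}"
          using cont U(1) unfolding continuous_map_def by auto
        then obtain V where V: "openin Rdot V" "{z \<in> UNIV - {p}. a z \<in> U} = V \<inter> (UNIV - {p})"
          unfolding top by (auto simp: openin_subtopology)
        have "None \<in> V" using V(2) U(2) Some by blast
        with V(1) obtain C where C: "compact C" "V = insert None (Some ` (UNIV - C))"
          unfolding Rdot_def openin_Alexandroff_compactification by auto
        obtain R where R: "\<And>z. z \<in> C \<Longrightarrow> \<bar>z\<bar> \<le> R"
          using compact_imp_bounded[OF C(1)] unfolding bounded_iff by auto
        have "\<forall>\<^sub>F n in sequentially. max R l < y + real n" by real_asymp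
        then show "\<forall>\<^sub>F n in sequentially. ?b (y + real n) \<in> U"
        proof eventually_elim
          case (elim n)
          then have "y + real n \<notin> C" using R[of "y + real n"] by auto
          then have "Some (y + real n) \<in> V \<inter> (UNIV - {p})" using C(2) elim Some by auto
          then show ?case using V(2) by auto
        qed
      qed
      show ?thesis using tendsto_diff[OF lim[of x] lim[of 0]] by simp
    next
      case None
      have D: "((\<lambda>t. t *\<^sub>R vector_derivative ?b (at t)) \<longlongrightarrow> 0) at_infinity"
        using a None unfolding SO3_def D_op_def[abs_def] by (force simp: D_op_def[abs_def])
      show ?thesis
      proof (rule tendstoI)
        fix e :: real assume e: "0 < e"
        \<comment> \<open>The two arguments are at distance \<open>|x|\<close>, so a derivative
          below \<open>d\<close> changes the value by less than \<open>e\<close>.\<close>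
        define d where "d = e / (\<bar>x\<bar> + 1)"
        have d: "0 < d" "d * \<bar>x\<bar> < e" using e by (auto simp: d_def field_simps add_nonneg_pos)
        obtain R where R: "\<And>t. R \<le> \<bar>t\<bar> \<Longrightarrow> norm (t *\<^sub>R vector_derivative ?b (at t)) < d"
          using tendstoD[OF D d(1)] unfolding eventually_at_infinity by (auto simp: dist_norm)
        have "\<forall>\<^sub>F n in sequentially. max R 1 + \<bar>x\<bar> \<le> real n" by real_asymp
        then show "\<forall>\<^sub>F n in sequentially. dist (?b (x + real n) - ?b (real n)) 0 < e"
        proof eventually_elim
          case (elim n)
          \<comment> \<open>A half-line is convex, as the mean value estimate requires. From 1 on,
            the bound on \<open>t\<close> times the derivative also bounds the derivative;
            \<open>real n\<close> exceeds the left end by \<open>|x|\<close>, so both arguments lie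
            in it.\<close>
          let ?S = "{max R 1..}"
          have "norm (?b (x + real n) - ?b (real n)) \<le> d * norm (x + real n - real n)"
          proof (rule differentiable_bound[where S = ?S])
            show "(?b has_derivative (\<lambda>h. h *\<^sub>R vector_derivative ?b (at t))) (at t within ?S)" if "t \<in> ?S" for t
              using SO3_differentiable[OF a, of t] None
              by (auto simp: vector_derivative_works has_vector_derivative_def intro: has_derivative_at_withinI)
            show "onorm (\<lambda>h. h *\<^sub>R vector_derivative ?b (at t)) \<le> d" if "t \<in> ?S" for t
            proof (rule onorm_le)
              fix h :: real
              have "norm (vector_derivative ?b (at t)) \<le> \<bar>t\<bar> * norm (vector_derivative ?b (at t))"
                using that mult_right_mono[of 1 "\<bar>t\<bar>" "norm (vector_derivative ?b (at t))"] by auto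
              also have "\<dots> \<le> d" using R[of t] that by auto
              finally show "norm (h *\<^sub>R vector_derivative ?b (at t)) \<le> d * norm h"
                by (simp add: mult.commute[of d] mult_left_mono)
            qed
          qed (use elim in auto)
          then show ?case using d(2) by (simp add: dist_norm)
        qed
      qed
    qed
  qed
qed

section \<open>Constants as slowly oscillating functions\<close>

lemma D_op_const: "D_op p (\<lambda>_. c) = (\<lambda>_. 0)"
  by (auto simp: D_op_def fun_eq_iff split: option.splits)

lemma D_op_funpow_const: "(D_op p ^^ k) (\<lambda>_. c) = (if k = 0 then (\<lambda>_. c) else (\<lambda>_. 0))"
  by (induction k) (auto simp: D_op_const)

text \<open>Places the unit, and with it all scalars, in \<open>SO_diamond\<close>; the inclusion
  from right to left in the theorem needs this.\<close>

lemma one_SO3: "(\<lambda>_. 1) \<in> SO3 p"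
proof -
  have osc0: "osc (\<lambda>_. 1) E = 0" for E
  proof -
    have "osc (\<lambda>_. 1) E \<le> 0" unfolding osc_def by (rule esssup_I) (auto simp: split_beta')
    then show ?thesis by simp
  qed
  have comp: "(\<lambda>_::real option. 1::complex) \<circ> Some = (\<lambda>_. 1)" by auto
  have "slowly_oscillating_at p (\<lambda>_. 1)"
    by (auto simp: slowly_oscillating_at_def osc0 split: option.splits)
  moreover have "bounded ((\<lambda>_::real option. 1::complex) ` (UNIV - {p}))"
    by (rule bounded_subset[of "{1}"]) auto
  ultimately have SO: "(\<lambda>_. 1) \<in> SO p" by (simp add: SO_def comp)
  have "Ck_on k S (\<lambda>_. c)" for k S c by (induction k arbitrary: c) auto
  moreover have "(\<Sum>j\<le>3. ennreal (1 / fact j) * esssup lebesgue (\<lambda>x. ennreal (cmod ((D_op p ^^ j) (\<lambda>_. 1) x)))) < \<infinity>"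
  proof -
    have le: "esssup lebesgue (\<lambda>x. ennreal (cmod ((D_op p ^^ j) (\<lambda>_. 1) x))) \<le> 1" for j
      by (rule esssup_I) (auto simp: D_op_funpow_const)
    have "(\<Sum>j\<le>3. ennreal (1 / fact j) * esssup lebesgue (\<lambda>x. ennreal (cmod ((D_op p ^^ j) (\<lambda>_. 1) x)))) \<le> (\<Sum>j\<le>(3::nat). ennreal (1 / fact j) * 1)"
      by (intro sum_mono mult_left_mono le) auto
    also have "\<dots> = ennreal (\<Sum>j\<le>(3::nat). 1 / fact j)" unfolding mult_1_right by (rule sum_ennreal) auto
    finally show ?thesis by (rule le_less_trans) simp
  qed
  ultimately show ?thesis unfolding SO3_def comp using SO by (auto simp: D_op_funpow_const D_op_const)
qed

section \<open>Means of orthogonal exponentials and approximation by constants\<close>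

text \<open>By orthogonality only the \<open>n\<close> diagonal terms survive in the square of the
  sum, each equal to the length \<open>2 * m * pi\<close>; dividing by \<open>n^2\<close> leaves the
  decay \<open>1/n\<close>.\<close>

lemma sqnorm_exponential_mean:
  fixes q :: "nat \<Rightarrow> nat"
  assumes q: "inj q" and m: "0 < (m::nat)"
  shows "sqnorm (\<lambda>x. indicator {- (real m * pi)..real m * pi} x * ((\<Sum>k<n. exp (\<i> * of_real x * of_real (- real (q k)))) / of_nat n))
    = ennreal (2 * real m * pi / real n)"
proof (cases "n = 0")
  \<comment> \<open>Both sides are 0, by division by zero.\<close>
  case True
  then show ?thesis by (simp add: sqnorm_def)
next
  case False
  define r where "r = real m * pi"
  have r: "0 \<le> r" by (simp add: r_def)
  let ?I = "indicator {-r..r} :: real \<Rightarrow> complex"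
  let ?e = "\<lambda>k x. exp (\<i> * complex_of_real x * complex_of_real k)"
  let ?w = "\<lambda>x. ?I x * ((\<Sum>k<n. ?e (- real (q k)) x) / of_nat n)"
  have I: "integrable lborel ?I" by (rule integrable_indicator_Icc)
  \<comment> \<open>The difference of two frequencies is an integer, so at half-length
    \<open>m * pi\<close> the sine is evaluated at an integer multiple of \<open>pi\<close>.\<close>
  have orth: "ft ?I (real (q j) - real (q k)) = (if j = k then of_real (2 * r) else 0)" for j k
  proof (cases "j = k")
    case True
    have "ft ?I 0 = complex_of_real (\<integral>x. indicator {-r..r} x \<partial>lborel)"
      unfolding ft_def by (subst integral_complex_of_real[symmetric], intro Bochner_Integration.integral_cong) (auto simp: indicator_def)
    also have "(\<integral>x. indicator {-r..r} x \<partial>lborel) = 2 * r" using r by simp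
    finally show ?thesis using True by simp
  next
    case False
    then have ne: "real (q j) - real (q k) \<noteq> 0" using q by (auto dest: injD)
    have "r * (real (q j) - real (q k)) = of_int (int m * (int (q j) - int (q k))) * pi"
      by (simp add: r_def algebra_simps)
    then have "sin (r * (real (q j) - real (q k))) = 0" by (metis sin_zero_iff_int2)
    then show ?thesis using ft_indicator[OF r ne] False by simp
  qed
  have sq: "of_real ((cmod (?w x))\<^sup>2) = (\<Sum>j<n. \<Sum>k<n. ?I x * ?e (real (q j) - real (q k)) x) / (of_nat n)\<^sup>2" for x
  proof -
    have "?e (- real (q k)) x * cnj (?e (- real (q j)) x) = ?e (real (q j) - real (q k)) x" for j k
      by (simp add: exp_cnj flip: exp_add) (simp add: algebra_simps)
    then have "(\<Sum>k<n. ?e (- real (q k)) x) * cnj (\<Sum>j<n. ?e (- real (q j)) x) = (\<Sum>j<n. \<Sum>k<n. ?e (real (q j) - real (q k)) x)"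
      by (subst sum.swap) (simp only: cnj_sum sum_product)
    moreover have "of_real ((cmod (?w x))\<^sup>2) = ?I x * ((\<Sum>k<n. ?e (- real (q k)) x) * cnj (\<Sum>j<n. ?e (- real (q j)) x)) / (of_nat n)\<^sup>2"
      unfolding complex_norm_square by (simp add: indicator_def power2_eq_square del: cnj_sum)
    ultimately show ?thesis by (simp add: sum_distrib_left)
  qed
  have int: "integrable lborel (\<lambda>x. complex_of_real ((cmod (?w x))\<^sup>2))"
    unfolding sq by (intro integrable_divide Bochner_Integration.integrable_sum integrable_ft_integrand I)
  have "(\<integral>x. complex_of_real ((cmod (?w x))\<^sup>2) \<partial>lborel) = (\<Sum>j<n. \<Sum>k<n. ft ?I (real (q j) - real (q k))) / (of_nat n)\<^sup>2"
    unfolding sq ft_def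
    by (simp only: integral_divide_zero Bochner_Integration.integral_sum integrable_ft_integrand[OF I] Bochner_Integration.integrable_sum)
  also have "\<dots> = (\<Sum>j<n. of_real (2 * r)) / (of_nat n)\<^sup>2"
    unfolding orth by (simp add: sum.delta if_distrib cong: if_cong)
  also have "\<dots> = complex_of_real (2 * r / real n)"
    using False by (simp add: power2_eq_square)
  finally have "complex_of_real (\<integral>x. (cmod (?w x))\<^sup>2 \<partial>lborel) = complex_of_real (2 * r / real n)"
    unfolding integral_complex_of_real .
  then have "(\<integral>x. (cmod (?w x))\<^sup>2 \<partial>lborel) = 2 * r / real n" by (simp only: of_real_eq_iff)
  moreover have "sqnorm ?w = ennreal (\<integral>x. (cmod (?w x))\<^sup>2 \<partial>lborel)"
    unfolding sqnorm_def
    using integrable_bounded_linear[OF bounded_linear_Re int]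
    by (intro nn_integral_eq_integral) auto
  ultimately show ?thesis by (simp add: r_def mult.assoc)
qed

lemma le_ennreal_if_power2_le:
  assumes "X\<^sup>2 \<le> ennreal (y\<^sup>2)" "0 \<le> y"
  shows "X \<le> ennreal y"
proof (cases X)
  case (real x)
  then have "x\<^sup>2 \<le> y\<^sup>2" using assms by (simp add: ennreal_power ennreal_le_iff)
  then have "x \<le> y" using assms(2) by (rule power2_le_imp_le)
  then show ?thesis using real by (simp add: ennreal_leI)
qed (use assms in \<open>simp add: top_power_ennreal top_unique\<close>)

text \<open>The constants form a complete, hence closed, subspace of L1 of the interval:
  approximating constants are Cauchy, because their distance is the L1 distance divided by the
  length \<open>2 * r\<close>.\<close>

lemma AE_const_on_interval:
  fixes g :: "real \<Rightarrow> complex"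
  assumes [measurable]: "g \<in> borel_measurable borel" and r: "0 < r"
    and approx: "\<And>e::real. 0 < e \<Longrightarrow> \<exists>c. (\<integral>\<^sup>+x. ennreal (cmod (g x - c)) * indicator {-r..r} x \<partial>lborel) \<le> ennreal e"
  shows "\<exists>c. AE x in lborel. x \<in> {-r..r} \<longrightarrow> g x = c"
proof -
  let ?I = "\<lambda>c. (\<integral>\<^sup>+x. ennreal (cmod (g x - c)) * indicator {-r..r} x \<partial>lborel)"
  have Ile: "?I c \<le> ?I d + ennreal (cmod (c - d) * (2 * r))" for c d
  proof -
    have "?I c \<le> (\<integral>\<^sup>+x. ennreal (cmod (g x - d)) * indicator {-r..r} x + ennreal (cmod (c - d)) * indicator {-r..r} x \<partial>lborel)"
    proof (rule nn_integral_mono)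
      fix x
      have "cmod (g x - c) \<le> cmod (g x - d) + cmod (c - d)"
        using norm_triangle_ineq4[of "g x - d" "c - d"] by simp
      then have "ennreal (cmod (g x - c)) \<le> ennreal (cmod (g x - d)) + ennreal (cmod (c - d))"
        by (simp flip: ennreal_plus add: ennreal_leI)
      then show "ennreal (cmod (g x - c)) * indicator {-r..r} x \<le> ennreal (cmod (g x - d)) * indicator {-r..r} x + ennreal (cmod (c - d)) * indicator {-r..r} x"
        unfolding distrib_right[symmetric] by (rule mult_right_mono) simp
    qed
    also have "\<dots> = ?I d + ennreal (cmod (c - d)) * ennreal (2 * r)"
      using r by (subst nn_integral_add) (auto simp: nn_integral_cmult)
    finally show ?thesis using r by (simp add: ennreal_mult)
  qed
  have dist_le: "ennreal (cmod (c - d) * (2 * r)) \<le> ?I c + ?I d" for c d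
  proof -
    have "ennreal (cmod (c - d) * (2 * r)) = (\<integral>\<^sup>+x. ennreal (cmod (c - d)) * indicator {-r..r} x \<partial>lborel)"
      using r by (simp add: nn_integral_cmult ennreal_mult)
    also have "\<dots> \<le> (\<integral>\<^sup>+x. ennreal (cmod (g x - c)) * indicator {-r..r} x + ennreal (cmod (g x - d)) * indicator {-r..r} x \<partial>lborel)"
    proof (rule nn_integral_mono)
      fix x
      have "cmod (c - d) \<le> cmod (g x - c) + cmod (g x - d)"
        using norm_triangle_ineq4[of "g x - d" "g x - c"] by simp
      then have "ennreal (cmod (c - d)) \<le> ennreal (cmod (g x - c)) + ennreal (cmod (g x - d))"
        by (simp flip: ennreal_plus add: ennreal_leI)
      then show "ennreal (cmod (c - d)) * indicator {-r..r} x \<le> ennreal (cmod (g x - c)) * indicator {-r..r} x + ennreal (cmod (g x - d)) * indicator {-r..r} x"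
        unfolding distrib_right[symmetric] by (rule mult_right_mono) simp
    qed
    also have "\<dots> = ?I c + ?I d" by (subst nn_integral_add) auto
    finally show ?thesis .
  qed
  obtain c where c: "\<And>j::nat. ?I (c j) \<le> ennreal (1 / real (Suc j))"
    using approx[of "1 / real (Suc j)" for j] by (metis zero_less_divide_iff zero_less_one of_nat_0_less_iff zero_less_Suc)
  have c_dist: "cmod (c j - c k) * (2 * r) \<le> 1 / real (Suc j) + 1 / real (Suc k)" for j k
  proof -
    have "ennreal (cmod (c j - c k) * (2 * r)) \<le> ennreal (1 / real (Suc j)) + ennreal (1 / real (Suc k))"
      by (rule order_trans[OF dist_le add_mono[OF c c]])
    also have "\<dots> = ennreal (1 / real (Suc j) + 1 / real (Suc k))" by (simp flip: ennreal_plus)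
    finally show ?thesis by (subst (asm) ennreal_le_iff) auto
  qed
  have "Cauchy c"
  proof (rule metric_CauchyI)
    fix e :: real assume e: "0 < e"
    obtain N where N: "1 / real (Suc N) < e * r" using e r by (meson mult_pos_pos nat_approx_posE)
    have "dist (c j) (c k) < e" if "j \<ge> N" "k \<ge> N" for j k
    proof -
      have "1 / real (Suc j) \<le> 1 / real (Suc N)" "1 / real (Suc k) \<le> 1 / real (Suc N)"
        using that by (auto intro!: divide_left_mono)
      with c_dist[of j k] N have "cmod (c j - c k) * (2 * r) < e * (2 * r)" by linarith
      then show ?thesis using r by (simp add: dist_norm)
    qed
    then show "\<exists>N. \<forall>j\<ge>N. \<forall>k\<ge>N. dist (c j) (c k) < e" by blast
  qed
  then obtain l where l: "c \<longlonglongrightarrow> l" using Cauchy_convergent convergent_def by blast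
  have "?I l \<le> ennreal (1 / real (Suc j) + cmod (l - c j) * (2 * r))" for j
    using order_trans[OF Ile[of l "c j"] add_right_mono[OF c[of j]]] r by (simp add: ennreal_plus)
  moreover have "(\<lambda>j. ennreal (1 / real (Suc j) + cmod (l - c j) * (2 * r))) \<longlonglongrightarrow> ennreal (0 + cmod (l - l) * (2 * r))"
    by (intro tendsto_ennrealI tendsto_intros l LIMSEQ_Suc[OF lim_inverse_n'])
  ultimately have "?I l \<le> ennreal (0 + cmod (l - l) * (2 * r))"
    by (intro tendsto_lowerbound[where F=sequentially]) auto
  then have "?I l = 0" by simp
  then have "AE x in lborel. ennreal (cmod (g x - l)) * indicator {-r..r} x = 0"
    by (subst (asm) nn_integral_0_iff_AE) auto
  then have "AE x in lborel. x \<in> {-r..r} \<longrightarrow> g x = l"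
    by eventually_elim (auto simp: indicator_def ennreal_eq_0_iff split: if_splits)
  then show ?thesis ..
qed

section \<open>Calkin classes and compact operators on modulated indicators\<close>

context separable_bfs
begin

lemma slowly_varying_multipliers_subalgebra: "complex_subalgebra (multipliers \<rho> \<inter> slowly_varying)"
  unfolding complex_subalgebra_def
proof (intro conjI ballI allI)
  show "0 \<in> multipliers \<rho> \<inter> slowly_varying"
    using slowly_varying_const[of 0] multipliers_const[of 0] by (simp add: const_L0_hom(4))
qed (simp_all add: slowly_varying_add slowly_varying_mult slowly_varying_const
      multipliers_add multipliers_mult multipliers_const_mult)

lemma SO_diamond_approx:
  assumes b: "b \<in> SO_diamond \<rho>"
  shows "b \<in> multipliers \<rho> \<and> (\<forall>e>0. \<exists>b'\<in>multipliers \<rho> \<inter> slowly_varying. mnorm (b - b') < ennreal e)"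
proof -
  have "SO_diamond \<rho> \<subseteq> mult.mtopology closure_of (multipliers \<rho> \<inter> slowly_varying)"
    by (rule SO_diamond_subset_closure)
      (auto intro: slowly_varying_multipliers_subalgebra SO3_slowly_varying)
  then show ?thesis using b mult_closure_iff[of "multipliers \<rho> \<inter> slowly_varying" b] by blast
qed

lemma const_SO_diamond: "const_L0 c \<in> SO_diamond \<rho>"
  unfolding SO_diamond_def
proof (rule InterI)
  fix A assume A: "A \<in> {A. complex_subalgebra A \<and> closedin (multiplier_topology \<rho>) A \<and> (\<Union>p. SO_mult \<rho> p) \<subseteq> A}"
  have "1 \<in> (\<lambda>a. abs_L0 (a \<circ> Some)) ` SO3 None"
    using one_SO3[of None] by (intro image_eqI[of _ _ "\<lambda>_. 1"]) (auto simp: one_L0_def o_def)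
  moreover have "1 \<in> multipliers \<rho>" using multipliers_const[of 1] by (simp add: const_L0_hom(5))
  ultimately have "1 \<in> SO_mult \<rho> None"
    unfolding SO_mult_def multiplier_topology_eq
    using closure_of_subset_Int[of mult.mtopology "(\<lambda>a. abs_L0 (a \<circ> Some)) ` SO3 None"] by auto
  then have "const_L0 c * 1 \<in> A" using A unfolding complex_subalgebra_def by blast
  then show "const_L0 c \<in> A" by simp
qed

lemma W0_const: "W0 \<rho> (const_L0 c) = mult_op \<rho> (const_L0 c)"
  by (rule W0_eqI[OF multiplier_op_const])

lemma zero_compact: "(\<lambda>_. 0) \<in> compact_ops \<rho>"
proof -
  have "(\<lambda>_. 0) = mult_op \<rho> (const_L0 0)" by (auto simp: mult_op_def const_L0_hom(4))
  then have bo: "(\<lambda>_. 0) \<in> bounded_ops \<rho>" using mult_op_const_bounded[of 0] by simp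
  have "(\<lambda>_. 0 :: L0) ` {f \<in> bfs \<rho>. nrm f \<le> 1} = {0}"
    using bfs_0 nrm_0_iff[of 0] by force
  moreover have "bfs.mtopology closure_of {0} = {0}"
    using closedin_Hausdorff_singleton[OF bfs.Hausdorff_space_mtopology, of 0] bfs_0 by (simp add: closure_of_closedin)
  moreover have "compactin bfs.mtopology {0}" using bfs_0 by simp
  ultimately show ?thesis using bo by (simp only: compact_ops_def bfs_topology_eq mem_Collect_eq)
qed

text \<open>Since 0 is compact, \<open>S\<close> lies in its own coset; membership in the coset of
  \<open>T\<close> is the claimed decomposition.\<close>

lemma calkin_class_eqD:
  assumes "calkin_class \<rho> S = calkin_class \<rho> T"
  shows "\<exists>K\<in>compact_ops \<rho>. \<forall>f. S f = K f + T f"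
proof -
  have eq: "calkin_class \<rho> T = {(\<lambda>f. K f + T f) | K. K \<in> compact_ops \<rho>}" for T
    unfolding calkin_class_def a_r_coset_def' by (auto simp: op_ring_def)
  have "S \<in> calkin_class \<rho> S" unfolding eq using zero_compact by force
  then show ?thesis using assms unfolding eq[of T] by auto
qed

text \<open>The means tend to 0 in L2, which says nothing directly about the norm of the space. A
  subsequence tends to 0 almost everywhere, all means are bounded by the interval indicator, and
  dominated convergence in the space applies.\<close>

lemma averages_small:
  fixes q :: "nat \<Rightarrow> nat"
  assumes q: "inj q" and m: "0 < (m::nat)" and e: "0 < (e::ennreal)"
  shows "\<exists>n>0. nrm (const_L0 (inverse (of_nat n)) * (\<Sum>k<n. wave (- real (q k)) * interval_ind (real m * pi))) < e"
proof -
  define r where "r = real m * pi"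
  define w where "w n = const_L0 (inverse (of_nat (Suc n))) * (\<Sum>k<Suc n. wave (- real (q k)) * interval_ind r)" for n
  define W where "W n x = indicator {-r..r} x * ((\<Sum>k<Suc n. exp (\<i> * of_real x * of_real (- real (q k)))) / of_nat (Suc n))" for n x
  have [measurable]: "W n \<in> borel_measurable borel" for n unfolding W_def[abs_def] by measurable
  have sum_ae: "AE x in lborel. brep (\<Sum>k<N. wave (- real (q k)) * interval_ind r) x = (\<Sum>k<N. exp (\<i> * of_real x * of_real (- real (q k)))) * indicator {-r..r} x" for N
  proof (induction N)
    case 0
    then show ?case using brep_0 by simp
  next
    case (Suc N)
    show ?case
      using Suc.IH brep_plus[of "\<Sum>k<N. wave (- real (q k)) * interval_ind r" "wave (- real (q N)) * interval_ind r"]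
        brep_times[of "wave (- real (q N))" "interval_ind r"] brep_wave[of "- real (q N)"] brep_interval_ind[of r]
      by eventually_elim (simp only: sum.lessThan_Suc distrib_right)
  qed
  have w_ae: "AE x in lborel. brep (w n) x = W n x" for n
    using const_L0_mult_brep[of "inverse (of_nat (Suc n))" "\<Sum>k<Suc n. wave (- real (q k)) * interval_ind r"] sum_ae[of "Suc n"]
    unfolding w_def[symmetric] by eventually_elim (simp only: W_def divide_inverse mult_ac)
  have W_sq: "sqnorm (W n) = ennreal (2 * r / real (Suc n))" for n
    using sqnorm_exponential_mean[OF q m, of "Suc n"] by (simp add: W_def[abs_def] r_def mult.assoc)
  have int: "integrable lborel (\<lambda>x. (cmod (W n x))\<^sup>2)" for n
    using W_sq[of n] by (intro integrableI_bounded) (auto simp: sqnorm_def)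
  have "(\<integral>x. norm ((cmod (W n x))\<^sup>2) \<partial>lborel) = 2 * r / real (Suc n)" for n
  proof -
    have "ennreal (\<integral>x. (cmod (W n x))\<^sup>2 \<partial>lborel) = ennreal (2 * r / real (Suc n))"
      using nn_integral_eq_integral[OF int[of n]] W_sq[of n] by (simp add: sqnorm_def)
    then show ?thesis by (subst (asm) ennreal_inj) (auto simp: r_def)
  qed
  moreover have "(\<lambda>n. 2 * r / real (Suc n)) \<longlonglongrightarrow> 0" by real_asymp
  ultimately have "(\<lambda>n. \<integral>x. norm ((cmod (W n x))\<^sup>2) \<partial>lborel) \<longlonglongrightarrow> 0" by simp
  from tendsto_L1_AE_subseq[OF int this] obtain s where
    s: "strict_mono s" "AE x in lborel. (\<lambda>n. (cmod (W (s n) x))\<^sup>2) \<longlonglongrightarrow> 0" by blast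
  have all_ae: "AE x in lborel. \<forall>n. brep (w n) x = W n x"
    unfolding AE_all_countable using w_ae by blast
  have "(\<lambda>n. nrm (w (s n))) \<longlonglongrightarrow> 0"
  proof (rule bfs_dominated_convergence[OF interval_ind_bfs[of r]])
    show "AE x in lborel. cmod (brep (w (s n)) x) \<le> cmod (brep (interval_ind r) x)" for n
      using w_ae[of "s n"] brep_interval_ind[of r]
    proof eventually_elim
      case (elim x)
      have "cmod (\<Sum>k<Suc (s n). exp (\<i> * of_real x * of_real (- real (q k)))) \<le> real (Suc (s n))"
        using norm_sum[of "\<lambda>k. exp (\<i> * complex_of_real x * of_real (- real (q k)))" "{..<Suc (s n)}"]
        by (simp only: norm_exp_ii sum_constant card_lessThan mult_1_right)
      then have "cmod ((\<Sum>k<Suc (s n). exp (\<i> * of_real x * of_real (- real (q k)))) / of_nat (Suc (s n))) \<le> 1"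
        unfolding norm_divide norm_of_nat by (subst divide_le_eq) simp
      then have "cmod (indicator {-r..r} x) * cmod ((\<Sum>k<Suc (s n). exp (\<i> * of_real x * of_real (- real (q k)))) / of_nat (Suc (s n)))
        \<le> cmod (indicator {-r..r} x)" by (rule mult_left_le) simp
      then show ?case using elim by (simp only: W_def norm_mult)
    qed
    show "AE x in lborel. (\<lambda>n. brep (w (s n)) x) \<longlonglongrightarrow> 0"
      using s(2) all_ae
    proof eventually_elim
      case (elim x)
      have "(\<lambda>n. sqrt ((cmod (W (s n) x))\<^sup>2)) \<longlonglongrightarrow> sqrt 0" by (rule tendsto_real_sqrt[OF elim(1)])
      then have "(\<lambda>n. cmod (W (s n) x)) \<longlonglongrightarrow> 0" by simp
      then show ?case using elim(2) by (simp add: tendsto_norm_zero_iff)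
    qed
  qed
  from order_tendstoD(2)[OF this e] obtain n where "nrm (w (s n)) < e"
    using eventually_happens'[OF sequentially_bot] by blast
  then show ?thesis unfolding w_def r_def by blast
qed

text \<open>Banach-Saks averaging instead of weak convergence: the averages of the modulations are small in
  norm, so the only possible limit of their images under \<open>K\<close> is \<open>0\<close>.\<close>

lemma compact_op_modulations:
  assumes K: "K \<in> compact_ops \<rho>" and m: "0 < (m::nat)"
  shows "\<exists>q::nat \<Rightarrow> nat. strict_mono q \<and> (\<lambda>k. nrm (K (wave (- real (q k)) * interval_ind (real m * pi)))) \<longlonglongrightarrow> 0"
proof -
  define r where "r = real m * pi"
  have Kb: "K \<in> bounded_ops \<rho>" using K by (simp add: compact_ops_def)
  obtain R where R: "0 \<le> R" "nrm (interval_ind r) = ennreal R" using interval_ind_bfs[of r] by (cases "nrm (interval_ind r)") (auto simp: bfs_iff)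
  \<comment> \<open>Compactness is stated for the image of the unit ball; \<open>c\<close> scales
    the test functions into it.\<close>
  define c where "c = complex_of_real (inverse (R + 1))"
  have "inverse (R + 1) \<noteq> 0" using R by simp
  then have c0: "c \<noteq> 0" unfolding c_def by (simp only: of_real_eq_0_iff not_False_eq_True)
  define g where "g n = wave (- real n) * interval_ind r" for n
  have g: "g n \<in> bfs \<rho>" for n unfolding g_def by (rule bfs_wave[OF interval_ind_bfs])
  have cg: "const_L0 c * g n \<in> bfs \<rho>" "nrm (const_L0 c * g n) \<le> 1" for n
  proof -
    show "const_L0 c * g n \<in> bfs \<rho>" by (rule bfs_const_mult[OF g])
    have "nrm (const_L0 c * g n) = ennreal (inverse (R + 1)) * ennreal R"
      using R by (simp add: nrm_const_mult g_def nrm_wave c_def del: of_real_inverse)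
    also have "\<dots> = ennreal (inverse (R + 1) * R)" using R by (simp add: ennreal_mult)
    also have "\<dots> \<le> ennreal 1" using R by (intro ennreal_leI) (simp add: field_simps)
    finally show "nrm (const_L0 c * g n) \<le> 1" by simp
  qed
  let ?S = "bfs.mtopology closure_of (K ` {f \<in> bfs \<rho>. nrm f \<le> 1})"
  have "compactin bfs.mtopology ?S" using K by (simp add: compact_ops_def bfs_topology_eq)
  moreover have "K ` {f \<in> bfs \<rho>. nrm f \<le> 1} \<subseteq> ?S"
    by (rule closure_of_subset) (use bounded_opsD(2)[OF Kb] in auto)
  then have "range (\<lambda>n. K (const_L0 c * g n)) \<subseteq> ?S" using cg by blast
  ultimately obtain l q where l: "strict_mono q"
    "limitin bfs.mtopology ((\<lambda>n. K (const_L0 c * g n)) \<circ> q) l sequentially"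
    unfolding bfs.compactin_sequentially by blast
  have lX: "l \<in> bfs \<rho>" using l(2) by (simp add: bfs.limitin_metric)
  \<comment> \<open>The limit with the scaling by \<open>c\<close> undone.\<close>
  define L where "L = const_L0 (inverse c) * l"
  have LX: "L \<in> bfs \<rho>" unfolding L_def by (rule bfs_const_mult[OF lX])
  have KgX: "K (g n) \<in> bfs \<rho>" for n by (rule bounded_opsD(2)[OF Kb g])
  have lim: "(\<lambda>k. nrm (K (g (q k)) - L)) \<longlonglongrightarrow> 0"
  proof -
    have "(\<lambda>k. nrm (K (const_L0 c * g (q k)) - l)) \<longlonglongrightarrow> 0"
    proof (rule order_tendstoI)
      fix a :: ennreal assume "0 < a"
      obtain e :: real where e: "0 < e" "ennreal e \<le> a"
      proof (cases a)
        case (real s)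
        then show ?thesis using \<open>0 < a\<close> that[of s] by auto
      next
        case top
        then show ?thesis using that[of 1] by auto
      qed
      have "\<forall>\<^sub>F k in sequentially. K (const_L0 c * g (q k)) \<in> bfs \<rho> \<and> enn2real (nrm (K (const_L0 c * g (q k)) - l)) < e"
        using l(2) e(1) by (simp add: bfs.limitin_metric)
      then show "\<forall>\<^sub>F k in sequentially. nrm (K (const_L0 c * g (q k)) - l) < a"
      proof eventually_elim
        case (elim k)
        then have "nrm (K (const_L0 c * g (q k)) - l) < ennreal e"
          using bfs_diff[OF _ lX, of "K (const_L0 c * g (q k))"] e(1)
          by (cases "nrm (K (const_L0 c * g (q k)) - l)") (auto simp: bfs_iff ennreal_less_iff)
        then show ?case using e(2) by (rule less_le_trans)
      qed
    qed simp
    from ennreal_tendsto_cmult[OF _ this, of "ennreal (cmod (inverse c))"]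
    have "(\<lambda>k. nrm (const_L0 (inverse c) * (K (const_L0 c * g (q k)) - l))) \<longlonglongrightarrow> 0"
      by (simp add: nrm_const_mult)
    moreover have "const_L0 (inverse c) * (K (const_L0 c * g n) - l) = K (g n) - L" for n
      unfolding bounded_opsD(4)[OF Kb g] right_diff_distrib const_L0_inverse_mult[OF c0] L_def ..
    ultimately show ?thesis by simp
  qed
  obtain C where C: "0 \<le> C" "op_norm \<rho> K = ennreal C" using op_norm_finite[OF Kb] by (cases "op_norm \<rho> K") auto
  have L_le: "nrm L \<le> ennreal e" if e: "0 < e" for e :: real
  proof -
    have "0 < ennreal (e / 2)" using e by simp
    from order_tendstoD(2)[OF lim this] obtain k0 where k0: "\<And>k. k \<ge> k0 \<Longrightarrow> nrm (K (g (q k)) - L) < ennreal (e / 2)"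
      by (auto simp: eventually_sequentially)
    \<comment> \<open>Averages are taken over a tail, so that each \<open>K (g (q (k0 + k)))\<close>
      is already within \<open>e / 2\<close> of \<open>L\<close>; the shifted frequencies stay
      distinct, as \<open>averages_small\<close> requires.\<close>
    have inj: "inj (\<lambda>k. q (k0 + k))"
      using strict_mono_eq[OF l(1)] by (auto intro: injI)
    have "0 < ennreal (e / 2 / (C + 1))" using e C(1) by simp
    from averages_small[OF inj m this] obtain n where n: "0 < n"
      "nrm (const_L0 (inverse (of_nat n)) * (\<Sum>k<n. g (q (k0 + k)))) < ennreal (e / 2 / (C + 1))"
      unfolding g_def r_def by blast
    define v where "v = const_L0 (inverse (of_nat n)) * (\<Sum>k<n. g (q (k0 + k)))"
    have sumX: "(\<Sum>k<n. g (q (k0 + k))) \<in> bfs \<rho>" and Ksum: "K (\<Sum>k<n. g (q (k0 + k))) = (\<Sum>k<n. K (g (q (k0 + k))))"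
      using bounded_op_sum[of "{..<n}" K "\<lambda>k. g (q (k0 + k))"] Kb g by auto
    have vX: "v \<in> bfs \<rho>" unfolding v_def by (rule bfs_const_mult[OF sumX])
    have "nrm (K v) \<le> op_norm \<rho> K * nrm v" by (rule nrm_op_le[OF Kb vX])
    also have "\<dots> \<le> ennreal C * ennreal (e / 2 / (C + 1))" unfolding C(2) using n(2) by (intro mult_left_mono) (auto simp: v_def)
    also have "\<dots> = ennreal (C * (e / 2 / (C + 1)))" using C(1) e by (intro ennreal_mult[symmetric]) auto
    also have "\<dots> \<le> ennreal (e / 2)"
    proof (rule ennreal_leI)
      have "e / 2 * (C / (C + 1)) \<le> e / 2" using e C(1) by (intro mult_left_le) auto
      then show "C * (e / 2 / (C + 1)) \<le> e / 2" by (simp add: mult_ac)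
    qed
    finally have Kv: "nrm (K v) \<le> ennreal (e / 2)" .
    \<comment> \<open>The mean of \<open>n\<close> copies of \<open>L\<close> is \<open>L\<close>,
      so \<open>K v - L\<close> is the mean of the small differences, while \<open>K v\<close> is
      small because \<open>v\<close> is.\<close>
    have diff: "K v - L = const_L0 (inverse (of_nat n)) * (\<Sum>k<n. K (g (q (k0 + k))) - L)"
    proof -
      have "(\<Sum>k<n. L) = const_L0 (of_nat n) * L"
        by (simp add: const_L0_of_nat)
      then have "const_L0 (inverse (of_nat n)) * (\<Sum>k<n. K (g (q (k0 + k))) - L)
        = const_L0 (inverse (of_nat n)) * (\<Sum>k<n. K (g (q (k0 + k)))) - const_L0 (inverse (of_nat n)) * (const_L0 (of_nat n) * L)"
        by (simp add: sum_subtractf right_diff_distrib)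
      also have "const_L0 (inverse (of_nat n)) * (const_L0 (of_nat n) * L) = L"
        by (rule const_L0_inverse_mult) (use n(1) in simp)
      also have "const_L0 (inverse (of_nat n)) * (\<Sum>k<n. K (g (q (k0 + k)))) = K v"
        unfolding v_def by (simp only: bounded_opsD(4)[OF Kb sumX] Ksum)
      finally show ?thesis ..
    qed
    have sum_le: "nrm (\<Sum>k<N. K (g (q (k0 + k))) - L) \<le> ennreal (real N * (e / 2))" for N
    proof (induction N)
      case 0
      then show ?case using nrm_0_iff[of 0] by simp
    next
      case (Suc N)
      have "nrm (\<Sum>k<Suc N. K (g (q (k0 + k))) - L) \<le> ennreal (real N * (e / 2)) + ennreal (e / 2)"
        unfolding sum.lessThan_Suc
        by (intro order_trans[OF nrm_add] add_mono Suc.IH less_imp_le[OF k0]) simp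
      also have "\<dots> = ennreal (real N * (e / 2) + e / 2)" using e by (intro ennreal_plus[symmetric]) auto
      also have "real N * (e / 2) + e / 2 = real (Suc N) * (e / 2)" by (simp add: distrib_right add.commute)
      finally show ?case .
    qed
    have "cmod (inverse (of_nat n)) = inverse (real n)" by (simp add: norm_inverse)
    then have "nrm (K v - L) \<le> ennreal (inverse (real n)) * ennreal (real n * (e / 2))"
      unfolding diff nrm_const_mult by (simp only: mult_left_mono[OF sum_le] zero_le)
    also have "\<dots> = ennreal (inverse (real n) * (real n * (e / 2)))"
      using e by (intro ennreal_mult[symmetric]) auto
    also have "inverse (real n) * (real n * (e / 2)) = e / 2" using n(1) by simp
    finally have "nrm (K v) + nrm (K v - L) \<le> ennreal (e / 2) + ennreal (e / 2)" using Kv by (intro add_mono)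
    also have "\<dots> = ennreal e" using e by (simp flip: ennreal_plus)
    finally show ?thesis using nrm_diff[of "K v" "K v - L"] by simp
  qed
  have "nrm L \<le> 0" by (rule ennreal_le_epsilon) (simp add: L_le)
  then have "L = 0" by (simp only: le_zero_eq nrm_0_iff)
  with lim have "(\<lambda>k. nrm (K (g (q k)))) \<longlonglongrightarrow> 0" by (simp only: diff_zero)
  with l(1) show ?thesis unfolding g_def r_def by blast
qed

section \<open>Modulated convolutions and the conclusion\<close>

text \<open>The transform of the modulated function is a translate. Translating back turns the
  symbol \<open>b - beta(n)\<close> into \<open>beta(x + n) - beta(n)\<close>, which is bounded and
  tends to 0 pointwise, so dominated convergence in L2 finishes.\<close>

lemma W0_slowly_varying_modulation:
  assumes b: "b \<in> multipliers \<rho>" "b \<in> slowly_varying" and f: "f \<in> L2 \<inter> bfs \<rho>"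
  shows "\<exists>c. (\<lambda>n. sqnorm (brep (W0 \<rho> b (wave (- real n) * f) - const_L0 (c n) * (wave (- real n) * f)))) \<longlonglongrightarrow> 0"
proof -
  obtain \<beta> M where [measurable]: "\<beta> \<in> borel_measurable borel" and M: "\<And>x. cmod (\<beta> x) \<le> M" and
    ae: "AE x in lborel. brep b x = \<beta> x" and lim: "\<And>x. (\<lambda>n. \<beta> (x + real n) - \<beta> (real n)) \<longlonglongrightarrow> 0"
    using b(2) unfolding slowly_varying_def by auto
  obtain C :: real where C: "\<And>g. g \<in> L2 \<Longrightarrow> sqnorm (brep (inverse_fourier g)) \<le> ennreal C * sqnorm (brep g)"
    using sqnorm_inverse_fourier_le by blast
  define u where "u = plancherel (brep f)"
  have u: "square_integrable u" unfolding u_def using f by (intro square_integrable_plancherel) (simp add: L2_iff)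
  have [measurable]: "u \<in> borel_measurable borel" using u by (simp add: square_integrable_def)
  \<comment> \<open>The transform side of the error, already translated back by \<open>n\<close>, so
    that all \<open>d n\<close> have the common majorant \<open>2 * M * |u|\<close>.\<close>
  define d where "d n x = (\<beta> (x + real n) - \<beta> (real n)) * u x" for n x
  have [measurable]: "d n \<in> borel_measurable borel" for n unfolding d_def[abs_def] by measurable
  have "(\<lambda>n. sqnorm (d n)) \<longlonglongrightarrow> 0"
  proof (rule sqnorm_dominated[OF _ square_integrable_cmult[OF u, of "of_real (2 * M)"]])
    show "cmod (d n x) \<le> cmod (of_real (2 * M) * u x)" for n x
    proof -
      have "0 \<le> M" using order_trans[OF norm_ge_zero M] .
      have "cmod (\<beta> (x + real n) - \<beta> (real n)) \<le> 2 * M"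
        using norm_triangle_ineq4[of "\<beta> (x + real n)" "\<beta> (real n)"] M[of "x + real n"] M[of "real n"] by linarith
      then show ?thesis using \<open>0 \<le> M\<close> unfolding d_def norm_mult norm_of_real by (intro mult_right_mono) auto
    qed
    show "AE x in lborel. (\<lambda>n. d n x) \<longlonglongrightarrow> 0"
      unfolding d_def using tendsto_mult_left_zero[OF lim] by auto
  qed simp
  from ennreal_tendsto_cmult[OF _ this, of "ennreal C"]
  have lim0: "(\<lambda>n. ennreal C * sqnorm (d n)) \<longlonglongrightarrow> 0" by simp
  have "sqnorm (brep (W0 \<rho> b (wave (- real n) * f) - const_L0 (\<beta> (real n)) * (wave (- real n) * f))) \<le> ennreal C * sqnorm (d n)" for n
  proof -
    let ?g = "wave (- real n) * f" and ?c = "const_L0 (\<beta> (real n))"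
    have g: "?g \<in> L2 \<inter> bfs \<rho>" using f by (auto intro: Linf_mult_L2 wave_Linf bfs_wave)
    have L2: "b * fourier ?g \<in> L2" "?c * fourier ?g \<in> L2" "(b - ?c) * fourier ?g \<in> L2"
      using g b(1) multipliers_diff[OF b(1) multipliers_const, of "\<beta> (real n)"]
      by (auto intro!: Linf_mult_L2 multipliers_Linf fourier_L2 const_L0_Linf)
    have "W0 \<rho> b ?g - ?c * ?g = W0 \<rho> b ?g - W0 \<rho> ?c ?g"
      using g by (simp add: W0_const mult_op_def)
    also have "\<dots> = W0 \<rho> (b - ?c) ?g" using W0_diff[OF b(1) multipliers_const] by simp
    also have "\<dots> = inverse_fourier ((b - ?c) * fourier ?g)"
      by (rule W0_L2[OF multipliers_diff[OF b(1) multipliers_const] g])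
    finally have "sqnorm (brep (W0 \<rho> b ?g - ?c * ?g)) \<le> ennreal C * sqnorm (brep ((b - ?c) * fourier ?g))"
      using C[OF L2(3)] by simp
    also have "sqnorm (brep ((b - ?c) * fourier ?g)) = sqnorm (\<lambda>x. d n (x + - real n))"
    proof (rule sqnorm_cong_AE)
      show "AE x in lborel. brep ((b - ?c) * fourier ?g) x = d n (x + - real n)"
        using brep_times[of "b - ?c" "fourier ?g"] brep_minus[of b ?c] brep_const[of "\<beta> (real n)"] ae
          brep_fourier_wave[of f "- real n"] f
        by (auto simp: d_def u_def elim!: eventually_elim2)
    qed
    also have "\<dots> = sqnorm (d n)" by (rule sqnorm_translate) simp
    finally show ?thesis .
  qed
  then have "(\<lambda>n. sqnorm (brep (W0 \<rho> b (wave (- real n) * f) - const_L0 (\<beta> (real n)) * (wave (- real n) * f)))) \<longlonglongrightarrow> 0"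
    by (rule tendsto_0_le_ennreal[OF lim0])
  then show ?thesis by (rule exI[where x="\<lambda>n. \<beta> (real n)"])
qed

text \<open>With \<open>g\<close> a modulated indicator, \<open>a * g - c * g\<close> splits into a
  part \<open>y\<close> small in the space and a part \<open>z\<close> small in L2. Each may use up
  \<open>e / 2\<close> of the local L1 error.\<close>

lemma multiplication_eq_convolution_mod_compact_imp_const:
  assumes b: "b \<in> SO_diamond \<rho>" and K: "K \<in> compact_ops \<rho>"
    and eq: "\<And>f. mult_op \<rho> a f = K f + W0 \<rho> b f"
  shows "\<exists>c. a = const_L0 c"
proof -
  have Kb: "K \<in> bounded_ops \<rho>" using K by (simp add: compact_ops_def)
  have bM: "b \<in> multipliers \<rho>" and approx: "\<And>e. 0 < e \<Longrightarrow> \<exists>b'\<in>multipliers \<rho> \<inter> slowly_varying. mnorm (b - b') < ennreal e"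
    using SO_diamond_approx[OF b] by auto
  have local: "\<exists>c. AE x in lborel. x \<in> {- (real m * pi)..real m * pi} \<longrightarrow> brep a x = c" if m: "0 < m" for m :: nat
  proof (rule AE_const_on_interval)
    define r where "r = real m * pi"
    show "0 < real m * pi" using m by simp
    fix e :: real assume e: "0 < e"
    obtain C where C: "0 < C" "\<And>f. (\<integral>\<^sup>+x. ennreal (cmod (brep f x)) * indicator {-r..r} x \<partial>lborel) \<le> ennreal C * nrm f"
      using local_integral_le by blast
    obtain q where q: "strict_mono q" "(\<lambda>k. nrm (K (wave (- real (q k)) * interval_ind r))) \<longlonglongrightarrow> 0"
      using compact_op_modulations[OF K m] unfolding r_def by blast
    obtain R where R: "0 \<le> R" "nrm (interval_ind r) = ennreal R" using interval_ind_bfs[of r] by (cases "nrm (interval_ind r)") (auto simp: bfs_iff)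
    \<comment> \<open>\<open>C\<close> is the constant of (A5) and \<open>R\<close> the norm of the
      test function: this tolerance contributes at most \<open>e / 4\<close> to the L1 error, as
      does the compact part.\<close>
    have "0 < e / (4 * C * (R + 1))" using e C R by simp
    then obtain b' where b': "b' \<in> multipliers \<rho>" "b' \<in> slowly_varying" "mnorm (b - b') < ennreal (e / (4 * C * (R + 1)))"
      using approx by blast
    obtain c where c: "(\<lambda>n. sqnorm (brep (W0 \<rho> b' (wave (- real n) * interval_ind r) - const_L0 (c n) * (wave (- real n) * interval_ind r)))) \<longlonglongrightarrow> 0"
      using W0_slowly_varying_modulation[OF b'(1,2), of "interval_ind r"] interval_ind_L2 interval_ind_bfs by blast
    have c_q: "(\<lambda>k. sqnorm (brep (W0 \<rho> b' (wave (- real (q k)) * interval_ind r) - const_L0 (c (q k)) * (wave (- real (q k)) * interval_ind r)))) \<longlonglongrightarrow> 0"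
      using LIMSEQ_subseq_LIMSEQ[OF c q(1)] by (simp add: o_def)
    have r0: "0 < r" using m by (simp add: r_def)
    \<comment> \<open>The second number is fitted to Cauchy-Schwarz against the indicator, whose
      squared norm is \<open>2 * r\<close>; the product is \<open>(e / 2)^2\<close>.\<close>
    have "0 < ennreal (e / (4 * C))" "0 < ennreal ((e / 2)\<^sup>2 / (2 * r))" using e C r0 by auto
    from order_tendstoD(2)[OF q(2) this(1)] order_tendstoD(2)[OF c_q this(2)]
    have "\<forall>\<^sub>F k in sequentially. nrm (K (wave (- real (q k)) * interval_ind r)) < ennreal (e / (4 * C)) \<and>
       sqnorm (brep (W0 \<rho> b' (wave (- real (q k)) * interval_ind r) - const_L0 (c (q k)) * (wave (- real (q k)) * interval_ind r))) < ennreal ((e / 2)\<^sup>2 / (2 * r))"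
      by (rule eventually_conj)
    then obtain n where n: "nrm (K (wave (- real n) * interval_ind r)) < ennreal (e / (4 * C))"
      "sqnorm (brep (W0 \<rho> b' (wave (- real n) * interval_ind r) - const_L0 (c n) * (wave (- real n) * interval_ind r))) < ennreal ((e / 2)\<^sup>2 / (2 * r))"
      using eventually_happens'[OF sequentially_bot] by blast
    define g where "g = wave (- real n) * interval_ind r"
    have g: "g \<in> bfs \<rho>" "nrm g = ennreal R" unfolding g_def by (auto simp: bfs_wave interval_ind_bfs nrm_wave R)
    define z where "z = W0 \<rho> b' g - const_L0 (c n) * g"
    define y where "y = K g + W0 \<rho> (b - b') g"
    have "a * g - const_L0 (c n) * g = y + z"
      using eq[of g] g W0_diff[OF bM b'(1), of g] by (simp add: mult_op_def y_def z_def)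
    then have decomp: "AE x in lborel. brep (a * g - const_L0 (c n) * g) x = brep y x + brep z x"
      using brep_plus[of y z] by simp
    have pointwise: "AE x in lborel. ennreal (cmod (brep a x - c n)) * indicator {-r..r} x \<le>
       ennreal (cmod (brep y x)) * indicator {-r..r} x + ennreal (cmod (brep z x * indicator {-r..r} x))"
      using decomp brep_minus[of "a * g" "const_L0 (c n) * g"] brep_times[of a g] const_L0_mult_brep[of "c n" g]
        brep_times[of "wave (- real n)" "interval_ind r"] brep_wave[of "- real n"] brep_interval_ind[of r]
    proof eventually_elim
      case (elim x)
      show ?case
      proof (cases "x \<in> {-r..r}")
        case True
        then have "cmod (brep g x) = 1" using elim by (simp add: g_def norm_mult)
        then have "cmod (brep a x - c n) = cmod ((brep a x - c n) * brep g x)" by (simp add: norm_mult)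
        also have "(brep a x - c n) * brep g x = brep y x + brep z x" using elim by (simp add: left_diff_distrib)
        finally have "cmod (brep a x - c n) \<le> cmod (brep y x) + cmod (brep z x)" by (simp add: norm_triangle_ineq)
        then show ?thesis using True by (simp flip: ennreal_plus add: ennreal_leI)
      qed simp
    qed
    have "(\<integral>\<^sup>+x. ennreal (cmod (brep a x - c n)) * indicator {-r..r} x \<partial>lborel) \<le>
      (\<integral>\<^sup>+x. ennreal (cmod (brep y x)) * indicator {-r..r} x + ennreal (cmod (brep z x * indicator {-r..r} x)) \<partial>lborel)"
      by (rule nn_integral_mono_AE[OF pointwise])
    also have "\<dots> = (\<integral>\<^sup>+x. ennreal (cmod (brep y x)) * indicator {-r..r} x \<partial>lborel) + (\<integral>\<^sup>+x. ennreal (cmod (brep z x * indicator {-r..r} x)) \<partial>lborel)"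
      by (rule nn_integral_add) auto
    also have "\<dots> \<le> ennreal (e / 2) + ennreal (e / 2)"
    proof (rule add_mono)
      have "nrm y \<le> ennreal (e / (4 * C)) + ennreal (e / (4 * C * (R + 1))) * ennreal R"
        unfolding y_def
      proof (intro order_trans[OF nrm_add] add_mono)
        show "nrm (K g) \<le> ennreal (e / (4 * C))" using n(1) by (simp add: g_def)
        have "nrm (W0 \<rho> (b - b') g) \<le> mnorm (b - b') * nrm g"
          by (rule nrm_W0_le[OF multipliers_diff[OF bM b'(1)] g(1)])
        also have "\<dots> \<le> ennreal (e / (4 * C * (R + 1))) * ennreal R"
          unfolding g(2) using b'(3) by (intro mult_right_mono) auto
        finally show "nrm (W0 \<rho> (b - b') g) \<le> \<dots>" .
      qed
      also have "\<dots> = ennreal (e / (4 * C) + e / (4 * C * (R + 1)) * R)"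
      proof -
        have "ennreal u + ennreal v * ennreal R = ennreal (u + v * R)" if "0 \<le> u" "0 \<le> v" for u v
          using R that by (simp add: ennreal_mult)
        then show ?thesis using e C R by simp
      qed
      also have "\<dots> \<le> ennreal (e / (2 * C))"
      proof (rule ennreal_leI)
        have "e / (4 * C) * (R / (R + 1)) \<le> e / (4 * C)" using e C R by (intro mult_left_le) auto
        then have "e / (4 * C * (R + 1)) * R \<le> e / (4 * C)" by simp
        moreover have "e / (4 * C) + e / (4 * C) = e / (2 * C)" using C by (simp add: field_simps)
        ultimately show "e / (4 * C) + e / (4 * C * (R + 1)) * R \<le> e / (2 * C)" by linarith
      qed
      finally have "ennreal C * nrm y \<le> ennreal C * ennreal (e / (2 * C))" by (rule mult_left_mono) simp
      also have "\<dots> = ennreal (C * (e / (2 * C)))" using e C by (intro ennreal_mult[symmetric]) auto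
      also have "C * (e / (2 * C)) = e / 2" using C by simp
      finally show "(\<integral>\<^sup>+x. ennreal (cmod (brep y x)) * indicator {-r..r} x \<partial>lborel) \<le> ennreal (e / 2)"
        using C(2)[of y] by (rule order_trans[rotated])
      have "(\<integral>\<^sup>+x. ennreal (cmod (brep z x * indicator {-r..r} x)) \<partial>lborel)\<^sup>2 \<le> sqnorm (brep z) * sqnorm (indicator {-r..r})"
        by (rule nn_integral_mult_sqnorm) auto
      also have "sqnorm (indicator {-r..r}) = ennreal (2 * r)"
      proof -
        have "sqnorm (indicator {-r..r}) = (\<integral>\<^sup>+x. indicator {-r..r} x \<partial>lborel)"
          unfolding sqnorm_def by (intro nn_integral_cong) (auto simp: indicator_def)
        then show ?thesis using r0 by simp
      qed
      also have "sqnorm (brep z) * ennreal (2 * r) \<le> ennreal ((e / 2)\<^sup>2 / (2 * r)) * ennreal (2 * r)"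
        using n(2) by (intro mult_right_mono) (auto simp: z_def g_def)
      also have "\<dots> = ennreal ((e / 2)\<^sup>2 / (2 * r) * (2 * r))" using r0 by (intro ennreal_mult[symmetric]) auto
      also have "(e / 2)\<^sup>2 / (2 * r) * (2 * r) = (e / 2)\<^sup>2" using r0 by simp
      finally show "(\<integral>\<^sup>+x. ennreal (cmod (brep z x * indicator {-r..r} x)) \<partial>lborel) \<le> ennreal (e / 2)"
        by (rule le_ennreal_if_power2_le) (use e in simp)
    qed
    also have "\<dots> = ennreal e" using e by (simp flip: ennreal_plus)
    finally show "\<exists>c. (\<integral>\<^sup>+x. ennreal (cmod (brep a x - c)) * indicator {- (real m * pi)..real m * pi} x \<partial>lborel) \<le> ennreal e"
      unfolding r_def by blast
  qed simp
  then obtain c where c: "\<And>m::nat. 0 < m \<Longrightarrow> AE x in lborel. x \<in> {- (real m * pi)..real m * pi} \<longrightarrow> brep a x = c m"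
    by metis
  \<comment> \<open>All the intervals contain the first one, which has positive measure, so their
    constants agree.\<close>
  have c1: "c m = c 1" if m: "0 < m" for m
  proof (rule ccontr)
    assume ne: "c m \<noteq> c 1"
    have "AE x in lborel. x \<notin> {-pi..pi}"
      using c[OF m] c[OF zero_less_one]
    proof eventually_elim
      case (elim x)
      have le: "1 * pi \<le> real m * pi" using m by (intro mult_right_mono) auto
      show ?case
      proof
        assume "x \<in> {-pi..pi}"
        then have "x \<in> {- (real m * pi)..real m * pi}" "x \<in> {- (real 1 * pi)..real 1 * pi}"
          unfolding atLeastAtMost_iff using le by linarith+
        with elim ne show False by metis
      qed
    qed
    then have "{-pi..pi} \<in> null_sets lborel" by (subst AE_iff_null_sets) auto
    then have "emeasure lborel {-pi..pi} = 0" by (rule null_setsD1)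
    then show False by simp
  qed
  have "AE x in lborel. \<forall>m::nat. 0 < m \<longrightarrow> x \<in> {- (real m * pi)..real m * pi} \<longrightarrow> brep a x = c 1"
    unfolding AE_all_countable
  proof
    fix m :: nat
    show "AE x in lborel. 0 < m \<longrightarrow> x \<in> {- (real m * pi)..real m * pi} \<longrightarrow> brep a x = c 1"
      using c[of m] c1[of m] by (cases "0 < m") auto
  qed
  with brep_const[of "c 1"] have "AE x in lborel. brep a x = brep (const_L0 (c 1)) x"
  proof eventually_elim
    case (elim x)
    obtain m :: nat where m: "\<bar>x\<bar> \<le> real m" using real_arch_simple by blast
    \<comment> \<open>\<open>Suc m\<close> avoids the excluded index 0, and \<open>pi >= 1\<close>
      makes the interval reach \<open>x\<close>.\<close>
    have "real m * 1 \<le> real (Suc m) * pi" using pi_ge_two by (intro mult_mono) auto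
    then have "x \<in> {- (real (Suc m) * pi)..real (Suc m) * pi}" using m by auto
    then show ?case using elim by (metis zero_less_Suc)
  qed
  then show ?thesis unfolding L0_eq_iff[symmetric] by blast
qed

end

theorem theorem1p1:
  fixes \<rho> :: "(real \<Rightarrow> ennreal) \<Rightarrow> ennreal" and \<Phi> :: "L0 set"
  assumes "banach_function_norm \<rho>"
    and "separable_space (bfs_topology \<rho>)"
    and "maximal_bounded \<rho>"
    and "maximal_bounded (associate_norm \<rho>)"
    and "unital_Cstar_subalgebra \<Phi>"
  shows "MO_pi \<rho> \<Phi> \<inter> CO_pi \<rho> (SO_diamond \<rho>) = MO_pi \<rho> (range const_L0)"
proof -
  interpret separable_bfs \<rho>
    by (intro separable_bfs.intro banach_function_space.intro separable_bfs_axioms.intro assms)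
  show ?thesis
  proof (intro equalityI subsetI IntI)
    fix A assume "A \<in> MO_pi \<rho> \<Phi> \<inter> CO_pi \<rho> (SO_diamond \<rho>)"
    then obtain a b where A: "A = calkin_class \<rho> (mult_op \<rho> a)" "A = calkin_class \<rho> (W0 \<rho> b)" "b \<in> SO_diamond \<rho>"
      unfolding MO_pi_def CO_pi_def by blast
    then obtain K where "K \<in> compact_ops \<rho>" "\<And>f. mult_op \<rho> a f = K f + W0 \<rho> b f"
      using calkin_class_eqD[of "mult_op \<rho> a" "W0 \<rho> b"] by auto
    then obtain c where "a = const_L0 c"
      using multiplication_eq_convolution_mod_compact_imp_const[OF A(3)] by blast
    then show "A \<in> MO_pi \<rho> (range const_L0)" using A(1) unfolding MO_pi_def by blast
  next
    fix A assume "A \<in> MO_pi \<rho> (range const_L0)"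
    then obtain c where A: "A = calkin_class \<rho> (mult_op \<rho> (const_L0 c))" unfolding MO_pi_def by blast
    \<comment> \<open>The constant is written as a multiple of the unit, the form in which a unital
      subalgebra is known to contain it.\<close>
    have "const_L0 c * 1 \<in> \<Phi>"
      using assms(5) unfolding unital_Cstar_subalgebra_def complex_subalgebra_def by blast
    then show "A \<in> MO_pi \<rho> \<Phi>" unfolding A MO_pi_def by auto
    show "A \<in> CO_pi \<rho> (SO_diamond \<rho>)"
      unfolding A CO_pi_def W0_const[symmetric] using const_SO_diamond by blast
  qed
qed

end
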